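(* Let $H=\operatorname{SL}_2(\mathbb{C})$, let $V$ be a finite-dimensional $H$-module with $V^H=(0)$, and let $v\in V$. Then the subgroup $G\subset\operatorname{Aff}(V)$ of affine transformations preserving $Hv$ is contained in $\operatorname{GL}(V)$.
   Context: $\operatorname{Aff}(V)=\operatorname{GL}(V)\ltimes V$ is the group of affine transformations $x\mapsto Ax+c$ of $V$. *)

theory Defs
  imports "HOL-Analysis.Analysis"
begin

definition SL2 :: "(complex^2^2) set" where
  "SL2 = {A. det A = 1}"

definition regular_on_SL2 :: "(complex^2^2 \<Rightarrow> complex) \<Rightarrow> bool" where
  "regular_on_SL2 f \<longleftrightarrow>
     (\<exists>(N::nat) (coef :: nat \<Rightarrow> nat \<Rightarrow> nat \<Rightarrow> nat \<Rightarrow> complex).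
        \<forall>A\<in>SL2. f A = (\<Sum>a\<le>N. \<Sum>b\<le>N. \<Sum>c\<le>N. \<Sum>d\<le>N.
            coef a b c d * (A$1$1)^a * (A$1$2)^b * (A$2$1)^c * (A$2$2)^d))"

definition SL2_module :: "(complex^2^2 \<Rightarrow> complex^'n^'n) \<Rightarrow> bool" where
  "SL2_module \<rho> \<longleftrightarrow>
     (\<forall>A\<in>SL2. \<forall>B\<in>SL2. \<rho> (A ** B) = \<rho> A ** \<rho> B) \<and>
     \<rho> (mat 1) = mat 1 \<and>
     (\<forall>i j. regular_on_SL2 (\<lambda>A. \<rho> A $ i $ j))"

definition SL2_orbit :: "(complex^2^2 \<Rightarrow> complex^'n^'n) \<Rightarrow> complex^'n \<Rightarrow> (complex^'n) set" where
  "SL2_orbit \<rho> v = {\<rho> h *v v | h. h \<in> SL2}"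

definition affine_stabilizer :: "(complex^'n) set \<Rightarrow> ((complex^'n^'n) \<times> (complex^'n)) set" where
  "affine_stabilizer S = {(M, c). invertible M \<and> (\<lambda>x. M *v x + c) ` S = S}"

end

theory Submission
  imports Defs "HOL-Complex_Analysis.Cauchy_Integral_Formula" "HOL-Computational_Algebra.Fundamental_Theorem_Algebra"
begin

text \<open>
  Write \<open>X = Hv\<close> and let \<open>g(x) = Mx + c\<close> preserve \<open>X\<close>.

  If some nonzero nilpotent element of the Lie algebra kills a point of \<open>X\<close>, that point is a sum of
  highest weight vectors of positive weight; then \<open>0\<close> is the only point of the closure of \<open>X\<close>
  outside \<open>X\<close>, so \<open>g\<close> fixes it.

  Otherwise the stabilizers are finite or finite extensions of a torus, and \<open>X\<close> carries a nowhere
  vanishing \<open>H\<close>-invariant volume form (defined up to sign) whose square is polynomial on \<open>V\<close>. Let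
  \<open>u(t)\<close> be the upper or the lower unipotent one-parameter subgroup. The Jacobian of
  \<open>g u(t) g\<^sup>-\<^sup>1\<close> with respect to this form is, up to squaring, a rational function of \<open>t\<close> without
  zeros and poles, hence constant: the affine vector field \<open>Bx + b\<close> generating this group is divergence
  free. Pulled back to \<open>H\<close>, each coordinate of \<open>B(hv) + b\<close> is a sum of derivatives of regular functions
  along invariant vector fields. The invariant mean on regular functions (integration over
  \<open>SU(2)\<close>, realized below by roots of unity and a beta integral) annihilates such derivatives, and it
  annihilates the coordinates of \<open>hv\<close> as \<open>V\<^sup>H = 0\<close>. Thus \<open>b = 0\<close>, which says that the generator of
  \<open>u\<close> kills \<open>M\<^sup>-\<^sup>1c\<close>. Both unipotent subgroups together generate \<open>H\<close>, so \<open>c = 0\<close>.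
\<close>

section \<open>Polynomial functions on two-by-two matrices\<close>

text \<open>The volume argument is an integration by parts: a divergence free field
  \<open>\<xi>(x) = Bx + b\<close> satisfies \<open>\<xi>(x_i) = div (x_i \<xi>)\<close>, and the
  right side has mean zero. It depends on the orbit being \<open>H\<close> modulo a reductive group.
  On the orbit of nonzero vectors in the standard module \<open>C^2\<close>, constant fields are
  divergence free as well; what excludes translations there is the missing point 0. The form is
  fixed only up to sign because a stabilizer may contain elements that invert its torus, hence the
  squares throughout. The main obstacle is that \<open>X\<close> is treated as a bare set, not as a
  submanifold of \<open>V\<close>, so it has to be proved that an affine bijection of
  \<open>X\<close> respects tangent spaces. Holomorphic curves inside \<open>X\<close> serve this
  purpose: their velocities are shown to lie in the image of the Lie algebra at the point they pass
  through.\<close>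

definition mat2 :: "complex \<Rightarrow> complex \<Rightarrow> complex \<Rightarrow> complex \<Rightarrow> complex^2^2" where
  "mat2 a b c d = vector [vector [a, b], vector [c, d]]"

lemma mat2_nth [simp]:
  "mat2 a b c d $ 1 $ 1 = a" "mat2 a b c d $ 1 $ 2 = b"
  "mat2 a b c d $ 2 $ 1 = c" "mat2 a b c d $ 2 $ 2 = d"
  by (simp_all add: mat2_def)

lemma mat2_eq_iff:
  "A = (B :: complex^2^2) \<longleftrightarrow> A$1$1 = B$1$1 \<and> A$1$2 = B$1$2 \<and> A$2$1 = B$2$1 \<and> A$2$2 = B$2$2"
  by (auto simp: vec_eq_iff forall_2)

lemma mat2_mult: "A ** (B :: complex^2^2) = mat2 (A$1$1 * B$1$1 + A$1$2 * B$2$1) (A$1$1 * B$1$2 + A$1$2 * B$2$2)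
    (A$2$1 * B$1$1 + A$2$2 * B$2$1) (A$2$1 * B$1$2 + A$2$2 * B$2$2)"
  by (simp add: mat2_eq_iff matrix_matrix_mult_def sum_2)

lemma mat2_one: "mat 1 = mat2 1 0 0 1"
  by (simp add: mat2_eq_iff mat_def)

lemma mem_SL2_iff: "A \<in> SL2 \<longleftrightarrow> A$1$1 * A$2$2 - A$1$2 * A$2$1 = 1"
  by (simp add: SL2_def det_2)

text \<open>These are functions on all matrices rather than on \<open>SL2\<close>, so that
  derivatives can be taken along lines \<open>1 + sX\<close>, which leave the group. Induction
  reduces statements about derivatives and means to single monomials.\<close>

inductive polyfun2 :: "(complex^2^2 \<Rightarrow> complex) \<Rightarrow> bool" where
  monomial: "polyfun2 (\<lambda>A. c * A$1$1^i * A$1$2^j * A$2$1^k * A$2$2^l)"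
| add: "polyfun2 f \<Longrightarrow> polyfun2 g \<Longrightarrow> polyfun2 (\<lambda>A. f A + g A)"

lemma polyfun2_const: "polyfun2 (\<lambda>A. c)"
  using polyfun2.monomial[of c 0 0 0 0] by simp

lemma polyfun2_coord: "polyfun2 (\<lambda>A. A$i$j)"
proof -
  have "polyfun2 (\<lambda>A. A$1$1)" "polyfun2 (\<lambda>A. A$1$2)" "polyfun2 (\<lambda>A. A$2$1)" "polyfun2 (\<lambda>A. A$2$2)"
    using polyfun2.monomial[of 1 1 0 0 0] polyfun2.monomial[of 1 0 1 0 0]
      polyfun2.monomial[of 1 0 0 1 0] polyfun2.monomial[of 1 0 0 0 1] by simp_all
  then show ?thesis
    using exhaust_2[of i] exhaust_2[of j] by auto
qed

lemma polyfun2_monomial_mult: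
  assumes "polyfun2 f"
  shows "polyfun2 (\<lambda>A. (c * A$1$1^i * A$1$2^j * A$2$1^k * A$2$2^l) * f A)"
  using assms
proof induction
  case (monomial c' i' j' k' l')
  have "polyfun2 (\<lambda>A. (c*c') * A$1$1^(i+i') * A$1$2^(j+j') * A$2$1^(k+k') * A$2$2^(l+l'))"
    by (rule polyfun2.monomial)
  then show ?case by (simp add: power_add mult_ac)
next
  case (add f g)
  then show ?case using polyfun2.add[OF add.IH] by (simp add: distrib_left)
qed

lemma polyfun2_mult:
  assumes "polyfun2 f" "polyfun2 g"
  shows "polyfun2 (\<lambda>A. f A * g A)"
  using assms(1)
proof induction
  case (monomial c i j k l)
  then show ?case using polyfun2_monomial_mult[OF assms(2)] by simp
next
  case (add f' g')
  then show ?case using polyfun2.add[OF add.IH] by (simp add: distrib_right)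
qed

lemma polyfun2_sum:
  assumes "\<And>x. x \<in> S \<Longrightarrow> polyfun2 (f x)"
  shows "polyfun2 (\<lambda>A. \<Sum>x\<in>S. f x A)"
  using assms
  by (induction S rule: infinite_finite_induct) (auto intro: polyfun2_const polyfun2.add)

lemma polyfun2_power: "polyfun2 f \<Longrightarrow> polyfun2 (\<lambda>A. f A ^ n)"
  by (induction n) (auto intro: polyfun2_const polyfun2_mult)

lemmas polyfun2_intros = polyfun2_const polyfun2_coord polyfun2.add polyfun2_mult polyfun2_sum
  polyfun2_power

lemma polyfun2_compose:
  assumes "polyfun2 f" "\<And>i j. polyfun2 (\<lambda>A. T A $ i $ j)"
  shows "polyfun2 (\<lambda>A. f (T A))"
  using assms(1) by induction (auto intro!: polyfun2_intros assms(2))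

text \<open>One induction for all classes of scalar functions that contain the constants and are
  closed under sums and products; continuous, differentiable, holomorphic, polynomial and Laurent
  polynomial functions are instances below.\<close>

lemma polyfun2_closed:
  assumes "polyfun2 f"
    and "\<And>c. Q (\<lambda>s. c)" "\<And>f g. Q f \<Longrightarrow> Q g \<Longrightarrow> Q (\<lambda>s. f s + g s)"
    and m: "\<And>f g. Q f \<Longrightarrow> Q g \<Longrightarrow> Q (\<lambda>s. f s * g s :: complex)"
    and T: "\<And>i j. Q (\<lambda>s. T s $ i $ j)"
  shows "Q (\<lambda>s. f (T s))"
proof -
  have p: "Q (\<lambda>s. T s $ i $ j ^ n)" for i j n
    by (induction n) (auto intro: assms)
  show ?thesis
    using assms(1) by induction (auto intro!: assms p)
qed

lemma polyfun2_continuous: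
  assumes "polyfun2 f" "\<And>i j. continuous_on S (\<lambda>s. T s $ i $ j)"
  shows "continuous_on S (\<lambda>s. f (T s))"
  by (rule polyfun2_closed[where Q = "continuous_on S" and T = T])
     (auto intro: assms continuous_intros)

text \<open>\<open>has_derivative\<close> is only real linear; the complex coefficients record
  complex linearity, which makes compositions with holomorphic curves complex
  differentiable.\<close>

lemma polyfun2_gradient:
  assumes "polyfun2 f"
  shows "\<exists>p q r s. (f has_derivative (\<lambda>X. p * X$1$1 + q * X$1$2 + r * X$2$1 + s * X$2$2)) (at A)"
proof -
  define Q where "Q f \<longleftrightarrow> (\<exists>p q r s. (f has_derivative
     (\<lambda>X. p * X$1$1 + q * X$1$2 + r * X$2$1 + s * X$2$2)) (at A))" for f :: "complex^2^2 \<Rightarrow> complex"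
  have coord: "((\<lambda>A::complex^2^2. A$i$j) has_derivative (\<lambda>X. X$i$j)) (at A)" for i j
    by (auto intro!: derivative_eq_intros bounded_linear_imp_has_derivative
          bounded_linear_compose[OF bounded_linear_vec_nth bounded_linear_vec_nth])
  have "Q (\<lambda>A. f A)"
  proof (rule polyfun2_closed[where Q = Q and T = "\<lambda>A. A"])
    show "Q (\<lambda>s. c)" for c
      unfolding Q_def by (rule exI[of _ 0])+ simp
    show "Q (\<lambda>s. f s + g s)" if fg: "Q f" "Q g" for f g
    proof -
      from fg obtain p q r s p' q' r' s' where
        "(f has_derivative (\<lambda>X. p * X$1$1 + q * X$1$2 + r * X$2$1 + s * X$2$2)) (at A)"
        "(g has_derivative (\<lambda>X. p' * X$1$1 + q' * X$1$2 + r' * X$2$1 + s' * X$2$2)) (at A)"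
        unfolding Q_def by blast
      from has_derivative_add[OF this] show ?thesis
        unfolding Q_def
        by (intro exI[of _ "p+p'"] exI[of _ "q+q'"] exI[of _ "r+r'"] exI[of _ "s+s'"])
           (simp add: algebra_simps)
    qed
    show "Q (\<lambda>s. f s * g s)" if fg: "Q f" "Q g" for f g
    proof -
      from fg obtain p q r s p' q' r' s' where
        "(f has_derivative (\<lambda>X. p * X$1$1 + q * X$1$2 + r * X$2$1 + s * X$2$2)) (at A)"
        "(g has_derivative (\<lambda>X. p' * X$1$1 + q' * X$1$2 + r' * X$2$1 + s' * X$2$2)) (at A)"
        unfolding Q_def by blast
      from has_derivative_mult[OF this] show ?thesis
        unfolding Q_def
        by (intro exI[of _ "p * g A + f A * p'"] exI[of _ "q * g A + f A * q'"]
              exI[of _ "r * g A + f A * r'"] exI[of _ "s * g A + f A * s'"])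
           (simp add: algebra_simps)
    qed
    show "Q (\<lambda>A. A $ i $ j)" for i j
      unfolding Q_def
      by (rule exI[of _ "of_bool (i=1\<and>j=1)"], rule exI[of _ "of_bool (i=1\<and>j=2)"],
          rule exI[of _ "of_bool (i=2\<and>j=1)"], rule exI[of _ "of_bool (i=2\<and>j=2)"])
         (use coord[of i j] exhaust_2[of i] exhaust_2[of j] in auto)
  qed (rule assms)
  then show ?thesis unfolding Q_def .
qed

lemma regular_on_SL2_polyfun2:
  assumes "regular_on_SL2 f"
  shows "\<exists>g. polyfun2 g \<and> (\<forall>A\<in>SL2. g A = f A)"
proof -
  from assms obtain N coef where f: "\<forall>A\<in>SL2. f A = (\<Sum>a\<le>N. \<Sum>b\<le>N. \<Sum>c\<le>N. \<Sum>d\<le>N.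
            coef a b c d * (A$1$1)^a * (A$1$2)^b * (A$2$1)^c * (A$2$2)^(d::nat))"
    unfolding regular_on_SL2_def by blast
  show ?thesis
    by (rule exI[of _ "\<lambda>A. \<Sum>a\<le>N. \<Sum>b\<le>N. \<Sum>c\<le>N. \<Sum>d\<le>N.
            coef a b c d * (A$1$1)^a * (A$1$2)^b * (A$2$1)^c * (A$2$2)^d"])
       (auto intro!: polyfun2_intros simp: f)
qed

text \<open>The values of \<open>cycle_point\<close> with \<open>|z| = |w| = 1\<close> replace the integration over \<open>SU(2)\<close>:
  averaging over \<open>z\<close> and \<open>w\<close> leaves only the monomials in \<open>ad\<close> and \<open>bc\<close>, and \<open>x = ad\<close> is uniformly
  distributed on \<open>[0, 1]\<close> under the Haar measure. The average over \<open>K\<close>-th roots of unity is exact only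
  once \<open>K\<close> exceeds the degrees, so statements about \<open>mean K\<close> hold eventually in \<open>K\<close>.\<close>

definition root_of_unity :: "nat \<Rightarrow> nat \<Rightarrow> complex" where
  "root_of_unity K p = cis (2 * pi * p / K)"

definition cycle_point :: "real \<Rightarrow> complex \<Rightarrow> complex \<Rightarrow> complex^2^2" where
  "cycle_point x z w = mat2 z (w * (of_real x - 1)) (1 / w) (of_real x / z)"

definition mean :: "nat \<Rightarrow> (complex^2^2 \<Rightarrow> complex) \<Rightarrow> complex" where
  "mean K f = integral {0..1} (\<lambda>x. (\<Sum>p<K. \<Sum>q<K.
     f (cycle_point x (root_of_unity K p) (root_of_unity K q))) / of_nat K ^ 2)"

lemma root_of_unity_nonzero [simp]: "root_of_unity K p \<noteq> 0"
  by (simp add: root_of_unity_def)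

lemma cycle_point_SL2: "z \<noteq> 0 \<Longrightarrow> w \<noteq> 0 \<Longrightarrow> cycle_point x z w \<in> SL2"
  by (simp add: mem_SL2_iff cycle_point_def field_simps)

text \<open>Orthogonality of the characters of the cyclic group of order \<open>K\<close>. The
  bounds give \<open>|i - l| < K\<close>, so the character is trivial only for
  \<open>i = l\<close>.\<close>

lemma sum_root_of_unity:
  assumes "i < K" "l < K"
  shows "(\<Sum>p<K. root_of_unity K p ^ i * (1 / root_of_unity K p) ^ l) = (if i = l then of_nat K else 0)"
proof (cases "i = l")
  case True
  then show ?thesis by (simp flip: power_mult_distrib)
next
  case False
  define y where "y = cis (2 * pi * (real i - real l) / K)"
  have K: "K > 0" using assms by simp
  have 1: "root_of_unity K p ^ i * (1 / root_of_unity K p) ^ l = y ^ p" for p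
  proof -
    have "1 / root_of_unity K p = cis (- (2 * pi * p / K))"
      by (simp add: root_of_unity_def cis_divide flip: cis_zero)
    then show ?thesis
      unfolding y_def root_of_unity_def Complex.DeMoivre
      by (simp add: cis_mult Complex.DeMoivre) (simp add: algebra_simps diff_divide_distrib)
  qed
  have "y ^ K = cis (2 * pi * (real i - real l))"
    using K by (simp add: y_def Complex.DeMoivre)
  also have "\<dots> = 1"
    using cis_multiple_2pi[of "real i - real l"] by simp
  finally have yK: "y ^ K = 1" .
  have "y \<noteq> 1"
  proof
    assume "y = 1"
    then have "cos (2 * pi * (real i - real l) / K) = 1"
      by (simp add: y_def complex_eq_iff)
    then obtain n :: int where "2 * pi * (real i - real l) / K = of_int n * 2 * pi"
      using cos_one_2pi_int by blast
    then have "pi * (2 * (real i - real l)) = pi * (2 * (of_int n * real K))"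
      using K by (simp add: field_simps)
    then have "real i - real l = of_int n * real K" by simp
    then have "of_int (int i - int l) = (of_int (n * int K) :: real)" by simp
    then have e: "int i - int l = n * int K" by (simp only: of_int_eq_iff)
    then have "int K dvd int i - int l" by simp
    moreover have "\<bar>int i - int l\<bar> < int K" using assms by linarith
    ultimately show False using False
      by (metis dvd_imp_le_int eq_iff_diff_eq_0 not_le of_nat_eq_iff abs_of_nat)
  qed
  then show ?thesis
    using False yK unfolding 1 by (simp add: geometric_sum)
qed

lemma mean_integrable:
  assumes "polyfun2 f"
  shows "(\<lambda>x. (\<Sum>p<K. \<Sum>q<K.
     f (cycle_point x (root_of_unity K p) (root_of_unity K q))) / of_nat K ^ 2) integrable_on {0..1}"
proof -
  have e: "continuous_on {0..1} (\<lambda>x. cycle_point x z w $ i $ j)" if "z \<noteq> 0" for z w i j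
    using exhaust_2[of i] exhaust_2[of j] that
    by (elim disjE) (simp_all add: cycle_point_def continuous_intros)
  show ?thesis
    by (cases "K = 0") (auto intro!: integrable_continuous_interval continuous_intros polyfun2_continuous assms e)
qed

lemma mean_add: "polyfun2 f \<Longrightarrow> polyfun2 g \<Longrightarrow> mean K (\<lambda>A. f A + g A) = mean K f + mean K g"
  unfolding mean_def
  by (subst integral_add[symmetric]) (auto intro!: mean_integrable integral_cong simp: sum.distrib add_divide_distrib)

lemma mean_cmult: "mean K (\<lambda>A. c * f A) = c * mean K f"
  unfolding mean_def by (simp flip: sum_distrib_left times_divide_eq_right)

lemma mean_const: "K > 0 \<Longrightarrow> mean K (\<lambda>A. c) = c"
  by (simp add: mean_def power2_eq_square)

lemma mean_sum:
  assumes "\<And>x. x \<in> S \<Longrightarrow> polyfun2 (f x)"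
  shows "mean K (\<lambda>A. \<Sum>x\<in>S. f x A) = (\<Sum>x\<in>S. mean K (f x))"
  using assms
proof (induction S rule: infinite_finite_induct)
  case (insert x S)
  then show ?case by (simp add: mean_add polyfun2_sum)
qed (simp_all add: mean_def)

lemma mean_cong: "(\<And>A. A \<in> SL2 \<Longrightarrow> f A = g A) \<Longrightarrow> mean K f = mean K g"
  unfolding mean_def by (intro integral_cong arg_cong2[of _ _ _ _ "(/)"] sum.cong) (auto simp: cycle_point_SL2)

text \<open>Up to the sign \<open>(-1)^j\<close> this is Euler's beta integral, with value
  \<open>l! j! / (l + j + 1)!\<close>.\<close>

definition beta_int :: "nat \<Rightarrow> nat \<Rightarrow> complex" where
  "beta_int l j = integral {0..1} (\<lambda>x::real. of_real x ^ l * (of_real x - 1) ^ j)"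

text \<open>The left side is the integral of the derivative of \<open>x^(l+1) * (x-1)^(j+1)\<close>,
  which vanishes at both endpoints. This relation is what makes the mean invariant.\<close>

lemma beta_int_rec: "of_nat (Suc l) * beta_int l (Suc j) + of_nat (Suc j) * beta_int (Suc l) j = 0"
proof -
  let ?f = "\<lambda>l j (x::real). (of_real x ^ l * (of_real x - 1) ^ j :: complex)"
  have i: "?f l j integrable_on {0..1}" for l j
    by (intro integrable_continuous_interval continuous_intros)
  have "((\<lambda>x. of_nat (Suc l) * ?f l (Suc j) x + of_nat (Suc j) * ?f (Suc l) j x) has_integral
      (?f (Suc l) (Suc j) 1 - ?f (Suc l) (Suc j) 0)) {0..1}"
  proof (rule fundamental_theorem_of_calculus)
    fix x :: real
    have "((\<lambda>z. z ^ Suc l * (z - 1) ^ Suc j) has_field_derivative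
        of_nat (Suc l) * (of_real x ^ l * (of_real x - 1) ^ Suc j) + of_nat (Suc j) * (of_real x ^ Suc l * (of_real x - 1) ^ j)) (at (of_real x :: complex))"
      by (rule derivative_eq_intros refl | simp)+
    from has_field_derivative_imp_has_derivative[OF this]
    show "(?f (Suc l) (Suc j) has_vector_derivative
        of_nat (Suc l) * ?f l (Suc j) x + of_nat (Suc j) * ?f (Suc l) j x) (at x within {0..1})"
      using \<open>((\<lambda>z. z ^ Suc l * (z - 1) ^ Suc j) has_field_derivative _) _\<close>
      by (intro has_vector_derivative_real_field) auto
  qed simp
  then have "integral {0..1} (\<lambda>x. of_nat (Suc l) * ?f l (Suc j) x + of_nat (Suc j) * ?f (Suc l) j x) = 0"
    by (simp add: integral_unique)
  then show ?thesis
    unfolding beta_int_def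
    by (subst (asm) integral_add) (auto simp del: of_nat_Suc power_Suc intro!: integrable_on_mult_right i)
qed

text \<open>What survives the averages over \<open>z\<close> and \<open>w\<close> is a product of
  powers of \<open>ad = x\<close> and \<open>bc = x - 1\<close>, as on \<open>SU(2)\<close>. The
  uneven split of these products between the entries of \<open>cycle_point\<close> avoids the square
  roots of \<open>x\<close> and \<open>1 - x\<close>.\<close>

lemma mean_monomial:
  assumes "i < K" "j < K" "k < K" "l < K"
  shows "mean K (\<lambda>A. c * A$1$1^i * A$1$2^j * A$2$1^k * A$2$2^l) =
    (if i = l \<and> j = k then c * beta_int l j else 0)"
proof -
  have "(\<Sum>p<K. \<Sum>q<K. c * root_of_unity K p ^ i * (root_of_unity K q * (of_real x - 1)) ^ j
       * (1 / root_of_unity K q) ^ k * (of_real x / root_of_unity K p) ^ l) / of_nat K ^ 2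
     = (if i = l \<and> j = k then c * (of_real x ^ l * (of_real x - 1) ^ j) else 0)" for x :: real
  proof -
    have "(\<Sum>p<K. \<Sum>q<K. c * root_of_unity K p ^ i * (root_of_unity K q * (of_real x - 1)) ^ j
       * (1 / root_of_unity K q) ^ k * (of_real x / root_of_unity K p) ^ l)
      = c * (of_real x ^ l * (of_real x - 1) ^ j) * (\<Sum>p<K. root_of_unity K p ^ i * (1 / root_of_unity K p) ^ l)
        * (\<Sum>q<K. root_of_unity K q ^ j * (1 / root_of_unity K q) ^ k)"
      unfolding sum_distrib_left sum_distrib_right
      by (subst sum.swap) (simp add: power_mult_distrib power_divide mult_ac)
    then show ?thesis
      using assms by (simp add: sum_root_of_unity power2_eq_square)
  qed
  then show ?thesis
    unfolding mean_def beta_int_def cycle_point_def by (cases "i = l \<and> j = k") auto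
qed

text \<open>Infinitesimal right invariance of the mean. The diagonal part multiplies a monomial by
  \<open>i - j + k - l\<close>, which is zero whenever its mean is not. Each off-diagonal part
  yields two monomials whose means cancel by \<open>beta_int_rec\<close>.\<close>

lemma polyfun2_right_derivative:
  assumes "polyfun2 f"
  shows "\<exists>g. polyfun2 g \<and>
    (\<forall>h. ((\<lambda>s. f (h ** mat2 (1 + s*z) (s*x) (s*y) (1 - s*z))) has_field_derivative g h) (at 0)) \<and>
    (\<forall>\<^sub>F K in sequentially. mean K g = 0)"
  using assms
proof induction
  case (monomial c i j k l)
  define m where "m i j k l c = (\<lambda>A::complex^2^2. c * A$1$1^i * A$1$2^j * A$2$1^k * A$2$2^l)" for i j k l c
  have mp: "polyfun2 (m i j k l c)" for i j k l c
    unfolding m_def by (rule polyfun2.monomial)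
  have mm: "mean K (m i j k l c) = (if i = l \<and> j = k then c * beta_int l j else 0)"
    if "i < K" "j < K" "k < K" "l < K" for K i j k l c
    unfolding m_def using that by (rule mean_monomial)
  define gz where "gz = m i j k l (c * z * (of_nat i - of_nat j + of_nat k - of_nat l))"
  \<comment> \<open>A truncated exponent such as \<open>j-1\<close> is harmless: for
    \<open>j = 0\<close> the coefficient vanishes.\<close>
  define gx1 where "gx1 = m (i+1) (j-1) k l (c * x * of_nat j)"
  define gx2 where "gx2 = m i j (k+1) (l-1) (c * x * of_nat l)"
  define gy1 where "gy1 = m (i-1) (j+1) k l (c * y * of_nat i)"
  define gy2 where "gy2 = m i j (k-1) (l+1) (c * y * of_nat k)"
  define g where "g = (\<lambda>A. (gz A + (gx1 A + gx2 A)) + (gy1 A + gy2 A))"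
  have "((\<lambda>s. c * (h ** mat2 (1 + s*z) (s*x) (s*y) (1 - s*z))$1$1^i * (h ** mat2 (1 + s*z) (s*x) (s*y) (1 - s*z))$1$2^j
      * (h ** mat2 (1 + s*z) (s*x) (s*y) (1 - s*z))$2$1^k * (h ** mat2 (1 + s*z) (s*x) (s*y) (1 - s*z))$2$2^l)
      has_field_derivative g h) (at 0)" for h
  proof -
    have pw: "of_nat n * a ^ n = of_nat n * a ^ (n - Suc 0) * a" for n and a :: complex
      by (cases n) auto
    have id: "c * (Ai1 * (a * z + b * y)) * B * C * E + c * A * (Bj1 * (a * x - b * z)) * C * E
        + c * A * B * (Ck1 * (u * z + v * y)) * E + c * A * B * C * (El1 * (u * x - v * z))
      = (c * z * (i - j + k - l) * A * B * C * E + (c * x * a * A * Bj1 * C * E + c * x * A * B * (u * C) * El1))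
        + (c * y * Ai1 * (b * B) * C * E + c * y * A * B * Ck1 * (v * E))"
      if "i * A = Ai1 * a" "j * B = Bj1 * b" "k * C = Ck1 * u" "l * E = El1 * v"
      for a b u v A B C E Ai1 Bj1 Ck1 El1 i j k l :: complex
      using that by algebra
    show ?thesis
      unfolding mat2_mult[of h] mat2_nth
      by (rule DERIV_cong, (rule derivative_eq_intros refl)+)
         (use id[OF pw[of i "h$1$1"] pw[of j "h$1$2"] pw[of k "h$2$1"] pw[of l "h$2$2"]]
           in \<open>simp add: g_def gz_def gx1_def gx2_def gy1_def gy2_def m_def algebra_simps\<close>)
  qed
  moreover have "polyfun2 g"
    unfolding g_def gz_def gx1_def gx2_def gy1_def gy2_def by (intro polyfun2.add mp)
  moreover have "\<forall>\<^sub>F K in sequentially. mean K g = 0"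
  \<comment> \<open>The derivative raises an exponent by at most one, so every exponent stays below
    \<open>K\<close>.\<close>
  proof (rule eventually_sequentiallyI[of "i + j + k + l + 2"])
    fix K assume K: "i + j + k + l + 2 \<le> K"
    have "mean K gz = 0" unfolding gz_def using K by (subst mm) auto
    moreover have "mean K gx1 + mean K gx2 = 0"
      proof (cases "l = Suc i \<and> j = Suc k")
      case True
      have gx1: "mean K gx1 = c * x * (of_nat (Suc k) * beta_int (Suc i) k)"
        unfolding gx1_def using True K by (subst mm) auto
      have gx2: "mean K gx2 = c * x * (of_nat (Suc i) * beta_int i (Suc k))"
        unfolding gx2_def using True K by (subst mm) auto
      show ?thesis
        using beta_int_rec[of i k]
        by (simp add: gx1 gx2 add.commute flip: distrib_left del: of_nat_Suc)
    next
      case False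
      then have "j = 0 \<or> \<not> (i + 1 = l \<and> j - 1 = k)" "l = 0 \<or> \<not> (i = l - 1 \<and> j = k + 1)" by auto
      then show ?thesis
        unfolding gx1_def gx2_def using K by (auto simp: mm)
    qed
    moreover have "mean K gy1 + mean K gy2 = 0"
    proof (cases "i = Suc l \<and> k = Suc j")
      case True
      have gy1: "mean K gy1 = c * y * (of_nat (Suc l) * beta_int l (Suc j))"
        unfolding gy1_def using True K by (subst mm) auto
      have gy2: "mean K gy2 = c * y * (of_nat (Suc j) * beta_int (Suc l) j)"
        unfolding gy2_def using True K by (subst mm) auto
      show ?thesis
        using beta_int_rec[of l j]
        by (simp add: gy1 gy2 add.commute flip: distrib_left del: of_nat_Suc)
    next
      case False
      then have "i = 0 \<or> \<not> (i - 1 = l \<and> j + 1 = k)" "k = 0 \<or> \<not> (i = l + 1 \<and> j = k - 1)" by auto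
      then show ?thesis
        unfolding gy1_def gy2_def using K by (auto simp: mm)
    qed
    ultimately show "mean K g = 0"
      unfolding g_def by (simp add: mean_add polyfun2.add mp gz_def gx1_def gx2_def gy1_def gy2_def)
  qed
  ultimately show ?case by blast
next
  case (add f1 f2)
  then obtain g1 g2 where g:
    "polyfun2 g1" "\<And>h. ((\<lambda>s. f1 (h ** mat2 (1 + s*z) (s*x) (s*y) (1 - s*z))) has_field_derivative g1 h) (at 0)"
    "\<forall>\<^sub>F K in sequentially. mean K g1 = 0"
    "polyfun2 g2" "\<And>h. ((\<lambda>s. f2 (h ** mat2 (1 + s*z) (s*x) (s*y) (1 - s*z))) has_field_derivative g2 h) (at 0)"
    "\<forall>\<^sub>F K in sequentially. mean K g2 = 0"
    by blast
  show ?case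
  proof (intro exI[of _ "\<lambda>A. g1 A + g2 A"] conjI allI)
    show "\<forall>\<^sub>F K in sequentially. mean K (\<lambda>A. g1 A + g2 A) = 0"
      using g(3,6) by eventually_elim (simp add: mean_add g)
  qed (auto intro: polyfun2.add DERIV_add g)
qed

lemma polyfun2_transpose: "polyfun2 f \<Longrightarrow> polyfun2 (\<lambda>A. f (transpose A))"
  by (erule polyfun2_compose) (simp add: transpose_def polyfun2_coord)

text \<open>Transposition swaps the exponents \<open>j\<close> and \<open>k\<close>, and only
  monomials with \<open>j = k\<close> have a nonzero mean.\<close>

lemma mean_transpose:
  assumes "polyfun2 f"
  shows "\<forall>\<^sub>F K in sequentially. mean K (\<lambda>A. f (transpose A)) = mean K f"
  using assms
proof induction
  case (monomial c i j k l)
  show ?case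
  proof (rule eventually_sequentiallyI[of "i + j + k + l + 1"])
    fix K assume K: "i + j + k + l + 1 \<le> K"
    have "(\<lambda>A::complex^2^2. c * transpose A$1$1^i * transpose A$1$2^j * transpose A$2$1^k * transpose A$2$2^l)
        = (\<lambda>A. c * A$1$1^i * A$1$2^k * A$2$1^j * A$2$2^l)"
      by (simp add: transpose_def mult_ac)
    then show "mean K (\<lambda>A. c * transpose A$1$1^i * transpose A$1$2^j * transpose A$2$1^k * transpose A$2$2^l)
        = mean K (\<lambda>A. c * A$1$1^i * A$1$2^j * A$2$1^k * A$2$2^l)"
      using K by (simp add: mean_monomial)
  qed
next
  case (add f g)
  then have "\<forall>\<^sub>F K in sequentially. mean K (\<lambda>A. f (transpose A)) = mean K f \<and> mean K (\<lambda>A. g (transpose A)) = mean K g"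
    by (simp add: eventually_conj)
  then show ?case
    by eventually_elim (simp add: mean_add add polyfun2_transpose)
qed

text \<open>Transposition turns left into right multiplication and exchanges the off-diagonal
  coordinates \<open>x\<close> and \<open>y\<close>.\<close>

lemma polyfun2_left_derivative:
  assumes "polyfun2 f"
  shows "\<exists>g. polyfun2 g \<and>
    (\<forall>h. ((\<lambda>s. f (mat2 (1 + s*z) (s*x) (s*y) (1 - s*z) ** h)) has_field_derivative g h) (at 0)) \<and>
    (\<forall>\<^sub>F K in sequentially. mean K g = 0)"
proof -
  obtain g where g: "polyfun2 g"
    "\<And>h. ((\<lambda>s. f (transpose (h ** mat2 (1 + s*z) (s*y) (s*x) (1 - s*z)))) has_field_derivative g h) (at 0)"
    "\<forall>\<^sub>F K in sequentially. mean K g = 0"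
    using polyfun2_right_derivative[OF polyfun2_transpose[OF assms], of z y x] by blast
  have t: "transpose (transpose h ** mat2 (1 + s*z) (s*y) (s*x) (1 - s*z)) = mat2 (1 + s*z) (s*x) (s*y) (1 - s*z) ** h"
    for h :: "complex^2^2" and s by (simp add: mat2_eq_iff mat2_mult transpose_def mult_ac)
  have "\<forall>\<^sub>F K in sequentially. mean K (\<lambda>A. g (transpose A)) = 0"
    using g(3) mean_transpose[OF g(1)] by eventually_elim simp
  then show ?thesis
    using g(2)[of "transpose _"] polyfun2_transpose[OF g(1)] unfolding t by blast
qed

section \<open>Rational representations and their differential\<close>

lemma has_derivative_vecI:
  fixes f :: "'a::real_normed_vector \<Rightarrow> 'b::euclidean_space ^ 'n"
  assumes "\<And>i. ((\<lambda>x. f x $ i) has_derivative (\<lambda>h. f' h $ i)) (at a within S)"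
  shows "(f has_derivative f') (at a within S)"
  by (subst has_derivative_componentwise_within)
     (auto simp: Basis_vec_def inner_axis intro!: has_derivative_inner_left assms)

definition has_mderiv :: "(complex \<Rightarrow> complex^'m^'n) \<Rightarrow> complex^'m^'n \<Rightarrow> complex \<Rightarrow> bool" where
  "has_mderiv A A' t \<longleftrightarrow> (\<forall>i j. ((\<lambda>s. A s $ i $ j) has_field_derivative A' $ i $ j) (at t))"

definition has_vderiv :: "(complex \<Rightarrow> complex^'n) \<Rightarrow> complex^'n \<Rightarrow> complex \<Rightarrow> bool" where
  "has_vderiv x x' t \<longleftrightarrow> (\<forall>i. ((\<lambda>s. x s $ i) has_field_derivative x' $ i) (at t))"

lemma has_mderiv_const: "has_mderiv (\<lambda>s. A) 0 t"
  by (simp add: has_mderiv_def)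

lemma has_vderiv_const: "has_vderiv (\<lambda>s. x) 0 t"
  by (simp add: has_vderiv_def)

lemma has_vderiv_add: "has_vderiv x x' t \<Longrightarrow> has_vderiv y y' t \<Longrightarrow> has_vderiv (\<lambda>s. x s + y s) (x' + y') t"
  by (auto simp: has_vderiv_def intro!: derivative_intros)

lemma has_mderiv_mult:
  assumes "has_mderiv A A' t" "has_mderiv B B' t"
  shows "has_mderiv (\<lambda>s. A s ** B s) (A' ** B t + A t ** B') t"
  using assms unfolding has_mderiv_def matrix_matrix_mult_def
  by (auto intro!: derivative_eq_intros simp: mult_ac add_ac sum.distrib)

lemma has_vderiv_mult:
  assumes "has_mderiv A A' t" "has_vderiv x x' t"
  shows "has_vderiv (\<lambda>s. A s *v x s) (A' *v x t + A t *v x') t"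
  using assms unfolding has_mderiv_def has_vderiv_def matrix_vector_mult_def
  by (auto intro!: derivative_eq_intros simp: mult_ac add_ac sum.distrib)

lemma has_mderiv_mult_left: "has_mderiv A A' t \<Longrightarrow> has_mderiv (\<lambda>s. B ** A s) (B ** A') t"
  using has_mderiv_mult[OF has_mderiv_const] by fastforce

lemma has_mderiv_mult_right: "has_mderiv A A' t \<Longrightarrow> has_mderiv (\<lambda>s. A s ** B) (A' ** B) t"
  using has_mderiv_mult[OF _ has_mderiv_const] by fastforce

lemma has_vderiv_mult_left: "has_vderiv x x' t \<Longrightarrow> has_vderiv (\<lambda>s. B *v x s) (B *v x') t"
  using has_vderiv_mult[OF has_mderiv_const] by fastforce

lemma has_vderiv_mult_right: "has_mderiv A A' t \<Longrightarrow> has_vderiv (\<lambda>s. A s *v x) (A' *v x) t"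
  using has_vderiv_mult[OF _ has_vderiv_const] by fastforce

lemma has_mderiv_unique: "has_mderiv A A' t \<Longrightarrow> has_mderiv A A'' t \<Longrightarrow> A' = A''"
  unfolding has_mderiv_def vec_eq_iff by (blast intro: DERIV_unique)

lemma has_vderiv_unique: "has_vderiv A A' t \<Longrightarrow> has_vderiv A A'' t \<Longrightarrow> A' = A''"
  unfolding has_vderiv_def vec_eq_iff by (blast intro: DERIV_unique)

lemma has_vderiv_zero_const:
  assumes "\<And>t. has_vderiv x 0 t"
  shows "x s = x t"
proof -
  have "x s $ i = x t $ i" for i
  proof -
    have "\<exists>c. \<forall>s\<in>UNIV. x s $ i = c"
      using assms by (intro has_field_derivative_zero_constant) (auto simp: has_vderiv_def)
    then show ?thesis by auto
  qed
  then show ?thesis by (simp add: vec_eq_iff)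
qed

text \<open>The adjugate: the inverse on \<open>SL2\<close>, and polynomial in the entries, so that
  \<open>R (adj2 h)\<close> stays polynomial in \<open>h\<close>.\<close>

definition adj2 :: "complex^2^2 \<Rightarrow> complex^2^2" where
  "adj2 A = mat2 (A$2$2) (- A$1$2) (- A$2$1) (A$1$1)"

lemma adj2_SL2: "A \<in> SL2 \<Longrightarrow> adj2 A \<in> SL2"
  by (simp add: mem_SL2_iff adj2_def mult_ac)

lemma adj2_mult: "A \<in> SL2 \<Longrightarrow> A ** adj2 A = mat 1" "A \<in> SL2 \<Longrightarrow> adj2 A ** A = mat 1"
  by (simp_all add: mem_SL2_iff adj2_def mat2_mult mat2_one mat2_eq_iff algebra_simps)

lemma SL2_mult: "A \<in> SL2 \<Longrightarrow> B \<in> SL2 \<Longrightarrow> A ** B \<in> SL2"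
  by (simp add: SL2_def det_mul)

lemma SL2_one: "mat 1 \<in> SL2"
  by (simp add: SL2_def)

section \<open>One-parameter subgroups and the Lie algebra action\<close>

definition upper :: "complex \<Rightarrow> complex^2^2" where "upper s = mat2 1 s 0 1"
definition lower :: "complex \<Rightarrow> complex^2^2" where "lower s = mat2 1 0 s 1"
definition diag :: "complex \<Rightarrow> complex^2^2" where "diag s = mat2 s 0 0 (1/s)"

lemma upper_SL2 [simp]: "upper s \<in> SL2" and lower_SL2 [simp]: "lower s \<in> SL2"
  and diag_SL2 [simp]: "s \<noteq> 0 \<Longrightarrow> diag s \<in> SL2"
  by (simp_all add: upper_def lower_def diag_def mem_SL2_iff)

lemma upper_add: "upper (s + t) = upper s ** upper t"
  and lower_add: "lower (s + t) = lower s ** lower t"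
  and diag_mult: "diag (s * t) = diag s ** diag t"
  by (simp_all add: upper_def lower_def diag_def mat2_eq_iff mat2_mult)

text \<open>Polynomial on all matrices but multiplicative only on \<open>SL2\<close>:
  \<open>R\<close> stands for a polynomial extension of the given module structure.\<close>

locale sl2_rep =
  fixes R :: "complex^2^2 \<Rightarrow> complex^'n^'n"
  assumes poly: "polyfun2 (\<lambda>A. R A $ i $ j)"
    and mult: "A \<in> SL2 \<Longrightarrow> B \<in> SL2 \<Longrightarrow> R (A ** B) = R A ** R B"
    and one: "R (mat 1) = mat 1"
begin

lemma R_adj2: "A \<in> SL2 \<Longrightarrow> R A ** R (adj2 A) = mat 1" "A \<in> SL2 \<Longrightarrow> R (adj2 A) ** R A = mat 1"
  by (simp_all add: adj2_SL2 adj2_mult one flip: mult)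

definition dE where "dE = (\<chi> i j. deriv (\<lambda>s. R (mat2 1 s 0 1) $ i $ j) 0)"
definition dF where "dF = (\<chi> i j. deriv (\<lambda>s. R (mat2 1 0 s 1) $ i $ j) 0)"
definition dH where "dH = (\<chi> i j. deriv (\<lambda>s. R (mat2 (exp s) 0 0 (exp (- s))) $ i $ j) 0)"
text \<open>The image of the traceless matrix with rows \<open>(z, x)\<close> and
  \<open>(y, -z)\<close> under the differential of \<open>R\<close>.\<close>

definition D where "D x y z = (\<chi> i j. x * dE$i$j + y * dF$i$j + z * dH$i$j)"

lemma D_basis: "D 1 0 0 = dE" "D 0 1 0 = dF" "D 0 0 1 = dH" "D 0 0 0 = 0"
  by (simp_all add: D_def vec_eq_iff)

lemma D_mulv: "D x y z *v w = x *s (dE *v w) + y *s (dF *v w) + z *s (dH *v w)"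
  by (simp add: D_def vec_eq_iff matrix_vector_mult_def sum_distrib_left algebra_simps sum.distrib)

text \<open>Off \<open>SL2\<close> nothing is known about \<open>R\<close>, so its derivative
  transverse to the group enters as an unknown multiple \<open>G\<close> of the trace. Along curves
  with traceless velocity this term drops out and \<open>D\<close> alone remains.\<close>

lemma gradient_one:
  "\<exists>G. ((\<lambda>A. R A $ i $ j) has_derivative (\<lambda>X. dE$i$j * X$1$2 + dF$i$j * X$2$1
      + dH$i$j * X$1$1 + G * (X$1$1 + X$2$2))) (at (mat 1))"
  and curve_deriv_entry:
  "\<lbrakk>(a has_field_derivative z) (at 0); (b has_field_derivative x) (at 0);
    (c has_field_derivative y) (at 0); (d has_field_derivative -z) (at 0);
    a 0 = 1; b 0 = 0; c 0 = 0; d 0 = 1\<rbrakk> \<Longrightarrow>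
   ((\<lambda>s. R (mat2 (a s) (b s) (c s) (d s)) $ i $ j) has_field_derivative D x y z $ i $ j) (at 0)"
proof -
  obtain p q r s where grad: "((\<lambda>A. R A $ i $ j) has_derivative
      (\<lambda>X. p * X$1$1 + q * X$1$2 + r * X$2$1 + s * X$2$2)) (at (mat 1))"
    using polyfun2_gradient[OF poly] by blast
  have curve: "((\<lambda>t. R (mat2 (a t) (b t) (c t) (d t)) $ i $ j) has_field_derivative
      p * z + q * x + r * y + s * w) (at 0)"
    if abcd: "(a has_field_derivative z) (at 0)" "(b has_field_derivative x) (at 0)"
      "(c has_field_derivative y) (at 0)" "(d has_field_derivative w) (at 0)"
      "a 0 = 1" "b 0 = 0" "c 0 = 0" "d 0 = 1" for a b c d x y z w
  proof -
    have "((\<lambda>t. mat2 (a t) (b t) (c t) (d t)) has_derivative (\<lambda>t. mat2 (z*t) (x*t) (y*t) (w*t))) (at 0)"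
    proof (intro has_derivative_vecI)
      fix i j :: 2
      show "((\<lambda>t. mat2 (a t) (b t) (c t) (d t) $ i $ j) has_derivative (\<lambda>t. mat2 (z*t) (x*t) (y*t) (w*t) $ i $ j)) (at 0)"
        using exhaust_2[of i] exhaust_2[of j] abcd by (auto simp: has_field_derivative_def)
    qed
    moreover have "((\<lambda>A. R A $ i $ j) has_derivative
      (\<lambda>X. p * X$1$1 + q * X$1$2 + r * X$2$1 + s * X$2$2)) (at (mat2 (a 0) (b 0) (c 0) (d 0)))"
      using grad abcd by (simp add: mat2_one)
    ultimately have "((\<lambda>t. R (mat2 (a t) (b t) (c t) (d t)) $ i $ j) has_derivative
       (\<lambda>t. p * (z*t) + q * (x*t) + r * (y*t) + s * (w*t))) (at 0)"
      using has_derivative_compose by fastforce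
    then show ?thesis
      unfolding has_field_derivative_def
      by (rule has_derivative_eq_rhs) (auto simp: fun_eq_iff algebra_simps)
  qed
  have E: "dE $ i $ j = q"
    using curve[of "\<lambda>s. 1" 0 "\<lambda>s. s" 1 "\<lambda>s. 0" 0 "\<lambda>s. 1" 0] by (simp add: dE_def DERIV_imp_deriv)
  have F: "dF $ i $ j = r"
    using curve[of "\<lambda>s. 1" 0 "\<lambda>s. 0" 0 "\<lambda>s. s" 1 "\<lambda>s. 1" 0] by (simp add: dF_def DERIV_imp_deriv)
  have "((\<lambda>s. exp (-s)) has_field_derivative -1) (at (0::complex))"
    by (auto intro!: derivative_eq_intros)
  then have H: "dH $ i $ j = p - s"
    using curve[of "\<lambda>s. exp s" 1 "\<lambda>s. 0" 0 "\<lambda>s. 0" 0 "\<lambda>s. exp (-s)" "-1"] DERIV_exp[of "0::complex"]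
    by (simp add: dH_def DERIV_imp_deriv)
  show "\<exists>G. ((\<lambda>A. R A $ i $ j) has_derivative (\<lambda>X. dE$i$j * X$1$2 + dF$i$j * X$2$1
      + dH$i$j * X$1$1 + G * (X$1$1 + X$2$2))) (at (mat 1))"
    by (rule exI[of _ s]) (use grad in \<open>simp add: E F H algebra_simps\<close>)
  assume "(a has_field_derivative z) (at 0)" "(b has_field_derivative x) (at 0)"
    "(c has_field_derivative y) (at 0)" "(d has_field_derivative -z) (at 0)"
    "a 0 = 1" "b 0 = 0" "c 0 = 0" "d 0 = 1"
  from curve[OF this]
  show "((\<lambda>s. R (mat2 (a s) (b s) (c s) (d s)) $ i $ j) has_field_derivative D x y z $ i $ j) (at 0)"
    by (simp add: D_def E F H algebra_simps)
qed

lemma curve_deriv: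
  assumes "((\<lambda>s. A s $ 1 $ 1) has_field_derivative z) (at 0)" "((\<lambda>s. A s $ 1 $ 2) has_field_derivative x) (at 0)"
    "((\<lambda>s. A s $ 2 $ 1) has_field_derivative y) (at 0)" "((\<lambda>s. A s $ 2 $ 2) has_field_derivative -z) (at 0)"
    "A 0 = mat 1"
  shows "has_mderiv (\<lambda>s. R (A s)) (D x y z) 0"
proof -
  have e: "mat2 (A s$1$1) (A s$1$2) (A s$2$1) (A s$2$2) = A s" for s by (simp add: mat2_eq_iff)
  show ?thesis
    unfolding has_mderiv_def using curve_deriv_entry[OF assms(1-4)] assms(5) by (simp add: e mat2_one)
qed

lemma deriv_upper: "has_mderiv (\<lambda>s. R (upper s)) dE 0"
  unfolding D_basis[symmetric] by (intro curve_deriv) (simp_all add: upper_def mat2_one)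

lemma deriv_lower: "has_mderiv (\<lambda>s. R (lower s)) dF 0"
  unfolding D_basis[symmetric] by (intro curve_deriv) (simp_all add: lower_def mat2_one)

lemma deriv_diag: "has_mderiv (\<lambda>s. R (diag (exp s))) dH 0"
  unfolding D_basis[symmetric]
  by (intro curve_deriv) (auto simp: diag_def mat2_one intro!: derivative_eq_intros)

text \<open>This is \<open>upper (x*s) ** lower (y*s) ** diag (exp (z*s))\<close>: a holomorphic
  curve in \<open>SL2\<close> with prescribed velocity at 0, explicit in its entries. It is in
  general not a one-parameter subgroup.\<close>

definition curve :: "complex \<Rightarrow> complex \<Rightarrow> complex \<Rightarrow> complex \<Rightarrow> complex^2^2" where
  "curve x y z s = mat2 ((1 + x*y * s^2) * exp (z * s)) (x * s*exp(-(z * s))) (y * s*exp(z * s)) (exp(-(z * s)))"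

lemma curve_SL2 [simp]: "curve x y z s \<in> SL2"
  by (simp add: curve_def mem_SL2_iff exp_minus field_simps power2_eq_square)

lemma curve_0 [simp]: "curve x y z 0 = mat 1"
  by (simp add: curve_def mat2_one)

lemma curve_entry_deriv:
  "((\<lambda>s. curve x y z s $ 1 $ 1) has_field_derivative z) (at 0)"
  "((\<lambda>s. curve x y z s $ 1 $ 2) has_field_derivative x) (at 0)"
  "((\<lambda>s. curve x y z s $ 2 $ 1) has_field_derivative y) (at 0)"
  "((\<lambda>s. curve x y z s $ 2 $ 2) has_field_derivative - z) (at 0)"
  by (auto simp: curve_def intro!: derivative_eq_intros)

lemma deriv_curve: "has_mderiv (\<lambda>s. R (curve x y z s)) (D x y z) 0"
  by (intro curve_deriv curve_entry_deriv curve_0)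

lemma curve_holomorphic: "(\<lambda>s. R (curve x y z s) $ i $ j) holomorphic_on UNIV"
proof (rule polyfun2_closed[where Q = "\<lambda>f. f holomorphic_on UNIV" and T = "curve x y z", OF poly])
  fix i j :: 2
  show "(\<lambda>s. curve x y z s $ i $ j) holomorphic_on UNIV"
    using exhaust_2[of i] exhaust_2[of j]
    by (elim disjE) (auto simp: curve_def intro!: holomorphic_intros)
qed (auto intro: holomorphic_intros)

text \<open>The arguments on the right are the coordinates of \<open>h X h^-1\<close> for
  \<open>X\<close> with rows \<open>(z, x)\<close> and \<open>(y, -z)\<close>; the identity is the
  derivative of \<open>R\<close> along \<open>h ** curve x y z s ** adj2 h\<close>.\<close>

lemma equivariance:
  assumes "h = mat2 a b c d" "h \<in> SL2"
  shows "R h ** D x y z = D (a^2*x - b^2*y - 2*a*b*z) (d^2*y - c^2*x + 2*c*d*z)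
      ((a*d + b*c)*z + b*d*y - a*c*x) ** R h"
proof -
  let ?D' = "D (a^2*x - b^2*y - 2*a*b*z) (d^2*y - c^2*x + 2*c*d*z) ((a*d + b*c)*z + b*d*y - a*c*x)"
  have det: "a*d - b*c = 1" using assms by (simp add: mem_SL2_iff)
  have e: "R (h ** curve x y z s ** adj2 h) = R h ** R (curve x y z s) ** R (adj2 h)" for s
    using assms by (simp add: mult SL2_mult adj2_SL2)
  have "has_mderiv (\<lambda>s. R (h ** curve x y z s ** adj2 h)) ?D' 0"
  proof (rule curve_deriv)
    show "h ** curve x y z 0 ** adj2 h = mat 1"
      using assms by (simp add: adj2_mult)
  qed (unfold assms(1) adj2_def mat2_mult mat2_nth,
        auto intro!: derivative_eq_intros curve_entry_deriv simp: mat2_one power2_eq_square algebra_simps)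
  moreover have "has_mderiv (\<lambda>s. R (h ** curve x y z s ** adj2 h)) (R h ** D x y z ** R (adj2 h)) 0"
    unfolding e by (intro has_mderiv_mult_right has_mderiv_mult_left deriv_curve)
  ultimately have "?D' = R h ** D x y z ** R (adj2 h)"
    by (rule has_mderiv_unique)
  then have "?D' ** R h = R h ** D x y z ** (R (adj2 h) ** R h)"
    by (simp add: matrix_mul_assoc)
  then show ?thesis using assms by (simp add: R_adj2)
qed

text \<open>The derivative at \<open>s = 0\<close> of \<open>equivariance\<close> for
  \<open>upper s\<close>; \<open>comm_F\<close> arises in the same way from
  \<open>lower s\<close>.\<close>

lemma comm_E: "dE ** D x y z = D x y z ** dE + D (-2*z) 0 y"
proof -
  have e: "R (upper s) ** D x y z = D (x - s^2*y - 2 * s*z) y (z + s*y) ** R (upper s)" for s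
    using equivariance[of "upper s" 1 s 0 1 x y z] by (simp add: upper_def[symmetric])
  have "has_mderiv (\<lambda>s. D (x - s^2*y - 2 * s*z) y (z + s*y)) (D (-2*z) 0 y) 0"
    unfolding has_mderiv_def D_def by (auto intro!: derivative_eq_intros)
  from has_mderiv_mult[OF this deriv_upper]
  have "has_mderiv (\<lambda>s. D (x - s^2*y - 2 * s*z) y (z + s*y) ** R (upper s)) (D (-2*z) 0 y + D x y z ** dE) 0"
    by (simp add: upper_def one flip: mat2_one)
  moreover have "has_mderiv (\<lambda>s. R (upper s) ** D x y z) (dE ** D x y z) 0"
    by (intro has_mderiv_mult_right deriv_upper)
  ultimately show ?thesis
    unfolding e by (simp add: has_mderiv_unique add.commute)
qed

lemma comm_F: "dF ** D x y z = D x y z ** dF + D 0 (2*z) (-x)"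
proof -
  have e: "R (lower s) ** D x y z = D x (y - s^2*x + 2 * s*z) (z - s*x) ** R (lower s)" for s
    using equivariance[of "lower s" 1 0 s 1 x y z] by (simp add: lower_def[symmetric])
  have "has_mderiv (\<lambda>s. D x (y - s^2*x + 2 * s*z) (z - s*x)) (D 0 (2*z) (-x)) 0"
    unfolding has_mderiv_def D_def by (auto intro!: derivative_eq_intros)
  from has_mderiv_mult[OF this deriv_lower]
  have "has_mderiv (\<lambda>s. D x (y - s^2*x + 2 * s*z) (z - s*x) ** R (lower s)) (D 0 (2*z) (-x) + D x y z ** dF) 0"
    by (simp add: lower_def one flip: mat2_one)
  moreover have "has_mderiv (\<lambda>s. R (lower s) ** D x y z) (dF ** D x y z) 0"
    by (intro has_mderiv_mult_right deriv_lower)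
  ultimately show ?thesis
    unfolding e by (simp add: has_mderiv_unique add.commute)
qed

lemma one_parameter_deriv:
  assumes "\<And>s t. c (s + t) = c s ** c t" "\<And>s. c s \<in> SL2" "has_mderiv (\<lambda>s. R (c s)) X 0"
  shows "has_mderiv (\<lambda>s. R (c s)) (R (c t) ** X) t"
proof -
  have e: "R (c t) ** R (c (s + - t)) = R (c s)" for s
    using assms(1)[of t "s + - t"] mult[of "c t" "c (s + - t)"] assms(2) by simp
  have "has_mderiv (\<lambda>s. R (c t) ** R (c s)) (R (c t) ** X) 0"
    by (intro has_mderiv_mult_left assms)
  then have "((\<lambda>s. (R (c t) ** R (c s)) $ i $ j) has_field_derivative (R (c t) ** X) $ i $ j) (at (t + -t))" for i j
    by (simp add: has_mderiv_def)
  then show ?thesis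
    unfolding has_mderiv_def by (simp only: DERIV_shift e) blast
qed

lemma one_parameter_fixed:
  assumes "\<And>s t. c (s + t) = c s ** c t" "\<And>s. c s \<in> SL2" "has_mderiv (\<lambda>s. R (c s)) X 0"
    and "c 0 = mat 1" "X *v w = 0"
  shows "R (c s) *v w = w"
proof -
  have "has_vderiv (\<lambda>s. R (c s) *v w) 0 t" for t
    using has_vderiv_mult_right[OF one_parameter_deriv[OF assms(1-3)], where x = w] assms(5)
    by (simp flip: matrix_vector_mul_assoc)
  from has_vderiv_zero_const[OF this, of s 0] show ?thesis
    by (simp add: assms one)
qed

lemma upper_fixed: "dE *v w = 0 \<Longrightarrow> R (upper s) *v w = w"
  by (rule one_parameter_fixed[OF upper_add upper_SL2 deriv_upper]) (simp_all add: upper_def mat2_one)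

lemma lower_fixed: "dF *v w = 0 \<Longrightarrow> R (lower s) *v w = w"
  by (rule one_parameter_fixed[OF lower_add lower_SL2 deriv_lower]) (simp_all add: lower_def mat2_one)

lemma diag_fixed:
  assumes "dH *v w = 0" "t \<noteq> 0"
  shows "R (diag t) *v w = w"
proof -
  have "R (diag (exp s)) *v w = w" for s
    by (rule one_parameter_fixed[where c = "\<lambda>s. diag (exp s)", OF _ _ deriv_diag])
       (simp_all add: exp_add diag_mult assms, simp add: diag_def mat2_one)
  then show ?thesis using assms(2) by (metis exp_Ln)
qed

text \<open>If the lower left entry is nonzero, \<open>h\<close> is a product upper, lower, upper.
  Otherwise \<open>h ** lower 1\<close> has lower left entry \<open>h$2$2\<close>, which is
  nonzero.\<close>

lemma SL2_generated:
  assumes "\<And>s. R (upper s) *v w = w" "\<And>s. R (lower s) *v w = w" "h \<in> SL2"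
  shows "R h *v w = w"
proof -
  have *: "R h *v w = w" if "h \<in> SL2" "h$2$1 \<noteq> 0" for h
  proof -
    define p q where "p = (h$1$1 - 1) / h$2$1" and "q = (h$2$2 - 1) / h$2$1"
    have "h$1$2 = h$1$1 * q + p"
      using that by (simp add: p_def q_def mem_SL2_iff field_simps)
    moreover have "h$1$1 = 1 + p * h$2$1" "h$2$2 = h$2$1 * q + 1"
      using that by (simp_all add: p_def q_def)
    ultimately have "h = upper p ** (lower (h$2$1) ** upper q)"
      by (simp add: mat2_eq_iff mat2_mult upper_def lower_def algebra_simps)
    then have "R h = R (upper p ** (lower (h$2$1) ** upper q))"
      by (rule arg_cong)
    also have "\<dots> = R (upper p) ** (R (lower (h$2$1)) ** R (upper q))"
      by (simp add: SL2_mult mult)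
    finally have "R h = \<dots>" .
    then have "R h *v w = R (upper p) *v (R (lower (h$2$1)) *v (R (upper q) *v w))"
      by (simp add: matrix_vector_mul_assoc)
    then show ?thesis by (simp add: assms)
  qed
  show ?thesis
  proof (cases "h$2$1 = 0")
    case True
    have "h$2$2 \<noteq> 0" using assms(3) True by (auto simp: mem_SL2_iff)
    then have "R (h ** lower 1) *v w = w"
      using True assms(3) SL2_mult[of h "lower 1"]
      by (intro *) (auto, auto simp: lower_def mat2_mult)
    then show ?thesis
      using assms by (simp add: mult flip: matrix_vector_mul_assoc)
  qed (use * assms in auto)
qed

lemma fixed_of_EF: "dE *v w = 0 \<Longrightarrow> dF *v w = 0 \<Longrightarrow> h \<in> SL2 \<Longrightarrow> R h *v w = w"
  by (rule SL2_generated) (auto simp: upper_fixed lower_fixed)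

end

section \<open>Tangent vectors of an orbit\<close>

lemma norm_smult: "norm (c *s x) = norm c * norm (x :: complex^'n)"
  by (simp add: norm_vec_def norm_mult L2_set_right_distrib)

lemma norm_le_sum_entries: "norm (A :: complex^'m^'n) \<le> (\<Sum>i\<in>UNIV. \<Sum>j\<in>UNIV. norm (A$i$j))"
proof -
  have "norm A \<le> (\<Sum>i\<in>UNIV. norm (A$i))"
    unfolding norm_vec_def[of A] by (intro L2_set_le_sum) simp
  also have "\<dots> \<le> (\<Sum>i\<in>UNIV. \<Sum>j\<in>UNIV. norm (A$i$j))"
    unfolding norm_vec_def by (intro sum_mono L2_set_le_sum) simp
  finally show ?thesis .
qed

lemma norm_mulv_le: "norm (A *v x) \<le> (\<Sum>i\<in>UNIV. \<Sum>j\<in>UNIV. norm (A$i$j)) * norm (x :: complex^'m)"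
proof -
  have "norm (A *v x) \<le> (\<Sum>i\<in>UNIV. norm ((A *v x)$i))"
    unfolding norm_vec_def by (intro L2_set_le_sum) simp
  also have "\<dots> \<le> (\<Sum>i\<in>UNIV. \<Sum>j\<in>UNIV. norm (A$i$j) * norm x)"
    unfolding matrix_vector_mult_def
    by (auto intro!: sum_mono norm_sum[THEN order_trans] simp: norm_mult mult_left_mono Finite_Cartesian_Product.norm_nth_le)
  finally show ?thesis by (simp add: sum_distrib_right)
qed

lemma entry_le_norm: "norm (A$i$j) \<le> norm (A :: complex^'m^'n)"
  by (meson Finite_Cartesian_Product.norm_nth_le order_trans)

lemma tendsto_mulv:
  fixes A :: "'a \<Rightarrow> complex^'m^'n"
  assumes "(A \<longlongrightarrow> B) F" "(x \<longlongrightarrow> y) F"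
  shows "((\<lambda>n. A n *v x n) \<longlongrightarrow> B *v y) F"
  unfolding matrix_vector_mult_def
  by (intro vec_tendstoI) (auto intro!: tendsto_intros assms)

lemma tendsto_matmul:
  fixes A :: "'a \<Rightarrow> complex^'m^'n"
  assumes "(A \<longlongrightarrow> B) F" "(x \<longlongrightarrow> y) F"
  shows "((\<lambda>n. A n ** x n) \<longlongrightarrow> B ** y) F"
  unfolding matrix_matrix_mult_def
  by (intro vec_tendstoI) (auto intro!: tendsto_intros assms)

lemma tendsto_det:
  fixes A :: "'a \<Rightarrow> complex^'n^'n"
  assumes "(A \<longlongrightarrow> B) F"
  shows "((\<lambda>n. det (A n)) \<longlongrightarrow> det B) F"
  unfolding det_def by (auto intro!: tendsto_intros assms)

lemma has_vderiv_quotient: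
  assumes "has_vderiv x x' t"
  shows "((\<lambda>s. (1 / (s - t)) *s (x s - x t)) \<longlongrightarrow> x') (at t)"
  using assms unfolding has_vderiv_def has_field_derivative_iff
  by (intro vec_tendstoI) (simp add: diff_divide_distrib)

lemma mulv_smult: "A *v (c *s x) = c *s (A *v x)" for x :: "complex^'m"
  by (simp add: vec_eq_iff matrix_vector_mult_def sum_distrib_left mult_ac)

lemma matmul_columns: "A ** (\<chi> i j. f j $ i) = (\<chi> i j. (A *v f j) $ i)" for A :: "complex^'m^'n"
  by (simp add: vec_eq_iff matrix_matrix_mult_def matrix_vector_mult_def)

context sl2_rep
begin

lemma tendsto_R: "(A \<longlongrightarrow> B) F \<Longrightarrow> ((\<lambda>n. R (A n)) \<longlongrightarrow> R B) F"
proof -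
  assume A: "(A \<longlongrightarrow> B) F"
  have "isCont (\<lambda>A. R A $ i $ j) B" for i j
    using polyfun2_gradient[OF poly, of i j B] by (auto dest: has_derivative_continuous)
  then show ?thesis
    by (intro vec_tendstoI) (rule isCont_tendsto_compose[OF _ A])
qed

text \<open>The error is measured by three coordinates only. The fourth is controlled by the
  determinant equation, which makes the trace deviation \<open>\<tau>\<close> of second order in the
  others; hence the unknown transverse derivative \<open>g\<close> does no harm.\<close>

lemma linearization:
  assumes "\<epsilon> > 0"
  shows "\<exists>\<delta>>0. \<forall>A\<in>SL2. norm (A - mat 1) < \<delta> \<longrightarrow>
    norm (R A *v v - v - D (A$1$2) (A$2$1) (A$1$1 - 1) *v v)
      \<le> \<epsilon> * (norm (A$1$2) + norm (A$2$1) + norm (A$1$1 - 1))"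
proof -
  define G where "G i j = (SOME G. ((\<lambda>A. R A $ i $ j) has_derivative (\<lambda>X. dE$i$j * X$1$2 + dF$i$j * X$2$1
      + dH$i$j * X$1$1 + G * (X$1$1 + X$2$2))) (at (mat 1)))" for i j
  have G: "((\<lambda>A. R A $ i $ j) has_derivative (\<lambda>X. dE$i$j * X$1$2 + dF$i$j * X$2$1
      + dH$i$j * X$1$1 + G i j * (X$1$1 + X$2$2))) (at (mat 1))" for i j
    unfolding G_def by (rule someI_ex[OF gradient_one])
  define g where "g = (\<chi> i j. G i j) *v v"
  define f' where "f' X = D (X$1$2) (X$2$1) (X$1$1) *v v + (X$1$1 + X$2$2) *s g" for X :: "complex^2^2"
  have "((\<lambda>A. R A *v v) has_derivative f') (at (mat 1))"
  proof (rule has_derivative_vecI)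
    fix i
    have "((\<lambda>A. \<Sum>j\<in>UNIV. R A $ i $ j * v $ j) has_derivative (\<lambda>X. \<Sum>j\<in>UNIV. (dE$i$j * X$1$2 + dF$i$j * X$2$1
      + dH$i$j * X$1$1 + G i j * (X$1$1 + X$2$2)) * v$j)) (at (mat 1))"
      by (intro has_derivative_sum has_derivative_mult_left G)
    moreover have "(\<Sum>j\<in>UNIV. (dE$i$j * X$1$2 + dF$i$j * X$2$1
      + dH$i$j * X$1$1 + G i j * (X$1$1 + X$2$2)) * v$j) = f' X $ i" for X :: "complex^2^2"
      by (simp add: f'_def g_def D_def matrix_vector_mult_def algebra_simps sum.distrib sum_distrib_left)
    ultimately show "((\<lambda>A. (R A *v v) $ i) has_derivative (\<lambda>h. f' h $ i)) (at (mat 1))"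
      by (simp add: matrix_vector_mult_def)
  qed
  then have lin: "\<exists>d>0. \<forall>A. norm (A - mat 1) < d \<longrightarrow> norm (R A *v v - v - f' (A - mat 1)) \<le> e * norm (A - mat 1)"
    if "e > 0" for e
    using that unfolding has_derivative_at_alt by (auto simp: one)
  \<comment> \<open>Half of \<open>\<epsilon>\<close> pays for the differentiability error, where
    \<open>norm (A - mat 1) \<le> 3 * m\<close> costs a factor 3. The other half pays for
    \<open>\<tau> *s g\<close>; the 1 added to \<open>norm g\<close> below covers
    \<open>g = 0\<close>.\<close>
  define e where "e = \<epsilon> / 8"
  obtain d where d: "d > 0" "\<And>A. norm (A - mat 1) < d \<Longrightarrow> norm (R A *v v - v - f' (A - mat 1)) \<le> e * norm (A - mat 1)"
    using lin[of e] assms by (auto simp: e_def)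
  define c where "c = \<epsilon> / (8 * (norm g + 1))"
  have c: "c > 0" "c * norm g \<le> \<epsilon> / 2"
  proof -
    have g: "norm g + 1 > 0" by (simp add: add_nonneg_pos)
    then show "c > 0" using assms by (simp add: c_def)
    then have "c * norm g \<le> c * (norm g + 1)" by simp
    also have "\<dots> = \<epsilon> / 8" using g unfolding c_def by (metis less_irrefl nonzero_mult_divide_mult_cancel_right mult.commute times_divide_eq_left)
    also have "\<dots> \<le> \<epsilon> / 2" using assms by simp
    finally show "c * norm g \<le> \<epsilon> / 2" .
  qed
  \<comment> \<open>The bound 1/2 keeps \<open>A$1$1\<close> away from 0, so that the determinant
    equation bounds \<open>\<tau>\<close> by \<open>2 * \<delta> * m\<close>; the bound
    \<open>c/2\<close> turns this into \<open>c * m\<close>.\<close>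
  define \<delta> where "\<delta> = min d (min (1/2) (c/2))"
  have "\<delta> > 0" using d c by (simp add: \<delta>_def)
  moreover have "norm (R A *v v - v - D (A$1$2) (A$2$1) (A$1$1 - 1) *v v)
      \<le> \<epsilon> * (norm (A$1$2) + norm (A$2$1) + norm (A$1$1 - 1))"
    if A: "A \<in> SL2" "norm (A - mat 1) < \<delta>" for A
  proof -
    define m where "m = norm (A$1$2) + norm (A$2$1) + norm (A$1$1 - 1)"
    define \<tau> where "\<tau> = A$1$1 - 1 + (A$2$2 - 1)"
    have ent: "norm ((A - mat 1)$i$j) < \<delta>" for i j
      using entry_le_norm[of "A - mat 1"] A(2) by (meson order_le_less_trans)
    have sm: "norm (A$1$1 - 1) < \<delta>" "norm (A$1$2) < \<delta>"
      using ent[of 1 1] ent[of 1 2] by (simp_all add: mat2_one)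
    have "norm (1::complex) \<le> norm (A$1$1) + norm (A$1$1 - 1)"
      by (metis norm_triangle_sub norm_minus_commute add.commute)
    then have a: "norm (A$1$1) \<ge> 1/2" using sm by (simp add: \<delta>_def)
    have "A$1$1 * \<tau> = (A$1$1 - 1) * (A$1$1 - 1) + A$1$2 * A$2$1"
      using A(1) by (simp add: \<tau>_def mem_SL2_iff algebra_simps)
    then have "norm (A$1$1) * norm \<tau> \<le> norm (A$1$1 - 1) * norm (A$1$1 - 1) + norm (A$1$2) * norm (A$2$1)"
      using norm_triangle_ineq[of "(A$1$1 - 1) * (A$1$1 - 1)" "A$1$2 * A$2$1"] by (simp flip: norm_mult)
    also have "\<dots> \<le> \<delta> * norm (A$1$1 - 1) + \<delta> * norm (A$2$1)"
      using sm by (intro add_mono mult_right_mono) auto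
    also have "\<dots> \<le> \<delta> * m"
      using \<open>\<delta> > 0\<close> by (simp add: m_def distrib_left)
    finally have "1/2 * norm \<tau> \<le> \<delta> * m"
      using a by (meson mult_right_mono norm_ge_zero order_trans)
    then have tau: "norm \<tau> \<le> 2 * \<delta> * m" by simp
    have m0: "m \<ge> 0" by (simp add: m_def)
    have "2 * \<delta> \<le> 1" "2 * \<delta> \<le> c" by (simp_all add: \<delta>_def)
    then have tau1: "norm \<tau> \<le> m" "norm \<tau> \<le> c * m"
      using tau mult_right_mono[of "2*\<delta>" 1 m] mult_right_mono[of "2*\<delta>" c m] m0 by auto
    have arith: "n \<le> 3 * (b + c + x)"
      if "w \<le> t + x" "n \<le> x + b + c + w" "t \<le> b + c + x" "0 \<le> b" "0 \<le> c" for n w t x b c :: real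
    proof -
      have "n \<le> x + b + c + ((b + c + x) + x)"
        using that(1-3) by linarith
      moreover have "3 * (b + c + x) = x + b + c + ((b + c + x) + x) + b + c" by simp
      ultimately show ?thesis using that(4,5) by linarith
    qed
    have "norm (A$2$2 - 1) \<le> norm \<tau> + norm (A$1$1 - 1)"
      unfolding \<tau>_def by (metis add_diff_cancel_left' norm_triangle_ineq4)
    moreover have "norm (A - mat 1) \<le> norm (A$1$1 - 1) + norm (A$1$2) + norm (A$2$1) + norm (A$2$2 - 1)"
      using norm_le_sum_entries[of "A - mat 1"] by (simp add: sum_2 mat2_one)
    ultimately have "norm (A - mat 1) \<le> 3 * m"
      using arith[OF _ _ tau1(1)[unfolded m_def] norm_ge_zero norm_ge_zero] unfolding m_def by blast
    moreover have "norm (R A *v v - v - f' (A - mat 1)) \<le> e * norm (A - mat 1)"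
      using A by (intro d) (simp add: \<delta>_def)
    moreover have "e \<ge> 0" using assms by (simp add: e_def)
    ultimately have "norm (R A *v v - v - f' (A - mat 1)) \<le> e * (3 * m)"
      using mult_left_mono[of "norm (A - mat 1)" "3 * m" e] by simp
    also have "\<dots> \<le> \<epsilon> / 2 * m"
      using assms m0 by (simp add: e_def)
    finally have 1: "norm (R A *v v - v - f' (A - mat 1)) \<le> \<epsilon> / 2 * m" .
    have 2: "f' (A - mat 1) = D (A$1$2) (A$2$1) (A$1$1 - 1) *v v + \<tau> *s g"
      by (simp add: f'_def mat2_one \<tau>_def)
    have "norm (\<tau> *s g) \<le> c * m * norm g"
      using tau1 by (simp add: norm_smult mult_right_mono)
    also have "\<dots> \<le> \<epsilon> / 2 * m"
      using mult_right_mono[OF c(2) m0] by (simp add: mult_ac)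
    finally have 3: "norm (\<tau> *s g) \<le> \<epsilon> / 2 * m" .
    have "norm (R A *v v - v - D (A$1$2) (A$2$1) (A$1$1 - 1) *v v)
      = norm ((R A *v v - v - f' (A - mat 1)) + \<tau> *s g)"
    proof -
      have "a - b - c = (a - b - (c + t)) + t" for a b c t :: "complex^'n" by simp
      then show ?thesis unfolding 2 by metis
    qed
    also have "\<dots> \<le> \<epsilon> / 2 * m + \<epsilon> / 2 * m"
      by (rule order_trans[OF norm_triangle_ineq add_mono[OF 1 3]])
    finally show ?thesis by (simp add: m_def)
  qed
  ultimately show ?thesis by blast
qed

end

definition polynomial_curve :: "(complex \<Rightarrow> complex) \<Rightarrow> bool" where
  "polynomial_curve f \<longleftrightarrow> (\<exists>p. \<forall>t. f t = poly p t)"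

text \<open>The two properties of polynomial functions on \<open>V\<close> that are needed: composition with polynomial
  curves is polynomial, and the derivative along a curve depends only on its velocity.\<close>

definition vec_polynomial :: "(complex^'n \<Rightarrow> complex) \<Rightarrow> bool" where
  "vec_polynomial Q \<longleftrightarrow>
     (\<forall>x. (\<forall>i. polynomial_curve (\<lambda>t. x t $ i)) \<longrightarrow> polynomial_curve (\<lambda>t. Q (x t))) \<and>
     (\<forall>x0 x'. \<exists>q. \<forall>x. x 0 = x0 \<longrightarrow> has_vderiv x x' 0 \<longrightarrow> ((\<lambda>t. Q (x t)) has_field_derivative q) (at 0))"

text \<open>The columns of \<open>P\<close> are a basis of the tangent space of the orbit at \<open>v\<close>, given by Lie algebra
  elements with coordinates \<open>ex\<close>, \<open>ey\<close>, \<open>ez\<close> along \<open>E\<close>, \<open>F\<close>, \<open>H\<close>; \<open>'r\<close> has three elements if the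
  stabilizer is finite and two if it contains a torus. Assumption \<open>bracket\<close> is the unimodularity of the
  homogeneous space, and \<open>density\<close> is the squared invariant volume form evaluated on \<open>L\<close>.\<close>

locale framed_orbit = sl2_rep R for R :: "complex^2^2 \<Rightarrow> complex^'n^'n" +
  fixes v :: "complex^'n" and ex ey ez :: "'r::finite \<Rightarrow> complex"
    and P :: "complex^'r^'n" and lam :: "complex^'n^'r"
  assumes P: "P = (\<chi> i j. (D (ex j) (ey j) (ez j) *v v) $ i)"
    and lamP: "lam ** P = mat 1"
    and span: "D x y z *v v = P *v (lam *v (D x y z *v v))"
    and bracket: "(\<Sum>j\<in>UNIV. (lam *v ((D (ex j) (ey j) (ez j) ** D (ex k) (ey k) (ez k)
        - D (ex k) (ey k) (ez k) ** D (ex j) (ey j) (ez j)) *v v)) $ j) = 0"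
    and chart: "\<lbrakk>\<And>n. A n \<in> SL2; A \<longlonglongrightarrow> mat 1\<rbrakk> \<Longrightarrow>
        \<exists>p e. (\<forall>n. R (A n) *v v = v + P *v p n + e n) \<and>
          (\<forall>\<epsilon>>0. \<forall>\<^sub>F n in sequentially. norm (e n) \<le> \<epsilon> * norm (p n :: complex^'r))"
    and density: "\<exists>Q. vec_polynomial Q \<and> (\<forall>h\<in>SL2. Q (R h *v v) = (det (L ** R h ** P))\<^sup>2)"
begin

definition X where "X = {R h *v v | h. h \<in> SL2}"

lemma lamP_mulv: "lam *v (P *v q) = q"
  by (simp add: matrix_vector_mul_assoc lamP)

text \<open>\<open>lam\<close> recovers \<open>p n\<close> from the displacement up to a small
  multiple of \<open>p n\<close>, so \<open>p n\<close> is bounded by the displacement and the error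
  is of smaller order than it. Hence \<open>Z\<close>, the projection with kernel the image of
  \<open>P\<close>, kills every limit of rescaled displacements.\<close>

lemma tangent_at_v:
  assumes A: "\<And>n. A n \<in> SL2" "A \<longlonglongrightarrow> mat 1"
    and w: "(\<lambda>n. c n *s (R (A n) *v v - v)) \<longlonglongrightarrow> w"
  shows "w = P *v (lam *v w)"
proof -
  from chart[OF A] obtain p e where pe: "\<And>n. R (A n) *v v = v + P *v p n + e n"
    "\<And>\<epsilon>. \<epsilon> > 0 \<Longrightarrow> \<forall>\<^sub>F n in sequentially. norm (e n) \<le> \<epsilon> * norm (p n)" by metis
  define C where "C = (\<Sum>i\<in>UNIV. \<Sum>j\<in>UNIV. norm (lam$i$j)) + 1"
  have C: "C > 0" "norm (lam *v x) \<le> C * norm x" for x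
  proof -
    have "0 \<le> (\<Sum>i\<in>UNIV. \<Sum>j\<in>UNIV. norm (lam$i$j))" by (intro sum_nonneg) simp
    then show "C > 0" by (simp add: C_def)
    show "norm (lam *v x) \<le> C * norm x"
      using norm_mulv_le[of lam x] by (simp add: C_def distrib_right add_increasing2)
  qed
  define Z where "Z = mat 1 - P ** lam"
  define C2 where "C2 = (\<Sum>i\<in>UNIV. \<Sum>j\<in>UNIV. norm (Z$i$j)) + 1"
  have C2: "C2 > 0" "norm (Z *v x) \<le> C2 * norm x" for x
  proof -
    have "0 \<le> (\<Sum>i\<in>UNIV. \<Sum>j\<in>UNIV. norm (Z$i$j))" by (intro sum_nonneg) simp
    then show "C2 > 0" by (simp add: C2_def)
    show "norm (Z *v x) \<le> C2 * norm x"
      using norm_mulv_le[of Z x] by (simp add: C2_def distrib_right add_increasing2)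
  qed
  have Zv: "Z *v x = x - P *v (lam *v x)" for x
    by (simp add: Z_def matrix_vector_mult_diff_rdistrib matrix_vector_mul_assoc)
  have bound: "norm (Z *v w) \<le> \<epsilon> * norm w" if "\<epsilon> > 0" for \<epsilon>
  proof (rule tendsto_le[OF _ tendsto_mult_left[OF tendsto_norm[OF w]] tendsto_norm[OF tendsto_mulv[OF tendsto_const w]]])
    define \<epsilon>' where "\<epsilon>' = \<epsilon> / (2 * C * C2)"
    have e': "\<epsilon>' > 0" using that C C2 by (simp add: \<epsilon>'_def)
    have "\<forall>\<^sub>F n in sequentially. norm (e n) \<le> 1 / (2*C) * norm (p n)"
      using C by (intro pe) simp
    moreover have "\<forall>\<^sub>F n in sequentially. norm (e n) \<le> \<epsilon>' * norm (p n)"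
      using e' by (intro pe)
    ultimately show "\<forall>\<^sub>F n in sequentially. norm (Z *v (c n *s (R (A n) *v v - v))) \<le> \<epsilon> * norm (c n *s (R (A n) *v v - v))"
    proof eventually_elim
      case (elim n)
      let ?d = "R (A n) *v v - v"
      have d: "?d = P *v p n + e n" using pe by simp
      have "p n = lam *v ?d - lam *v e n"
        unfolding d by (simp add: matrix_vector_right_distrib lamP_mulv)
      then have "norm (p n) \<le> norm (lam *v ?d) + norm (lam *v e n)"
        by (metis norm_triangle_ineq4)
      also have "\<dots> \<le> C * norm ?d + C * norm (e n)"
        by (intro add_mono C)
      also have "C * norm (e n) \<le> C * (1 / (2*C) * norm (p n))"
        using elim C by (intro mult_left_mono) auto
      also have "\<dots> = norm (p n) / 2" using C by simp
      \<comment> \<open>The error bound with \<open>1 / (2*C)\<close> was chosen so that half of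
        \<open>norm (p n)\<close> can be absorbed here.\<close>
      finally have p: "norm (p n) \<le> 2 * C * norm ?d" by simp
      have "Z *v ?d = Z *v e n"
        unfolding d by (simp add: Zv matrix_vector_right_distrib lamP_mulv)
      then have "norm (Z *v ?d) \<le> C2 * norm (e n)" using C2 by simp
      also have "\<dots> \<le> C2 * (\<epsilon>' * (2 * C * norm ?d))"
        using elim C2 e' p by (intro mult_left_mono) (auto intro: order_trans mult_left_mono)
      also have "\<dots> = \<epsilon> * norm ?d" using C C2 by (simp add: \<epsilon>'_def)
      finally have "norm (c n) * norm (Z *v ?d) \<le> norm (c n) * (\<epsilon> * norm ?d)"
        by (rule mult_left_mono) simp
      then show ?case
        by (simp only: mulv_smult norm_smult mult.left_commute)
    qed
  qed simp
  have "norm (Z *v w) \<le> 0"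
  proof (rule field_le_epsilon)
    fix e :: real assume "e > 0"
    have "norm (Z *v w) \<le> e / (norm w + 1) * norm w"
      using \<open>e > 0\<close> by (intro bound) (simp add: add_nonneg_pos)
    also have "\<dots> \<le> e / (norm w + 1) * (norm w + 1)"
      using \<open>e > 0\<close> by (intro mult_left_mono) (auto simp: add_nonneg_pos less_imp_le)
    also have "\<dots> = e"
      using norm_ge_zero[of w] by (simp add: add_nonneg_eq_0_iff)
    finally show "norm (Z *v w) \<le> 0 + e" by simp
  qed
  then show ?thesis by (simp add: Zv)
qed

lemma D_orbit:
  assumes "h \<in> SL2"
  shows "\<exists>q. D x y z *v (R h *v v) = R h *v (P *v q)"
proof -
  obtain x' y' z' where "R (adj2 h) ** D x y z = D x' y' z' ** R (adj2 h)"
    using equivariance[OF adj2_def adj2_SL2[OF assms], of x y z] by blast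
  then have "(R h ** R (adj2 h)) ** D x y z ** R h = R h ** D x' y' z' ** (R (adj2 h) ** R h)"
    by (metis matrix_mul_assoc)
  then have "D x y z ** R h = R h ** D x' y' z'"
    by (simp add: R_adj2 assms)
  then have "D x y z *v (R h *v v) = R h *v (D x' y' z' *v v)"
    by (simp add: matrix_vector_mul_assoc)
  then show ?thesis using span by metis
qed

lemma has_vderiv_isCont:
  assumes "has_vderiv x x' t"
  shows "isCont x t"
  using assms unfolding has_vderiv_def isCont_def
  by (intro vec_tendstoI) (metis DERIV_isCont isCont_def)

text \<open>The orbit is only known to be a countable union of compact pieces. One of the pieces contains
  uncountably many points of the curve near \<open>s0\<close>; at an accumulation point of those, the group
  elements moving the curve can be chosen convergent.\<close>

lemma tangent_dense:
  assumes X: "\<And>s. x s \<in> X" and d: "\<And>s. has_vderiv x (x' s) s" and "\<epsilon> > 0"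
  shows "\<exists>s1 h q. dist s1 s0 < \<epsilon> \<and> h \<in> SL2 \<and> x s1 = R h *v v \<and> x' s1 = R h *v (P *v q)"
proof -
  \<comment> \<open>The closed ball of half the radius is compact, and an accumulation point in it
    is still closer than \<open>\<epsilon>\<close> to \<open>s0\<close>.\<close>
  define S where "S m = {s \<in> cball s0 (\<epsilon>/2). \<exists>h\<in>SL2. norm h \<le> real m \<and> x s = R h *v v}" for m :: nat
  have "cball s0 (\<epsilon>/2) \<subseteq> (\<Union>m. S m)"
  proof
    fix s assume s: "s \<in> cball s0 (\<epsilon>/2)"
    obtain h where h: "h \<in> SL2" "x s = R h *v v" using X[of s] by (auto simp: X_def)
    obtain m :: nat where "norm h \<le> real m" using real_arch_simple by blast
    then show "s \<in> (\<Union>m. S m)" using s h by (auto simp: S_def)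
  qed
  have "\<exists>m. infinite (S m)"
  proof (rule ccontr)
    assume "\<nexists>m. infinite (S m)"
    then have "countable (\<Union>m. S m)" by (auto intro: countable_finite)
    then have "countable (cball s0 (\<epsilon>/2))"
      using \<open>cball s0 (\<epsilon>/2) \<subseteq> (\<Union>m. S m)\<close> countable_subset by blast
    then show False using uncountable_cball[of "\<epsilon>/2" s0] \<open>\<epsilon> > 0\<close> by simp
  qed
  then obtain m where "infinite (S m)" by blast
  moreover have "S m \<subseteq> cball s0 (\<epsilon>/2)" by (auto simp: S_def)
  ultimately obtain s1 where s1: "s1 \<in> cball s0 (\<epsilon>/2)" "s1 islimpt S m"
    using compact_cball[of s0 "\<epsilon>/2"] unfolding compact_eq_Bolzano_Weierstrass by blast
  then obtain f where f: "\<And>n. f n \<in> S m - {s1}" "f \<longlonglongrightarrow> s1"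
    unfolding islimpt_sequential by blast
  have "\<forall>n. \<exists>h. h \<in> SL2 \<and> norm h \<le> real m \<and> x (f n) = R h *v v"
    using f(1) by (auto simp: S_def)
  then obtain H where H: "\<And>n. H n \<in> SL2" "\<And>n. norm (H n) \<le> real m" "\<And>n. x (f n) = R (H n) *v v"
    by metis
  have "\<forall>n. H n \<in> cball 0 (real m)" using H by simp
  then obtain h0 r where r: "strict_mono r" "(H \<circ> r) \<longlonglongrightarrow> h0"
    using compact_imp_seq_compact[OF compact_cball[of "0::complex^2^2" "real m"]] unfolding seq_compact_def by blast
  then have Hr: "(\<lambda>n. H (r n)) \<longlonglongrightarrow> h0" by (simp add: o_def)
  have h0: "h0 \<in> SL2"
    using tendsto_det[OF Hr] H(1) by (simp add: SL2_def LIMSEQ_const_iff)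
  have fr: "(\<lambda>n. f (r n)) \<longlonglongrightarrow> s1"
    using LIMSEQ_subseq_LIMSEQ[OF f(2) r(1)] by (simp add: o_def)
  have "(\<lambda>n. x (f (r n))) \<longlonglongrightarrow> x s1"
    by (rule isCont_tendsto_compose[OF has_vderiv_isCont[OF d] fr])
  moreover have "(\<lambda>n. x (f (r n))) \<longlonglongrightarrow> R h0 *v v"
    unfolding H(3) by (intro tendsto_mulv tendsto_R Hr tendsto_const)
  ultimately have xs1: "x s1 = R h0 *v v" by (rule LIMSEQ_unique)
  let ?A = "\<lambda>n. adj2 h0 ** H (r n)"
  have A: "?A n \<in> SL2" for n using H h0 by (simp add: SL2_mult adj2_SL2)
  have A1: "?A \<longlonglongrightarrow> mat 1"
    using tendsto_matmul[OF tendsto_const[of "adj2 h0"] Hr] h0 by (simp add: adj2_mult)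
  let ?w = "R (adj2 h0) *v x' s1"
  have "filterlim (\<lambda>n. f (r n)) (at s1) sequentially"
    using fr f(1) by (intro filterlim_atI) auto
  then have "(\<lambda>n. (1 / (f (r n) - s1)) *s (x (f (r n)) - x s1)) \<longlonglongrightarrow> x' s1"
    by (rule filterlim_compose[OF has_vderiv_quotient[OF d]])
  then have "(\<lambda>n. R (adj2 h0) *v ((1 / (f (r n) - s1)) *s (x (f (r n)) - x s1))) \<longlonglongrightarrow> ?w"
    by (rule tendsto_mulv[OF tendsto_const])
  moreover have "R (adj2 h0) *v ((1 / (f (r n) - s1)) *s (x (f (r n)) - x s1))
      = (1 / (f (r n) - s1)) *s (R (?A n) *v v - v)" for n
    using h0 H(1)
    by (simp only: mulv_smult matrix_vector_mult_diff_distrib xs1 H(3) mult adj2_SL2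
          matrix_vector_mul_assoc R_adj2 matrix_vector_mul_lid)
  ultimately have "?w = P *v (lam *v ?w)"
    by (intro tangent_at_v[OF A A1]) simp
  then have "R h0 *v ?w = R h0 *v (P *v (lam *v ?w))" by simp
  then have "x' s1 = R h0 *v (P *v (lam *v ?w))"
    using h0 by (simp add: R_adj2 matrix_vector_mul_assoc)
  moreover have "dist s1 s0 < \<epsilon>"
    using s1(1) \<open>\<epsilon> > 0\<close> by (simp add: dist_commute)
  ultimately show ?thesis using h0 xs1 by blast
qed

text \<open>The group elements \<open>h n\<close> at the good points near \<open>s0\<close> are not
  controlled. The frame \<open>PT\<close> avoids them: it consists of fixed Lie algebra elements,
  conjugated by \<open>h0\<close>, evaluated at \<open>x (s n)\<close>, and so varies continuously.
  The velocities have convergent coordinates in this frame, so tangency passes to the limit.\<close>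

lemma tangent:
  assumes X: "\<And>s. x s \<in> X" and d: "\<And>s. has_vderiv x (x' s) s" and c: "isCont x' s0"
    and h0: "h0 \<in> SL2" "x s0 = R h0 *v v"
  shows "x' s0 = R h0 *v (P *v (lam *v (R (adj2 h0) *v x' s0)))"
proof -
  have "\<forall>n. \<exists>s1 h q. dist s1 s0 < inverse (real (Suc n)) \<and> h \<in> SL2 \<and> x s1 = R h *v v \<and> x' s1 = R h *v (P *v q)"
    using tangent_dense[OF X d] by simp
  then obtain s h q where s: "\<And>n. dist (s n) s0 < inverse (real (Suc n))" and h: "\<And>n. h n \<in> SL2"
    and xs: "\<And>n. x (s n) = R (h n) *v v" and x's: "\<And>n. x' (s n) = R (h n) *v (P *v q n)"
    by metis
  have slim: "s \<longlonglongrightarrow> s0"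
  proof -
    have "(\<lambda>n. dist (s n) s0) \<longlonglongrightarrow> 0"
      by (rule Lim_null_comparison[OF _ LIMSEQ_inverse_real_of_nat]) (use s in \<open>auto simp: less_imp_le\<close>)
    then show ?thesis by (subst tendsto_dist_iff)
  qed
  have "\<exists>x' y' z'. R h0 ** D (ex j) (ey j) (ez j) = D x' y' z' ** R h0" for j
    using equivariance[of h0 "h0$1$1" "h0$1$2" "h0$2$1" "h0$2$2"] h0 by (simp add: mat2_eq_iff) blast
  then obtain ex' ey' ez' where ad: "\<And>j. R h0 ** D (ex j) (ey j) (ez j) = D (ex' j) (ey' j) (ez' j) ** R h0"
    by metis
  define PT where "PT y = (\<chi> i j. (D (ex' j) (ey' j) (ez' j) *v y) $ i)" for y
  have PT0: "PT (x s0) = R h0 ** P"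
  proof -
    have "D (ex' j) (ey' j) (ez' j) *v (R h0 *v v) = R h0 *v (D (ex j) (ey j) (ez j) *v v)" for j
      by (simp add: matrix_vector_mul_assoc ad)
    then show ?thesis
      unfolding PT_def h0 P by (simp only: matmul_columns)
  qed
  have PTlim: "(\<lambda>n. PT (x (s n))) \<longlonglongrightarrow> R h0 ** P"
    unfolding PT0[symmetric] PT_def
    by (intro vec_tendstoI)
       (simp, intro tendsto_vec_nth tendsto_mulv tendsto_const isCont_tendsto_compose[OF has_vderiv_isCont[OF d] slim])
  \<comment> \<open>\<open>K n\<close> tends to the identity; once its determinant is nonzero,
    \<open>PT\<close> spans the whole tangent space at \<open>x (s n)\<close>.\<close>
  define K where "K n = lam ** R (adj2 h0) ** PT (x (s n))" for n
  have "K \<longlonglongrightarrow> lam ** R (adj2 h0) ** (R h0 ** P)"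
    unfolding K_def by (intro tendsto_matmul tendsto_const PTlim)
  moreover have "lam ** R (adj2 h0) ** (R h0 ** P) = lam ** (R (adj2 h0) ** R h0) ** P"
    by (simp add: matrix_mul_assoc)
  ultimately have K1: "K \<longlonglongrightarrow> mat 1" using h0 by (simp add: R_adj2 lamP)
  define y where "y n = (SOME y. x' (s n) = PT (x (s n)) *v y)" for n
  have "(\<lambda>n. det (K n)) \<longlonglongrightarrow> 1" using tendsto_det[OF K1] by simp
  then have "\<forall>\<^sub>F n in sequentially. det (K n) \<noteq> 0"
    by (rule tendsto_imp_eventually_ne) simp
  then have y: "\<forall>\<^sub>F n in sequentially. x' (s n) = PT (x (s n)) *v y n"
  proof eventually_elim
    case (elim n)
    have "\<forall>j. \<exists>q. D (ex' j) (ey' j) (ez' j) *v x (s n) = R (h n) *v (P *v q)"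
      unfolding xs using D_orbit[OF h] by blast
    then obtain q' where q': "\<And>j. D (ex' j) (ey' j) (ez' j) *v x (s n) = R (h n) *v (P *v q' j)"
      by metis
    define C where "C = (\<chi> i j. q' j $ i)"
    have PTC: "PT (x (s n)) = R (h n) ** P ** C"
      unfolding PT_def q' C_def matmul_columns by (simp only: matrix_vector_mul_assoc)
    have "K n = (lam ** R (adj2 h0) ** R (h n) ** P) ** C"
      by (simp add: K_def PTC matrix_mul_assoc)
    then have "det C \<noteq> 0" using elim by (auto simp: det_mul)
    then obtain C' where "C ** C' = mat 1"
      by (auto simp: invertible_det_nz[symmetric] invertible_def)
    then have "PT (x (s n)) *v (C' *v q n) = x' (s n)"
      unfolding PTC x's by (simp add: matrix_vector_mul_assoc flip: matrix_mul_assoc)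
    then show ?case unfolding y_def by (metis (mono_tags, lifting) someI)
  qed
  have x'lim: "(\<lambda>n. x' (s n)) \<longlonglongrightarrow> x' s0"
    by (rule isCont_tendsto_compose[OF c slim])
  define u where "u n = lam *v (R (adj2 h0) *v x' (s n))" for n
  have ulim: "u \<longlonglongrightarrow> lam *v (R (adj2 h0) *v x' s0)"
    unfolding u_def by (intro tendsto_mulv tendsto_const x'lim)
  define \<delta> where "\<delta> n = (\<Sum>i\<in>UNIV. \<Sum>j\<in>UNIV. norm ((mat 1 - K n)$i$j))" for n
  have "(\<lambda>n. mat 1 - K n) \<longlonglongrightarrow> mat 1 - mat 1"
    by (intro tendsto_diff tendsto_const K1)
  then have "\<delta> \<longlonglongrightarrow> (\<Sum>i\<in>(UNIV::'r set). \<Sum>j\<in>(UNIV::'r set). norm ((mat 1 - mat 1 :: complex^'r^'r)$i$j))"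
    unfolding \<delta>_def by (intro tendsto_sum tendsto_norm tendsto_vec_nth)
  then have \<delta>: "\<delta> \<longlonglongrightarrow> 0" by simp
  then have "\<forall>\<^sub>F n in sequentially. \<delta> n < 1/2"
    by (rule order_tendstoD) simp
  then have "\<forall>\<^sub>F n in sequentially. norm (y n - u n) \<le> \<delta> n * (2 * norm (u n))"
    using y
  proof eventually_elim
    case (elim n)
    \<comment> \<open>No bound on \<open>y n\<close> is known in advance; since \<open>K n\<close>
      is near the identity, \<open>y n\<close> inherits a bound and the limit from
      \<open>u n\<close>.\<close>
    have "u n = K n *v y n"
      unfolding u_def K_def elim by (simp add: matrix_vector_mul_assoc matrix_mul_assoc)
    then have "y n - u n = (mat 1 - K n) *v y n"
      by (simp add: matrix_vector_mult_diff_rdistrib)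
    then have 1: "norm (y n - u n) \<le> \<delta> n * norm (y n)"
      unfolding \<delta>_def using norm_mulv_le by metis
    also have "\<dots> \<le> 1/2 * norm (y n)" using elim by (intro mult_right_mono) auto
    finally have "norm (y n - u n) \<le> 1/2 * norm (y n)" .
    moreover have "norm (y n) \<le> norm (u n) + norm (y n - u n)"
      by (metis add.commute diff_add_cancel norm_triangle_ineq)
    ultimately have "norm (y n) \<le> 2 * norm (u n)" by simp
    moreover have "\<delta> n \<ge> 0" by (auto simp: \<delta>_def intro!: sum_nonneg)
    ultimately have "\<delta> n * norm (y n) \<le> \<delta> n * (2 * norm (u n))" by (intro mult_left_mono)
    with 1 show ?case by simp
  qed
  moreover have "(\<lambda>n. \<delta> n * (2 * norm (u n))) \<longlonglongrightarrow> 0"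
    using tendsto_mult[OF \<delta> tendsto_mult_left[OF tendsto_norm[OF ulim]], of 2] by simp
  ultimately have "(\<lambda>n. y n - u n) \<longlonglongrightarrow> 0"
    by (rule Lim_null_comparison)
  from tendsto_add[OF this ulim] have "y \<longlonglongrightarrow> lam *v (R (adj2 h0) *v x' s0)" by simp
  then have "(\<lambda>n. PT (x (s n)) *v y n) \<longlonglongrightarrow> (R h0 ** P) *v (lam *v (R (adj2 h0) *v x' s0))"
    by (intro tendsto_mulv PTlim)
  then have "(\<lambda>n. x' (s n)) \<longlonglongrightarrow> (R h0 ** P) *v (lam *v (R (adj2 h0) *v x' s0))"
    by (rule Lim_transform_eventually) (use y in \<open>eventually_elim, simp\<close>)
  from LIMSEQ_unique[OF x'lim this] show ?thesis
    by (simp add: matrix_vector_mul_assoc matrix_mul_assoc)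
qed

text \<open>Holomorphy supplies the continuity of the velocity that \<open>tangent\<close> asks
  for.\<close>

lemma tangent_holomorphic:
  assumes X: "\<And>s. x s \<in> X" and hol: "\<And>i. (\<lambda>s. x s $ i) holomorphic_on UNIV"
    and d: "has_vderiv x w s0" and h: "h \<in> SL2" "x s0 = R h *v v"
  shows "w = R h *v (P *v (lam *v (R (adj2 h) *v w)))"
proof -
  define x' where "x' s = (\<chi> i. deriv (\<lambda>s. x s $ i) s)" for s
  have d': "has_vderiv x (x' s) s" for s
    unfolding has_vderiv_def x'_def using hol by (auto intro: holomorphic_derivI)
  have "isCont x' s0"
    unfolding isCont_def
  proof (intro vec_tendstoI)
    fix i
    have "deriv (\<lambda>s. x s $ i) holomorphic_on UNIV"
      using hol by (intro holomorphic_deriv) auto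
    then have "isCont (deriv (\<lambda>s. x s $ i)) s0"
      using holomorphic_on_imp_continuous_on continuous_on_eq_continuous_at by blast
    then show "((\<lambda>s. x' s $ i) \<longlongrightarrow> x' s0 $ i) (at s0)"
      by (simp add: x'_def isCont_def)
  qed
  from tangent[OF X d' this h] show ?thesis
    using has_vderiv_unique[OF d d'[of s0]] by simp
qed

text \<open>The affine map carries the curves \<open>R (h ** curve _ _ _ s) *v v\<close> to
  holomorphic curves in \<open>X\<close> through \<open>R h' *v v\<close>, whose velocities are
  tangent there. \<open>C\<close> is the differential of the map in the frames at the two
  points.\<close>

lemma affine_tangent:
  assumes inv: "\<And>x. x \<in> X \<Longrightarrow> M *v x + c \<in> X" and h: "h \<in> SL2" "h' \<in> SL2"
    and e: "M *v (R h *v v) + c = R h' *v v"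
  shows "\<exists>C. M ** R h ** P = R h' ** P ** C"
proof -
  have "\<exists>q. (M ** R h) *v (D (ex j) (ey j) (ez j) *v v) = R h' *v (P *v q)" for j
  proof -
    let ?c = "curve (ex j) (ey j) (ez j)"
    define x where "x s = (M ** R h) *v (R (?c s) *v v) + c" for s
    have "x s \<in> X" for s
    proof -
      have "x s = M *v (R (h ** ?c s) *v v) + c"
        using h by (simp add: x_def mult matrix_vector_mul_assoc matrix_mul_assoc)
      moreover have "R (h ** ?c s) *v v \<in> X" using h by (auto simp: X_def SL2_mult)
      ultimately show ?thesis using inv by simp
    qed
    moreover have "(\<lambda>s. x s $ i) holomorphic_on UNIV" for i
      unfolding x_def matrix_vector_mult_def
      by (simp, intro holomorphic_intros curve_holomorphic)
    moreover have "has_vderiv x ((M ** R h) *v (D (ex j) (ey j) (ez j) *v v)) 0"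
      unfolding x_def
      using has_vderiv_add[OF has_vderiv_mult_left[OF has_vderiv_mult_right[OF deriv_curve]] has_vderiv_const]
      by simp
    moreover have "x 0 = R h' *v v"
      using e by (simp add: x_def one matrix_vector_mul_assoc)
    ultimately show ?thesis using tangent_holomorphic h(2) by blast
  qed
  then obtain q where q: "\<And>j. (M ** R h) *v (D (ex j) (ey j) (ez j) *v v) = R h' *v (P *v q j)"
    by metis
  have "M ** R h ** P = R h' ** P ** (\<chi> i j. q j $ i)"
    unfolding matmul_columns q[symmetric] matrix_vector_mul_assoc[of "R h'", symmetric]
    by (subst P) (simp only: matmul_columns)
  then show ?thesis by blast
qed

end

section \<open>Volume forms and divergence\<close>

lemma polynomial_curve_const: "polynomial_curve (\<lambda>t. c)"
  unfolding polynomial_curve_def by (rule exI[of _ "[:c:]"]) simp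

lemma polynomial_curve_ident: "polynomial_curve (\<lambda>t. t)"
  unfolding polynomial_curve_def by (rule exI[of _ "[:0, 1:]"]) simp

lemma polynomial_curve_add:
  assumes "polynomial_curve f" "polynomial_curve g"
  shows "polynomial_curve (\<lambda>t. f t + g t)"
proof -
  from assms obtain p q where "\<forall>t. f t = poly p t" "\<forall>t. g t = poly q t"
    unfolding polynomial_curve_def by blast
  then show ?thesis unfolding polynomial_curve_def by (intro exI[of _ "p + q"]) simp
qed

lemma polynomial_curve_mult:
  assumes "polynomial_curve f" "polynomial_curve g"
  shows "polynomial_curve (\<lambda>t. f t * g t)"
proof -
  from assms obtain p q where "\<forall>t. f t = poly p t" "\<forall>t. g t = poly q t"
    unfolding polynomial_curve_def by blast
  then show ?thesis unfolding polynomial_curve_def by (intro exI[of _ "p * q"]) simp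
qed

lemma polynomial_curve_sum:
  "(\<And>x. x \<in> S \<Longrightarrow> polynomial_curve (f x)) \<Longrightarrow> polynomial_curve (\<lambda>t. \<Sum>x\<in>S. f x t)"
  by (induction S rule: infinite_finite_induct) (auto intro: polynomial_curve_const polynomial_curve_add)

lemma polynomial_curve_prod:
  "(\<And>x. x \<in> S \<Longrightarrow> polynomial_curve (f x)) \<Longrightarrow> polynomial_curve (\<lambda>t. \<Prod>x\<in>S. f x t)"
  by (induction S rule: infinite_finite_induct) (auto intro: polynomial_curve_const polynomial_curve_mult)

lemma polynomial_curve_power: "polynomial_curve f \<Longrightarrow> polynomial_curve (\<lambda>t. f t ^ n)"
  by (induction n) (auto intro: polynomial_curve_const polynomial_curve_mult)

lemmas polynomial_curve_intros = polynomial_curve_const polynomial_curve_ident polynomial_curve_add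
  polynomial_curve_mult polynomial_curve_sum polynomial_curve_prod polynomial_curve_power

lemma polynomial_curve_diff: "polynomial_curve f \<Longrightarrow> polynomial_curve g \<Longrightarrow> polynomial_curve (\<lambda>t. f t - g t)"
  using polynomial_curve_add[OF _ polynomial_curve_mult[OF polynomial_curve_const[of "-1"]]] by fastforce

lemma polynomial_curve_det:
  "(\<And>i j. polynomial_curve (\<lambda>t. A t $ i $ j)) \<Longrightarrow> polynomial_curve (\<lambda>t. det (A t))"
  unfolding det_def by (intro polynomial_curve_intros)

lemma polynomial_curve_matmul:
  assumes "\<And>i j. polynomial_curve (\<lambda>t. A t $ i $ j)" "\<And>i j. polynomial_curve (\<lambda>t. B t $ i $ j)"
  shows "polynomial_curve (\<lambda>t. (A t ** B t) $ i $ j)"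
  unfolding matrix_matrix_mult_def
  by (simp, intro polynomial_curve_sum polynomial_curve_mult assms)

lemma polynomial_curve_holomorphic: "polynomial_curve f \<Longrightarrow> f holomorphic_on UNIV"
proof -
  assume "polynomial_curve f"
  then obtain p where "f = poly p" unfolding polynomial_curve_def by (auto simp: fun_eq_iff)
  then show ?thesis by (auto intro: holomorphic_intros)
qed

text \<open>Since \<open>j\<close> has no zeros, every root of \<open>p\<close> is a root of
  \<open>q\<close>. Cancelling common roots ends with a \<open>p\<close> without roots; then
  \<open>q\<close> has none either, and both are constant by the fundamental theorem of
  algebra.\<close>

lemma nonvanishing_ratio_const_aux:
  fixes j :: "complex \<Rightarrow> complex"
  assumes j: "\<And>t. j t \<noteq> 0"
    and local: "\<And>t. \<exists>a b. poly b t \<noteq> 0 \<and> (\<forall>s. poly a s = j s * poly b s)"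
  shows "p \<noteq> 0 \<Longrightarrow> (\<And>t. poly p t = j t * poly q t) \<Longrightarrow> \<exists>c. \<forall>t. j t = c"
proof (induction "degree p" arbitrary: p q rule: less_induct)
  case less
  show ?case
  proof (cases "\<exists>t0. poly p t0 = 0")
    case True
    then obtain t0 where t0: "poly p t0 = 0" by blast
    then have "poly q t0 = 0" using less.prems(2)[of t0] j by simp
    with t0 obtain p1 q1 where pq: "p = [:-t0, 1:] * p1" "q = [:-t0, 1:] * q1"
      unfolding poly_eq_0_iff_dvd by (auto elim!: dvdE)
    have "poly p1 t = j t * poly q1 t" for t
    proof (cases "t = t0")
      case False
      have "(t - t0) * poly p1 t = (t - t0) * (j t * poly q1 t)"
        using less.prems(2)[of t] by (simp add: pq algebra_simps)
      then show ?thesis using False by simp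
    next
      case True
      \<comment> \<open>At \<open>t0\<close> itself the common factor cannot be divided out
        pointwise, and continuity of \<open>j\<close> is not given. The representation with a
        denominator nonzero at \<open>t0\<close> replaces \<open>j\<close> by a polynomial
        identity.\<close>
      obtain a b where ab: "poly b t0 \<noteq> 0" "\<And>s. poly a s = j s * poly b s" using local by blast
      have "poly (p * b) s = poly (a * q) s" for s
        using less.prems(2)[of s] ab(2)[of s] by simp
      then have "p * b = a * q" by (simp add: poly_eq_poly_eq_iff[symmetric] fun_eq_iff)
      then have "[:-t0, 1:] * (p1 * b) = [:-t0, 1:] * (a * q1)"
        unfolding pq by (simp only: mult_ac)
      then have "p1 * b = a * q1" by (subst (asm) mult_cancel_left) simp
      then have "poly p1 t0 * poly b t0 = poly a t0 * poly q1 t0" by (metis poly_mult)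
      then show ?thesis using ab True by simp
    qed
    moreover have "p1 \<noteq> 0" using less.prems(1) pq by auto
    moreover have "degree p1 < degree p"
      using \<open>p1 \<noteq> 0\<close> unfolding pq by (subst degree_mult_eq) auto
    ultimately show ?thesis using less.hyps by blast
  next
    case False
    then have "poly q t \<noteq> 0" for t using less.prems(2)[of t] j by auto
    then have "constant (poly p)" "constant (poly q)"
      using False fundamental_theorem_of_algebra by blast+
    then have "poly p t = poly p 0" "poly q t = poly q 0" for t
      unfolding constant_def by blast+
    then have "j t = poly p 0 / poly q 0" for t
      using less.prems(2)[of t] \<open>\<And>t. poly q t \<noteq> 0\<close> by (metis nonzero_eq_divide_eq)
    then show ?thesis by blast
  qed
qed

text \<open>For each \<open>t\<close> some index \<open>L\<close> has
  \<open>N L t \<noteq> 0\<close>, hence \<open>q L t \<noteq> 0\<close>; so \<open>j\<close> is a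
  quotient of polynomials with a denominator that does not vanish at the chosen point.\<close>

lemma nonvanishing_ratio_const:
  fixes j :: "complex \<Rightarrow> complex"
  assumes "\<And>L. polynomial_curve (N L)" "\<And>L. polynomial_curve (q L)"
    and rel: "\<And>L t. N L t = j t * q L t" and j: "\<And>t. j t \<noteq> 0" and N: "\<And>t. \<exists>L. N L t \<noteq> 0"
  shows "j s = j t"
proof -
  have 1: "\<exists>a b. poly b t \<noteq> 0 \<and> (\<forall>s. poly a s = j s * poly b s)" for t
  proof -
    obtain L where L: "N L t \<noteq> 0" using N by blast
    obtain a b where ab: "\<And>s. N L s = poly a s" "\<And>s. q L s = poly b s"
      using assms(1,2) unfolding polynomial_curve_def by meson
    show ?thesis using L rel[of L] by (intro exI[of _ a] exI[of _ b]) (auto simp flip: ab)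
  qed
  then obtain a b where "poly b 0 \<noteq> 0" "\<And>s. poly a s = j s * poly b s" by blast
  moreover from this j[of 0] have "a \<noteq> 0" by (metis mult_eq_0_iff poly_0)
  ultimately have "\<exists>c. \<forall>t. j t = c"
    using nonvanishing_ratio_const_aux[OF j 1] by blast
  then show ?thesis by auto
qed

section \<open>Derivatives of determinants and of polynomial functions along curves\<close>

definition det_deriv :: "complex^'n^'n \<Rightarrow> complex^'n^'n \<Rightarrow> complex" where
  "det_deriv A A' = (\<Sum>p | p permutes (UNIV::'n set). of_int (sign p) *
      (\<Sum>i\<in>UNIV. A' $ i $ p i * (\<Prod>k\<in>UNIV-{i}. A $ k $ p k)))"

lemma has_field_derivative_det:
  assumes "has_mderiv A A' t"
  shows "((\<lambda>s. det (A s)) has_field_derivative det_deriv (A t) A') (at t)"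
  using assms unfolding det_def det_deriv_def has_mderiv_def
  by (intro DERIV_sum DERIV_cmult has_field_derivative_prod) simp

text \<open>A permutation other than the identity moves at least two points, so a vanishing
  off-diagonal entry remains after one factor is removed.\<close>

lemma det_deriv_one: "det_deriv (mat 1) A' = trace (A' :: complex^'n^'n)"
proof -
  let ?f = "\<lambda>p. of_int (sign p) *
      (\<Sum>i\<in>UNIV. A' $ i $ p i * (\<Prod>k\<in>UNIV-{i}. (mat 1 :: complex^'n^'n) $ k $ p k))"
  have "?f p = 0" if p: "p permutes (UNIV :: 'n set)" "p \<noteq> id" for p
  proof -
    have z: "(\<Prod>k\<in>UNIV-{i}. (mat 1 :: complex^'n^'n) $ k $ p k) = 0" for i
    proof -
      have "\<exists>k. k \<noteq> i \<and> p k \<noteq> k"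
      proof (rule ccontr)
        assume "\<not> ?thesis"
        then have *: "\<And>k. k \<noteq> i \<Longrightarrow> p k = k" by blast
        have "p i = i" using * permutes_inj[OF p(1)] by (metis injD)
        then have "p k = k" for k using * by (cases "k = i") auto
        then have "p = id" by (simp add: fun_eq_iff)
        with p show False by simp
      qed
      then obtain k where "k \<noteq> i" "p k \<noteq> k" by blast
      then show ?thesis by (intro prod_zero) (auto simp: mat_def intro!: bexI[of _ k])
    qed
    show ?thesis by (simp only: z) simp
  qed
  then have "det_deriv (mat 1) A' = (\<Sum>p\<in>{id}. ?f p)"
    unfolding det_deriv_def
    by (intro sum.mono_neutral_right) (auto simp: finite_permutations permutes_id)
  then show ?thesis by (simp add: trace_def mat_def sign_id)
qed

lemma has_field_derivative_det_square:
  assumes "has_mderiv A A' t" "A t = mat 1"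
  shows "((\<lambda>s. (det (A s))\<^sup>2) has_field_derivative 2 * trace A') (at t)"
  using has_field_derivative_det[OF assms(1)] assms(2)
  by (auto intro!: derivative_eq_intros simp: det_deriv_one)

text \<open>Allows the line \<open>1 + sX\<close>, used for the mean, to be replaced by a curve in
  \<open>SL2\<close> with the same velocity, where \<open>R\<close> is multiplicative.\<close>

lemma polyfun2_curve_deriv:
  assumes "polyfun2 f"
  shows "\<exists>d. \<forall>T. T 0 = A \<longrightarrow> has_mderiv T T' 0 \<longrightarrow> ((\<lambda>t. f (T t)) has_field_derivative d) (at 0)"
proof -
  obtain p q r s where grad: "(f has_derivative
      (\<lambda>X. p * X$1$1 + q * X$1$2 + r * X$2$1 + s * X$2$2)) (at A)"
    using polyfun2_gradient[OF assms] by blast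
  have "((\<lambda>t. f (T t)) has_field_derivative p * T'$1$1 + q * T'$1$2 + r * T'$2$1 + s * T'$2$2) (at 0)"
    if T: "T 0 = A" "has_mderiv T T' 0" for T
  proof -
    have "(T has_derivative (\<lambda>t. \<chi> i j. T'$i$j * t)) (at 0)"
      by (intro has_derivative_vecI) (use T in \<open>simp add: has_mderiv_def has_field_derivative_def\<close>)
    then have "((\<lambda>t. f (T t)) has_derivative
       (\<lambda>t. p * (T'$1$1 * t) + q * (T'$1$2 * t) + r * (T'$2$1 * t) + s * (T'$2$2 * t))) (at 0)"
      using has_derivative_compose[of T _ 0 UNIV f] grad T(1) by fastforce
    then show ?thesis
      unfolding has_field_derivative_def
      by (rule has_derivative_eq_rhs) (auto simp: fun_eq_iff algebra_simps)
  qed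
  then show ?thesis by blast
qed

lemma polyfun2_mulv:
  assumes "\<And>i j. polyfun2 (\<lambda>A. M A $ i $ j)" "\<And>i. polyfun2 (\<lambda>A. x A $ i)"
  shows "polyfun2 (\<lambda>A. (M A *v x A) $ i)"
  unfolding matrix_vector_mult_def by (auto intro!: polyfun2_intros assms)

context sl2_rep
begin

lemma polynomial_curve_R:
  assumes "\<And>i j. polynomial_curve (\<lambda>t. U t $ i $ j)"
  shows "polynomial_curve (\<lambda>t. R (U t) $ i $ j)"
  by (rule polyfun2_closed[where Q = polynomial_curve and T = U, OF poly])
     (auto intro: polynomial_curve_const polynomial_curve_add polynomial_curve_mult assms)

text \<open>Applying \<open>dE\<close> or \<open>dF\<close> to the vector of means gives means of
  left derivatives, which are zero; so this vector is invariant under the group.\<close>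

lemma mean_orbit_eventually_zero:
  assumes noinv: "\<And>w. (\<forall>h\<in>SL2. R h *v w = w) \<Longrightarrow> w = 0"
  shows "\<forall>\<^sub>F K in sequentially. \<forall>i. mean K (\<lambda>h. (R h *v v) $ i) = 0"
proof -
  have poly_R: "polyfun2 (\<lambda>h. (M *v (R h *v v)) $ i)" for M :: "complex^'n^'m" and i
    by (auto intro!: polyfun2_mulv poly polyfun2_const)
  have ev: "\<forall>\<^sub>F K in sequentially. mean K (\<lambda>h. (d *v (R h *v v)) $ i) = 0"
    if d: "has_mderiv (\<lambda>s. R (c s)) d 0" "\<And>s. c s \<in> SL2"
      and c: "\<And>s. c s = mat2 1 (s * x) (s * y) 1" for c d x y i
  proof -
    obtain g where g: "\<And>h. ((\<lambda>s. (R (c s ** h) *v v) $ i) has_field_derivative g h) (at 0)"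
      "\<forall>\<^sub>F K in sequentially. mean K g = 0"
      using polyfun2_left_derivative[of "\<lambda>h. (R h *v v) $ i" 0 x y] polyfun2_mulv[OF poly polyfun2_const, of v i]
      by (auto simp: c)
    have "g h = (d *v (R h *v v)) $ i" if "h \<in> SL2" for h
    proof -
      have "has_vderiv (\<lambda>s. R (c s) *v (R h *v v)) (d *v (R h *v v)) 0"
        by (intro has_vderiv_mult_right d)
      then have "((\<lambda>s. (R (c s ** h) *v v) $ i) has_field_derivative (d *v (R h *v v)) $ i) (at 0)"
        using that d(2) by (simp add: has_vderiv_def mult matrix_vector_mul_assoc)
      then show ?thesis using g(1) DERIV_unique by blast
    qed
    then have "mean K g = mean K (\<lambda>h. (d *v (R h *v v)) $ i)" for K by (intro mean_cong)
    then show ?thesis using g(2) by simp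
  qed
  have upper_eq: "upper s = mat2 1 (s * 1) (s * 0) 1" and lower_eq: "lower s = mat2 1 (s * 0) (s * 1) 1" for s
    by (simp_all add: upper_def lower_def)
  have E: "\<forall>\<^sub>F K in sequentially. \<forall>i. mean K (\<lambda>h. (dE *v (R h *v v)) $ i) = 0"
    by (intro eventually_all_finite ev[OF deriv_upper upper_SL2 upper_eq])
  have F: "\<forall>\<^sub>F K in sequentially. \<forall>i. mean K (\<lambda>h. (dF *v (R h *v v)) $ i) = 0"
    by (intro eventually_all_finite ev[OF deriv_lower lower_SL2 lower_eq])
  from E F show ?thesis
  proof eventually_elim
    case (elim K)
    define W where "W = (\<chi> i. mean K (\<lambda>h. (R h *v v) $ i))"
    have lin: "d *v W = (\<chi> i. mean K (\<lambda>h. (d *v (R h *v v)) $ i))" for d :: "complex^'n^'n"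
    proof -
      have "mean K (\<lambda>h. \<Sum>k\<in>UNIV. d$i$k * (R h *v v) $ k) = (\<Sum>k\<in>UNIV. d$i$k * mean K (\<lambda>h. (R h *v v) $ k))" for i
        using poly_R[of "mat 1"] by (subst mean_sum) (auto simp: mean_cmult intro!: polyfun2_mult polyfun2_const)
      then show ?thesis
        by (simp add: W_def vec_eq_iff matrix_vector_mult_def[of d])
    qed
    have "dE *v W = 0" "dF *v W = 0"
      using elim by (simp_all add: lin vec_eq_iff)
    then have "W = 0" using noinv[of W] fixed_of_EF[of W] by blast
    then show ?case by (simp add: W_def vec_eq_iff)
  qed
qed

end

context framed_orbit
begin

lemma D_combination:
  "D (\<Sum>j\<in>UNIV. q$j * ex j) (\<Sum>j\<in>UNIV. q$j * ey j) (\<Sum>j\<in>UNIV. q$j * ez j) = (\<chi> a b. \<Sum>j\<in>UNIV. q$j * D (ex j) (ey j) (ez j) $ a $ b)"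
  by (simp add: D_def vec_eq_iff sum.distrib sum_distrib_left sum_distrib_right algebra_simps)

definition Dq where "Dq q = D (\<Sum>j\<in>UNIV. q$j * ex j) (\<Sum>j\<in>UNIV. q$j * ey j) (\<Sum>j\<in>UNIV. q$j * ez j)"

lemma Dq_v: "Dq q *v v = P *v q"
  unfolding Dq_def D_combination
  by (subst P) (simp add: vec_eq_iff matrix_vector_mult_def sum_distrib_left sum_distrib_right mult_ac sum.swap[of _ "UNIV :: 'n set"])

lemma trace_columns: "trace (lam ** B ** P) = (\<Sum>j\<in>UNIV. (lam *v (B *v (D (ex j) (ey j) (ez j) *v v))) $ j)"
proof -
  have "lam ** B ** P = (\<chi> i j. ((lam ** B) *v (D (ex j) (ey j) (ez j) *v v)) $ i)"
    by (subst P) (simp only: matmul_columns)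
  then show ?thesis by (simp add: trace_def matrix_vector_mul_assoc matrix_mul_assoc)
qed

text \<open>Exchanging the two Lie algebra elements under the sum over \<open>j\<close> costs
  brackets, whose contribution is zero by \<open>bracket\<close>.\<close>

lemma bracket_Dq: "(\<Sum>j\<in>UNIV. (lam *v (D (ex j) (ey j) (ez j) *v (P *v q))) $ j) = trace (lam ** Dq q ** P)"
proof -
  let ?D = "\<lambda>j. D (ex j) (ey j) (ez j)"
  have swap: "(\<Sum>j\<in>UNIV. (lam *v (?D j *v (?D k *v v))) $ j) = (\<Sum>j\<in>UNIV. (lam *v (?D k *v (?D j *v v))) $ j)" for k
  proof -
    have "(\<Sum>j\<in>UNIV. (lam *v (?D j *v (?D k *v v))) $ j) - (\<Sum>j\<in>UNIV. (lam *v (?D k *v (?D j *v v))) $ j) = 0"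
      using bracket[of k]
      by (simp add: matrix_vector_mult_diff_rdistrib matrix_vector_mult_diff_distrib sum_subtractf matrix_vector_mul_assoc)
    then show ?thesis by simp
  qed
  have 1: "Dq q *v w = (\<Sum>k\<in>UNIV. q$k *s (?D k *v w))" for w
    unfolding Dq_def D_combination
    by (simp add: vec_eq_iff matrix_vector_mult_def sum_distrib_left sum_distrib_right mult_ac sum.swap[of _ "UNIV :: 'n set"])
  have "P *v q = (\<Sum>k\<in>UNIV. q$k *s (?D k *v v))" using 1[of v] by (simp add: Dq_v)
  then have "(\<Sum>j\<in>UNIV. (lam *v (?D j *v (P *v q))) $ j) = (\<Sum>j\<in>UNIV. \<Sum>k\<in>UNIV. q$k * (lam *v (?D j *v (?D k *v v))) $ j)"
    by (simp add: linear_sum[OF matrix_vector_mul_linear] mulv_smult)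
  also have "\<dots> = (\<Sum>k\<in>UNIV. q$k * (\<Sum>j\<in>UNIV. (lam *v (?D j *v (?D k *v v))) $ j))"
    by (subst sum.swap) (simp add: sum_distrib_left)
  also have "\<dots> = (\<Sum>k\<in>UNIV. q$k * (\<Sum>j\<in>UNIV. (lam *v (?D k *v (?D j *v v))) $ j))"
    by (simp only: swap)
  also have "\<dots> = (\<Sum>j\<in>UNIV. \<Sum>k\<in>UNIV. q$k * (lam *v (?D k *v (?D j *v v))) $ j)"
    by (subst sum.swap) (simp add: sum_distrib_left)
  also have "\<dots> = (\<Sum>j\<in>UNIV. (lam *v (Dq q *v (?D j *v v))) $ j)"
    by (simp add: 1 linear_sum[OF matrix_vector_mul_linear] mulv_smult)
  finally show ?thesis unfolding trace_columns .
qed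

text \<open>The field \<open>Bx + b\<close> is the image of \<open>x \<mapsto> Nx\<close> under
  \<open>g\<close>, and \<open>b\<close> is its value at 0. So \<open>b = 0\<close> says that
  \<open>N\<close> vanishes at the preimage \<open>- (M' *v c)\<close> of 0. With \<open>N\<close>
  equal to \<open>dE\<close> and to \<open>dF\<close>, this preimage is invariant under the group,
  hence 0.\<close>

lemma affine_stabilizer_linear:
  assumes noinv: "\<And>w. (\<forall>h\<in>SL2. R h *v w = w) \<Longrightarrow> w = 0"
    and M: "invertible M" and gX: "(\<lambda>x. M *v x + c) ` X = X"
  shows "c = 0"
proof -
  obtain M' where M': "M ** M' = mat 1" "M' ** M = mat 1"
    using M unfolding invertible_def by blast
  have key: "N *v (M' *v c) = 0"
    if U: "\<And>t. U t \<in> SL2" and U0: "U 0 = mat 1" and UN: "has_mderiv (\<lambda>t. R (U t)) N 0"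
      and Upoly: "\<And>i j. polynomial_curve (\<lambda>t. R (U t) $ i $ j)" for U N
  proof -
    define Mt where "Mt t = M ** R (U t) ** M'" for t
    define ct where "ct t = c - Mt t *v c" for t
    define B where "B = M ** N ** M'"
    define b where "b = - (B *v c)"
    have Mt0: "Mt 0 = mat 1" by (simp add: Mt_def U0 one M')
    have ct0: "ct 0 = 0" by (simp add: ct_def Mt0)
    have MtB: "has_mderiv Mt B 0"
      unfolding Mt_def B_def by (intro has_mderiv_mult_right has_mderiv_mult_left UN)
    have inX: "Mt t *v x + ct t \<in> X" if x: "x \<in> X" for t x
    proof -
      obtain y where y: "y \<in> X" "x = M *v y + c" using gX x by blast
      have "Mt t *v x + ct t = M *v (R (U t) *v ((M' ** M) *v y)) + c"
        unfolding y ct_def Mt_def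
        by (simp add: matrix_vector_right_distrib matrix_vector_mul_assoc matrix_mul_assoc)
      also have "\<dots> = M *v (R (U t) *v y) + c" by (simp add: M')
      also have "R (U t) *v y \<in> X"
        using y(1) U SL2_mult[OF U] unfolding X_def
        by (auto simp: matrix_vector_mul_assoc simp flip: mult)
      then have "M *v (R (U t) *v y) + c \<in> X" using gX by blast
      finally show ?thesis .
    qed
    have Mt_poly: "polynomial_curve (\<lambda>t. Mt t $ i $ j)" for i j
      unfolding Mt_def by (intro polynomial_curve_matmul polynomial_curve_const Upoly)
    have x_poly: "polynomial_curve (\<lambda>t. (Mt t *v x + ct t) $ i)" for x i
      unfolding ct_def matrix_vector_mult_def
      by (simp, intro polynomial_curve_add polynomial_curve_diff polynomial_curve_sum polynomial_curve_mult
           polynomial_curve_const Mt_poly)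
    have x_deriv: "has_vderiv (\<lambda>t. Mt t *v x + ct t) (B *v x + b) 0" for x
    proof -
      have e: "(\<lambda>t. Mt t *v x + ct t) = (\<lambda>t. Mt t *v (x - c) + c)"
        by (simp add: fun_eq_iff ct_def matrix_vector_mult_diff_distrib)
      have "has_vderiv (\<lambda>t. Mt t *v (x - c) + c) (B *v (x - c) + 0) 0"
        by (intro has_vderiv_add has_vderiv_mult_right has_vderiv_const MtB)
      moreover have "B *v (x - c) + 0 = B *v x + b"
        by (simp add: b_def matrix_vector_mult_diff_distrib)
      ultimately show ?thesis unfolding e by simp
    qed
    \<comment> \<open>The coordinates, in the frame \<open>P\<close>, of the field at
      \<open>R h *v v\<close> moved back to \<open>v\<close>.\<close>
    define \<alpha> where "\<alpha> h = lam *v (R (adj2 h) *v (B *v (R h *v v) + b))" for h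
    have beta: "B *v (R h *v v) + b = R h *v (P *v \<alpha> h)" if "h \<in> SL2" for h
      unfolding \<alpha>_def
    proof (rule tangent_holomorphic[OF _ _ x_deriv])
      show "Mt s *v (R h *v v) + ct s \<in> X" for s using that by (intro inX) (auto simp: X_def)
      show "(\<lambda>s. (Mt s *v (R h *v v) + ct s) $ i) holomorphic_on UNIV" for i
        by (intro polynomial_curve_holomorphic x_poly)
    qed (use that in \<open>simp_all add: Mt0 ct0\<close>)

    \<comment> \<open>For fixed \<open>t\<close> the two sides differ by a factor
      \<open>j t\<close>, the squared Jacobian of the affine map, which is the same for all
      \<open>L\<close>. Varying \<open>L\<close> presents \<open>j\<close> as a quotient of
      polynomials near every \<open>t\<close>; \<open>j 0 = 1\<close> then fixes the
      constant.\<close>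
    have density_preserved: "(det (L ** Mt t ** R h ** P))\<^sup>2 = Q (Mt t *v (R h *v v) + ct t)"
      if h: "h \<in> SL2" and Q: "vec_polynomial Q" "\<And>h. h \<in> SL2 \<Longrightarrow> Q (R h *v v) = (det (L ** R h ** P))\<^sup>2" for L t h Q
    proof -
      have "\<exists>Q. vec_polynomial Q \<and> (\<forall>h\<in>SL2. Q (R h *v v) = (det (L ** R h ** P))\<^sup>2)" for L
        by (rule density)
      then obtain Q' where Q': "\<And>L. vec_polynomial (Q' L)"
        "\<And>L h. h \<in> SL2 \<Longrightarrow> Q' L (R h *v v) = (det (L ** R h ** P))\<^sup>2" by metis
      let ?x = "\<lambda>t. Mt t *v (R h *v v) + ct t"
      \<comment> \<open>A left inverse of the transported frame, taken as \<open>L\<close>, gives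
        determinant 1. So some member of the family is nonzero at each \<open>t\<close>, and the
        Jacobian cannot vanish.\<close>
      have linv: "\<exists>W. W ** Mt t ** R h ** P = mat 1" for t
      proof (intro exI)
        have "lam ** R (adj2 h) ** (M ** R (adj2 (U t)) ** M') ** Mt t ** R h ** P
          = lam ** R (adj2 h) ** M ** (R (adj2 (U t)) ** ((M' ** M) ** R (U t))) ** M' ** R h ** P"
          unfolding Mt_def by (simp only: matrix_mul_assoc)
        also have "\<dots> = lam ** (R (adj2 h) ** ((M ** M') ** R h)) ** P"
          by (simp only: M'(2) R_adj2(2)[OF U] matrix_mul_lid matrix_mul_rid) (simp only: matrix_mul_assoc)
        also have "\<dots> = mat 1" using h by (simp add: M' R_adj2 lamP)
        finally show "lam ** R (adj2 h) ** (M ** R (adj2 (U t)) ** M') ** Mt t ** R h ** P = mat 1" .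
      qed
      have "\<exists>j. j \<noteq> 0 \<and> (\<forall>L Q. (\<forall>h\<in>SL2. Q (R h *v v) = (det (L ** R h ** P))\<^sup>2) \<longrightarrow>
          (det (L ** Mt t ** R h ** P))\<^sup>2 = j * Q (?x t))" for t
      proof -
        have "?x t \<in> X" using h by (intro inX) (auto simp: X_def)
        then obtain h' where h': "h' \<in> SL2" "?x t = R h' *v v" unfolding X_def by blast
        then obtain C where C: "Mt t ** R h ** P = R h' ** P ** C"
          using affine_tangent[OF inX h, of _ t] by metis
        have split: "det (L ** Mt t ** R h ** P) = det (L ** R h' ** P) * det C" for L
        proof -
          have "L ** Mt t ** R h ** P = L ** (Mt t ** R h ** P)" by (simp only: matrix_mul_assoc)
          also have "\<dots> = (L ** R h' ** P) ** C" unfolding C by (simp only: matrix_mul_assoc)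
          finally show ?thesis by (simp add: det_mul)
        qed
        obtain W where "W ** Mt t ** R h ** P = mat 1" using linv by blast
        then have "det C \<noteq> 0" using split[of W] by auto
        then show ?thesis
          by (intro exI[of _ "(det C)\<^sup>2"]) (auto simp: split h' power_mult_distrib)
      qed
      then obtain j where j: "\<And>t. j t \<noteq> 0"
        "\<And>t L Q. (\<And>h. h \<in> SL2 \<Longrightarrow> Q (R h *v v) = (det (L ** R h ** P))\<^sup>2) \<Longrightarrow>
          (det (L ** Mt t ** R h ** P))\<^sup>2 = j t * Q (?x t)" by metis
      have jc: "j s = j t" for s t
      proof (rule nonvanishing_ratio_const[where N = "\<lambda>L t. (det (L ** Mt t ** R h ** P))\<^sup>2" and q = "\<lambda>L t. Q' L (?x t)" and j = j])
        show "polynomial_curve (\<lambda>t. (det (L ** Mt t ** R h ** P))\<^sup>2)" for L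
        proof (rule polynomial_curve_power, rule polynomial_curve_det)
          show "polynomial_curve (\<lambda>t. (L ** Mt t ** R h ** P) $ i $ k)" for i k
            by (intro polynomial_curve_matmul polynomial_curve_const Mt_poly)
        qed
        show "polynomial_curve (\<lambda>t. Q' L (?x t))" for L
          by (rule Q'(1)[unfolded vec_polynomial_def, THEN conjunct1, rule_format, OF x_poly])
        show "(det (L ** Mt t ** R h ** P))\<^sup>2 = j t * Q' L (?x t)" for L t
          by (intro j(2) Q'(2))
        show "\<exists>L. (det (L ** Mt t ** R h ** P))\<^sup>2 \<noteq> 0" for t
          using linv[of t] by (metis det_I one_neq_zero power_eq_0_iff)
      qed (rule j(1))
      obtain W where "W ** Mt 0 ** R h ** P = mat 1" using linv by blast
      then have "j 0 = 1"
        using j(2)[of "Q' W" W 0, OF Q'(2)] Q'(2)[OF h, of W] by (simp add: Mt0 ct0)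
      then have "j t = 1" using jc[of t 0] by simp
      then show ?thesis using j(2)[of Q L t, OF Q(2)] by simp
    qed

    \<comment> \<open>Vanishing of the divergence. The affine flow \<open>?x\<close> and the group
      curve \<open>?y\<close> pass through the same point with the same velocity, so
      \<open>Q\<close> has the same derivative along both; \<open>density_preserved\<close>
      evaluates it on the first and the formula for \<open>Q\<close> on the second.\<close>
    have trace: "trace (lam ** (R (adj2 h) ** B ** R h) ** P) = trace (lam ** Dq (\<alpha> h) ** P)"
      if h: "h \<in> SL2" for h
    proof -
      define L where "L = lam ** R (adj2 h)"
      obtain Q where Q: "vec_polynomial Q" "\<And>h. h \<in> SL2 \<Longrightarrow> Q (R h *v v) = (det (L ** R h ** P))\<^sup>2"
        using density[of L] by blast
      let ?c = "curve (\<Sum>j\<in>UNIV. \<alpha> h$j * ex j) (\<Sum>j\<in>UNIV. \<alpha> h$j * ey j) (\<Sum>j\<in>UNIV. \<alpha> h$j * ez j)"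
      let ?x = "\<lambda>t. Mt t *v (R h *v v) + ct t" and ?y = "\<lambda>t. R h *v (R (?c t) *v v)"
      have "has_vderiv ?y (R h *v (Dq (\<alpha> h) *v v)) 0"
        unfolding Dq_def by (intro has_vderiv_mult_left has_vderiv_mult_right deriv_curve)
      then have y': "has_vderiv ?y (B *v (R h *v v) + b) 0"
        by (simp add: Dq_v beta h)
      obtain q where q: "\<And>x. x 0 = R h *v v \<Longrightarrow> has_vderiv x (B *v (R h *v v) + b) 0 \<Longrightarrow>
          ((\<lambda>t. Q (x t)) has_field_derivative q) (at 0)"
        using Q(1) unfolding vec_polynomial_def by meson
      have qa: "((\<lambda>t. Q (?x t)) has_field_derivative q) (at 0)"
        by (rule q[OF _ x_deriv]) (simp add: Mt0 ct0)
      have qb: "((\<lambda>t. (det (L ** Mt t ** R h ** P))\<^sup>2) has_field_derivative 2 * trace (L ** B ** R h ** P)) (at 0)"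
      proof (rule has_field_derivative_det_square)
        show "has_mderiv (\<lambda>t. L ** Mt t ** R h ** P) (L ** B ** R h ** P) 0"
          by (intro has_mderiv_mult_right has_mderiv_mult_left MtB)
        have "L ** Mt 0 ** R h ** P = lam ** (R (adj2 h) ** R h) ** P"
          by (simp add: Mt0 L_def matrix_mul_assoc)
        then show "L ** Mt 0 ** R h ** P = mat 1" using h by (simp add: R_adj2 lamP)
      qed
      have qe: "(\<lambda>t. (det (L ** Mt t ** R h ** P))\<^sup>2) = (\<lambda>t. Q (?x t))"
      proof
        show "(det (L ** Mt t ** R h ** P))\<^sup>2 = Q (?x t)" for t
          by (rule density_preserved[where Q = Q]) (rule h Q | assumption)+
      qed
      have 1: "q = 2 * trace (L ** B ** R h ** P)"
        by (rule DERIV_unique[OF qa qb[unfolded qe]])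
      have ya: "((\<lambda>t. Q (?y t)) has_field_derivative q) (at 0)"
        by (rule q[OF _ y']) (simp add: one)
      have ye: "Q (?y t) = (det (lam ** R (?c t) ** P))\<^sup>2" for t
      proof -
        have "Q (?y t) = Q (R (h ** ?c t) *v v)" using h by (simp add: mult matrix_vector_mul_assoc)
        also have "\<dots> = (det (L ** R (h ** ?c t) ** P))\<^sup>2" using h by (intro Q) (simp add: SL2_mult)
        also have "L ** R (h ** ?c t) ** P = lam ** (R (adj2 h) ** R h) ** R (?c t) ** P"
          using h by (simp add: mult L_def matrix_mul_assoc)
        finally show ?thesis using h by (simp add: R_adj2)
      qed
      have yb: "((\<lambda>t. (det (lam ** R (?c t) ** P))\<^sup>2) has_field_derivative 2 * trace (lam ** Dq (\<alpha> h) ** P)) (at 0)"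
        unfolding Dq_def
        by (rule has_field_derivative_det_square)
           (intro has_mderiv_mult_right has_mderiv_mult_left deriv_curve, simp add: one lamP)
      have "q = 2 * trace (lam ** Dq (\<alpha> h) ** P)"
        by (rule DERIV_unique[OF ya[unfolded ye] yb])
      with 1 show ?thesis by (simp add: L_def matrix_mul_assoc)
    qed

    have adj2_poly: "polyfun2 (\<lambda>h. R (adj2 h) $ i $ j)" for i j
    proof (rule polyfun2_compose[OF poly])
      fix k l :: 2
      show "polyfun2 (\<lambda>A. adj2 A $ k $ l)"
        using exhaust_2[of k] exhaust_2[of l] polyfun2_mult[OF polyfun2_const[of "-1"] polyfun2_coord]
        by (auto simp: adj2_def intro: polyfun2_coord)
    qed
    have \<alpha>_poly: "polyfun2 (\<lambda>h. \<alpha> h $ j)" for j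
      unfolding \<alpha>_def
      by (intro polyfun2_mulv adj2_poly polyfun2_const)
         (simp, intro polyfun2.add polyfun2_mulv poly polyfun2_const)
    have psi_poly: "polyfun2 (\<lambda>h. (R h *v v) $ i)" for i
      by (intro polyfun2_mulv poly polyfun2_const)
    let ?D = "\<lambda>j. D (ex j) (ey j) (ez j)"
    have "b $ i = 0" for i
    proof -
      \<comment> \<open>\<open>g\<close> is the derivative of
        \<open>\<alpha> h $ j * (R h *v v) $ i\<close> along the \<open>j\<close>-th frame element.
        Summed over \<open>j\<close> this is the divergence of the \<open>i\<close>-th coordinate
        times the field.\<close>
      have "\<exists>g. polyfun2 g \<and> (\<forall>\<^sub>F K in sequentially. mean K g = 0) \<and>
          (\<forall>h\<in>SL2. g h = (lam *v (R (adj2 h) *v (B *v (R h *v (?D j *v v))) - ?D j *v (P *v \<alpha> h))) $ j * (R h *v v) $ i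
            + \<alpha> h $ j * (R h *v (?D j *v v)) $ i)" for j
      proof -
        let ?f = "\<lambda>h. \<alpha> h $ j * (R h *v v) $ i"
        let ?c = "curve (ex j) (ey j) (ez j)"
        have fp: "polyfun2 ?f" by (intro polyfun2_mult \<alpha>_poly psi_poly)
        obtain g where g: "polyfun2 g" "\<forall>\<^sub>F K in sequentially. mean K g = 0"
          "\<And>h. ((\<lambda>s. ?f (h ** mat2 (1 + s * ez j) (s * ex j) (s * ey j) (1 - s * ez j))) has_field_derivative g h) (at 0)"
          using polyfun2_right_derivative[OF fp, of "ez j" "ex j" "ey j"] by blast
        have "g h = (lam *v (R (adj2 h) *v (B *v (R h *v (?D j *v v))) - ?D j *v (P *v \<alpha> h))) $ j * (R h *v v) $ i
            + \<alpha> h $ j * (R h *v (?D j *v v)) $ i" if h: "h \<in> SL2" for h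
        proof -
          let ?T' = "mat2 (ez j) (ex j) (ey j) (- ez j)"
          have T': "has_mderiv (\<lambda>s. mat2 (1 + s * ez j) (s * ex j) (s * ey j) (1 - s * ez j)) ?T' 0"
            "has_mderiv ?c ?T' 0"
            unfolding has_mderiv_def forall_2 mat2_nth
            using curve_entry_deriv[of "ex j" "ey j" "ez j"] by (auto intro!: derivative_eq_intros)
          have "\<exists>d. \<forall>T. T 0 = h \<longrightarrow> has_mderiv T (h ** ?T') 0 \<longrightarrow> ((\<lambda>t. ?f (T t)) has_field_derivative d) (at 0)"
            by (rule polyfun2_curve_deriv[OF fp])
          then obtain d where d: "\<And>T. T 0 = h \<Longrightarrow> has_mderiv T (h ** ?T') 0 \<Longrightarrow> ((\<lambda>t. ?f (T t)) has_field_derivative d) (at 0)"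
            by blast
          have "((\<lambda>s. ?f (h ** mat2 (1 + s * ez j) (s * ex j) (s * ey j) (1 - s * ez j))) has_field_derivative d) (at 0)"
            by (rule d) (simp flip: mat2_one, intro has_mderiv_mult_left T')
          then have "g h = d" using g(3) DERIV_unique by blast
          moreover have "((\<lambda>s. ?f (h ** ?c s)) has_field_derivative d) (at 0)"
            by (rule d) (simp, intro has_mderiv_mult_left T')
          ultimately have gd: "((\<lambda>s. ?f (h ** ?c s)) has_field_derivative g h) (at 0)" by simp
          have Rc: "R (h ** ?c s) = R h ** R (?c s)" for s using h by (simp add: mult)
          have adjc: "R (adj2 (h ** ?c s)) = R (adj2 (?c s)) ** R (adj2 h)" for s
          proof -
            have "adj2 (h ** ?c s) = adj2 (?c s) ** adj2 h"
              by (simp add: adj2_def mat2_mult mat2_eq_iff algebra_simps)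
            then show ?thesis using h by (simp add: mult adj2_SL2)
          qed
          have "has_mderiv (\<lambda>s. R (adj2 (?c s))) (D (- ex j) (- ey j) (- ez j)) 0"
            by (rule curve_deriv)
               (auto simp: adj2_def mat2_one intro!: derivative_eq_intros curve_entry_deriv)
          moreover have "D (- ex j) (- ey j) (- ez j) = - ?D j" by (simp add: D_def vec_eq_iff)
          ultimately have adj': "has_mderiv (\<lambda>s. R (adj2 (?c s))) (- ?D j) 0" by simp
          have psi': "has_vderiv (\<lambda>s. R (h ** ?c s) *v v) (R h *v (?D j *v v)) 0"
            unfolding Rc matrix_vector_mul_assoc[symmetric]
            by (intro has_vderiv_mult_left has_vderiv_mult_right deriv_curve)
          have "has_vderiv (\<lambda>s. R (adj2 (?c s)) *v (R (adj2 h) *v (B *v (R (h ** ?c s) *v v) + b)))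
              (- ?D j *v (R (adj2 h) *v (B *v (R (h ** ?c 0) *v v) + b))
               + R (adj2 (?c 0)) *v (R (adj2 h) *v (B *v (R h *v (?D j *v v)) + 0))) 0"
            by (intro has_vderiv_mult adj' has_vderiv_mult_left has_vderiv_add has_vderiv_const psi')
          moreover have "R (adj2 h) *v (B *v (R h *v v) + b) = P *v \<alpha> h"
          proof -
            have "R (adj2 h) *v (B *v (R h *v v) + b) = (R (adj2 h) ** R h) *v (P *v \<alpha> h)"
              unfolding beta[OF h] by (simp only: matrix_vector_mul_assoc matrix_mul_assoc)
            then show ?thesis using h by (simp add: R_adj2)
          qed
          moreover have "adj2 (mat 1) = mat 1" by (simp add: adj2_def mat2_one)
          ultimately have "has_vderiv (\<lambda>s. R (adj2 (?c s)) *v (R (adj2 h) *v (B *v (R (h ** ?c s) *v v) + b)))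
              (- ?D j *v (P *v \<alpha> h) + R (adj2 h) *v (B *v (R h *v (?D j *v v)))) 0"
            by (simp add: one)
          from has_vderiv_mult_left[OF this, of lam]
          have "has_vderiv (\<lambda>s. \<alpha> (h ** ?c s)) (lam *v (- ?D j *v (P *v \<alpha> h) + R (adj2 h) *v (B *v (R h *v (?D j *v v))))) 0"
            unfolding \<alpha>_def adjc matrix_vector_mul_assoc[of "R (adj2 (?c _))", symmetric] .
          moreover have "- ?D j *v (P *v \<alpha> h) + R (adj2 h) *v (B *v (R h *v (?D j *v v)))
             = R (adj2 h) *v (B *v (R h *v (?D j *v v))) - ?D j *v (P *v \<alpha> h)"
            by (simp add: vec_eq_iff matrix_vector_mult_def sum_negf)
          ultimately have "((\<lambda>s. \<alpha> (h ** ?c s) $ j) has_field_derivative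
              (lam *v (R (adj2 h) *v (B *v (R h *v (?D j *v v))) - ?D j *v (P *v \<alpha> h))) $ j) (at 0)"
            by (simp add: has_vderiv_def)
          moreover have "((\<lambda>s. (R (h ** ?c s) *v v) $ i) has_field_derivative (R h *v (?D j *v v)) $ i) (at 0)"
            using psi' by (simp add: has_vderiv_def)
          ultimately have "((\<lambda>s. ?f (h ** ?c s)) has_field_derivative
            (lam *v (R (adj2 h) *v (B *v (R h *v (?D j *v v))) - ?D j *v (P *v \<alpha> h))) $ j * (R (h ** ?c 0) *v v) $ i
            + (R h *v (?D j *v v)) $ i * \<alpha> (h ** ?c 0) $ j) (at 0)"
            by (rule DERIV_mult)
          from DERIV_unique[OF gd this] show ?thesis by (simp add: mult.commute)
        qed
        then show ?thesis using g by blast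
      qed
      then obtain g where g: "\<And>j. polyfun2 (g j)" "\<And>j. \<forall>\<^sub>F K in sequentially. mean K (g j) = 0"
          "\<And>j h. h \<in> SL2 \<Longrightarrow> g j h = (lam *v (R (adj2 h) *v (B *v (R h *v (?D j *v v))) - ?D j *v (P *v \<alpha> h))) $ j * (R h *v v) $ i
            + \<alpha> h $ j * (R h *v (?D j *v v)) $ i" by metis
      \<comment> \<open>By the product rule one part is the divergence of the field times the
        coordinate, zero by \<open>trace\<close> and \<open>bracket_Dq\<close>. The rest is the
        derivative of the coordinate along the field, which is the \<open>i\<close>-th entry of
        \<open>Bx + b\<close>.\<close>
      have sum_g: "(\<Sum>j\<in>UNIV. g j h) = (\<Sum>k\<in>UNIV. B$i$k * (R h *v v) $ k) + b $ i" if h: "h \<in> SL2" for h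
      proof -
        have "(\<Sum>j\<in>UNIV. (lam *v (R (adj2 h) *v (B *v (R h *v (?D j *v v))) - ?D j *v (P *v \<alpha> h))) $ j)
          = trace (lam ** (R (adj2 h) ** B ** R h) ** P) - trace (lam ** Dq (\<alpha> h) ** P)"
          unfolding trace_columns[of "R (adj2 h) ** B ** R h"] bracket_Dq[symmetric]
          by (simp add: matrix_vector_mult_diff_distrib sum_subtractf matrix_vector_mul_assoc matrix_mul_assoc)
        then have "(\<Sum>j\<in>UNIV. g j h) = (\<Sum>j\<in>UNIV. \<alpha> h $ j * (R h *v (?D j *v v)) $ i)"
          using trace[OF h] by (simp add: g(3) h sum.distrib flip: sum_distrib_right)
        also have "\<dots> = (R h *v (P *v \<alpha> h)) $ i"
        proof -
          have "R h ** P = (\<chi> i j. (R h *v (?D j *v v)) $ i)"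
            by (subst P) (simp only: matmul_columns)
          then have "(R h *v (P *v \<alpha> h)) = (\<chi> i j. (R h *v (?D j *v v)) $ i) *v \<alpha> h"
            by (simp only: matrix_vector_mul_assoc)
          then show ?thesis by (simp add: matrix_vector_mult_def[of "\<chi> i j. (R h *v (?D j *v v)) $ i"] mult.commute)
        qed
        also have "\<dots> = (B *v (R h *v v)) $ i + b $ i" using beta[OF h] by (metis vector_add_component)
        finally show ?thesis by (simp add: matrix_vector_mult_def[of B])
      qed
      have "\<forall>\<^sub>F K in sequentially. \<forall>j. mean K (g j) = 0"
        by (intro eventually_all_finite g)
      moreover have "\<forall>\<^sub>F K in sequentially. \<forall>k. mean K (\<lambda>h. (R h *v v) $ k) = 0"
        by (rule mean_orbit_eventually_zero[OF noinv])
      moreover have "\<forall>\<^sub>F K in sequentially. K > (0::nat)" by (rule eventually_gt_at_top)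
      ultimately have "\<forall>\<^sub>F K::nat in sequentially. b $ i = 0"
      proof eventually_elim
        case (elim K)
        have "0 = mean K (\<lambda>h. \<Sum>j\<in>UNIV. g j h)" using elim by (simp add: mean_sum g)
        also have "\<dots> = mean K (\<lambda>h. (\<Sum>k\<in>UNIV. B$i$k * (R h *v v) $ k) + b $ i)"
          by (rule mean_cong) (rule sum_g)
        also have "\<dots> = (\<Sum>k\<in>UNIV. B$i$k * mean K (\<lambda>h. (R h *v v) $ k)) + b $ i"
          using elim by (simp add: mean_add mean_sum mean_cmult mean_const polyfun2_sum polyfun2_mult polyfun2_const psi_poly)
        also have "\<dots> = b $ i" using elim by simp
        finally show ?case by simp
      qed
      then show ?thesis by simp
    qed
    then have "B *v c = 0" by (simp add: b_def vec_eq_iff)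
    then have "M' *v (B *v c) = 0" by simp
    moreover have "M' *v (B *v c) = N *v (M' *v c)"
      by (simp add: B_def matrix_vector_mul_assoc matrix_mul_assoc M')
    ultimately show ?thesis by simp
  qed
  have "dE *v (M' *v c) = 0"
  proof (rule key[OF upper_SL2 _ deriv_upper polynomial_curve_R])
    fix i j :: 2
    show "polynomial_curve (\<lambda>t. upper t $ i $ j)"
      using exhaust_2[of i] exhaust_2[of j]
      by (auto simp: upper_def intro: polynomial_curve_const polynomial_curve_ident)
  qed (simp add: upper_def mat2_one)
  moreover have "dF *v (M' *v c) = 0"
  proof (rule key[OF lower_SL2 _ deriv_lower polynomial_curve_R])
    fix i j :: 2
    show "polynomial_curve (\<lambda>t. lower t $ i $ j)"
      using exhaust_2[of i] exhaust_2[of j]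
      by (auto simp: lower_def intro: polynomial_curve_const polynomial_curve_ident)
  qed (simp add: lower_def mat2_one)
  ultimately have "M' *v c = 0" using noinv[of "M' *v c"] fixed_of_EF[of "M' *v c"] by blast
  then have "M *v (M' *v c) = 0" by simp
  then show ?thesis by (simp add: matrix_vector_mul_assoc M')
qed

end

section \<open>Orbits of highest weight vectors\<close>

lemma poly_eq_nonzero:
  fixes p q :: "complex poly"
  assumes "\<And>t. t \<noteq> 0 \<Longrightarrow> poly p t = poly q t"
  shows "p = q"
proof -
  have "poly ([:0, 1:] * p) t = poly ([:0, 1:] * q) t" for t
    using assms[of t] by (cases "t = 0") auto
  then have "[:0, 1:] * p = [:0, 1:] * q" by (subst poly_eq_poly_eq_iff[symmetric]) (rule ext)
  then show ?thesis by (subst (asm) mult_cancel_left) simp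
qed

text \<open>Outside the unit disc \<open>p\<close> takes values that \<open>q\<close> takes inside
  it, so \<open>p\<close> is bounded there and must be constant.\<close>

lemma poly_inverse_const:
  fixes p q :: "complex poly"
  assumes "\<And>a. a \<noteq> 0 \<Longrightarrow> poly p a = poly q (1 / a)"
  shows "poly p a = poly q 0"
proof -
  obtain p0 p1 where p: "p = pCons p0 p1" by (rule pCons_cases)
  have "p1 = 0"
  proof (rule ccontr)
    assume "p1 \<noteq> 0"
    have "compact (poly q ` cball 0 1)"
      by (intro compact_continuous_image compact_cball continuous_intros)
    then obtain B where B: "\<And>c. c \<in> cball 0 1 \<Longrightarrow> norm (poly q c) \<le> B"
      using compact_imp_bounded bounded_iff by (metis imageI)
    obtain r where r: "\<And>z. r \<le> norm z \<Longrightarrow> B + 1 \<le> norm (poly p z)"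
      using poly_infinity[OF \<open>p1 \<noteq> 0\<close>, of "B + 1" p0] unfolding p by blast
    define a where "a = complex_of_real (max r 1)"
    have a: "r \<le> norm a" "norm a \<ge> 1" by (auto simp: a_def)
    then have "a \<noteq> 0" by auto
    then have "norm (poly p a) \<le> B"
      using a assms[of a] B[of "1 / a"] by (simp add: norm_divide divide_simps)
    then show False using r[OF a(1)] by simp
  qed
  then have pc: "poly p a = p0" for a by (simp add: p)
  have "q = [:p0:]"
  proof (rule poly_eq_nonzero)
    fix c :: complex assume "c \<noteq> 0"
    then show "poly q c = poly [:p0:] c" using assms[of "1 / c"] pc by simp
  qed
  then show ?thesis by (simp add: pc)
qed

context sl2_rep
begin

lemma polynomial_curve_upper: "polynomial_curve (\<lambda>t. (R (upper t) *v w) $ i)"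
  and polynomial_curve_lower: "polynomial_curve (\<lambda>t. (R (lower t) *v w) $ i)"
proof -
  have "polynomial_curve (\<lambda>t. upper t $ i $ j)" "polynomial_curve (\<lambda>t. lower t $ i $ j)" for i j
    using exhaust_2[of i] exhaust_2[of j]
    by (auto simp: upper_def lower_def intro: polynomial_curve_const polynomial_curve_ident)
  then have "polynomial_curve (\<lambda>t. R (upper t) $ i $ j)" "polynomial_curve (\<lambda>t. R (lower t) $ i $ j)" for i j
    by (simp_all add: polynomial_curve_R)
  then show "polynomial_curve (\<lambda>t. (R (upper t) *v w) $ i)" "polynomial_curve (\<lambda>t. (R (lower t) *v w) $ i)"
    by (simp_all add: matrix_vector_mult_def polynomial_curve_sum polynomial_curve_mult polynomial_curve_const)
qed

definition weyl where "weyl = mat2 0 (-1) 1 0"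

lemma weyl_SL2: "weyl \<in> SL2" by (simp add: weyl_def mem_SL2_iff)

text \<open>By \<open>u(a) w\<^sub>0 u(1/a) = l(1/a) diag(a)\<close>, a polynomial in \<open>a\<close> equals a polynomial in \<open>1/a\<close>.\<close>

lemma highest_weight_nonpositive:
  assumes noinv: "\<And>w. (\<forall>h\<in>SL2. R h *v w = w) \<Longrightarrow> w = 0"
    and u: "\<And>x. R (upper x) *v w = w"
    and d: "\<And>s. s \<noteq> 0 \<Longrightarrow> s ^ N *s (R (diag s) *v w) = s ^ k *s w" and "k \<le> N"
  shows "w = 0"
proof -
  let ?w = "R weyl *v w"
  have rel: "a ^ (N - k) *s (R (upper a) *v ?w) = R (lower (1/a)) *v w" if "a \<noteq> 0" for a
  proof -
    have "upper a ** (weyl ** upper (1/a)) = lower (1/a) ** diag a"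
      using that by (simp add: mat2_eq_iff mat2_mult upper_def lower_def diag_def weyl_def)
    then have "R (upper a ** (weyl ** upper (1/a))) *v w = R (lower (1/a) ** diag a) *v w" by simp
    then have "R (upper a) *v (R weyl *v (R (upper (1/a)) *v w)) = R (lower (1/a)) *v (R (diag a) *v w)"
      using that by (simp add: mult SL2_mult weyl_SL2 matrix_vector_mul_assoc)
    then have "R (upper a) *v ?w = R (lower (1/a)) *v (R (diag a) *v w)" by (simp add: u)
    then have "a ^ N *s (R (upper a) *v ?w) = a ^ k *s (R (lower (1/a)) *v w)"
      using d[OF that] by (simp flip: mulv_smult)
    moreover have "a ^ N = a ^ k * a ^ (N - k)" using \<open>k \<le> N\<close> by (simp flip: power_add)
    ultimately have "a ^ k *s (a ^ (N - k) *s (R (upper a) *v ?w)) = a ^ k *s (R (lower (1/a)) *v w)"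
      by (simp add: vector_smult_assoc)
    then show ?thesis using that by (simp add: vec_eq_iff)
  qed
  have const: "a ^ (N - k) * (R (upper a) *v ?w) $ i = w $ i" for a i
  proof -
    obtain p where p: "\<And>a. a ^ (N - k) * (R (upper a) *v ?w) $ i = poly p a"
      using polynomial_curve_mult[OF polynomial_curve_power[OF polynomial_curve_ident] polynomial_curve_upper]
      unfolding polynomial_curve_def by meson
    obtain q where q: "\<And>a. (R (lower a) *v w) $ i = poly q a"
      using polynomial_curve_lower unfolding polynomial_curve_def by meson
    have "poly p a = poly q 0" for a
    proof (rule poly_inverse_const)
      fix a :: complex assume "a \<noteq> 0"
      from rel[OF this] show "poly p a = poly q (1/a)"
        by (simp flip: p q add: vec_eq_iff)
    qed
    then show ?thesis by (simp add: p flip: q) (simp add: lower_def one flip: mat2_one)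
  qed
  show ?thesis
  proof (cases "k = N")
    \<comment> \<open>Negative weight: the power of \<open>a\<close> vanishes at
      \<open>a = 0\<close>.\<close>
    case False
    then have "(0::complex) ^ (N - k) = 0" using \<open>k \<le> N\<close> by simp
    then have "w $ i = 0" for i using const[of 0 i] by (metis mult_zero_left)
    then show ?thesis by (simp add: vec_eq_iff)
  next
    \<comment> \<open>Weight zero: at \<open>a = 0\<close> the relation says that
      \<open>weyl\<close> fixes \<open>w\<close>. As \<open>weyl\<close> conjugates the upper into
      the lower unipotent subgroup, \<open>w\<close> is invariant.\<close>
    case True
    have ww: "?w = w"
      using const[of 0] True by (simp add: vec_eq_iff upper_def one flip: mat2_one)
    have "R (lower s) *v w = w" for s
    proof -
      have "lower s ** weyl = weyl ** upper (- s)"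
        by (simp add: mat2_eq_iff mat2_mult upper_def lower_def weyl_def)
      then have "R (lower s) *v ?w = R weyl *v (R (upper (-s)) *v w)"
        by (simp add: matrix_vector_mul_assoc weyl_SL2 flip: mult)
      then show ?thesis by (simp add: ww u)
    qed
    then show ?thesis using noinv SL2_generated u by blast
  qed
qed

text \<open>The entries of \<open>R (diag t) *v v\<close> are Laurent polynomials in
  \<open>t\<close>; \<open>Q\<close> describes this class. After multiplication by
  \<open>t ^ M\<close> the coefficient vectors \<open>W k\<close> are upper-invariant of weight
  \<open>k - M\<close>, so those with \<open>k \<le> M\<close> vanish.\<close>

lemma highest_weight_torus:
  assumes noinv: "\<And>w. (\<forall>h\<in>SL2. R h *v w = w) \<Longrightarrow> w = 0"
    and u: "\<And>x. R (upper x) *v v = v"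
  obtains r where "\<And>i. poly (r i) 0 = 0" "\<And>i t. t \<noteq> 0 \<Longrightarrow> (R (diag t) *v v) $ i = poly (r i) t"
proof -
  define Q where "Q g \<longleftrightarrow> (\<exists>N p. \<forall>t. t \<noteq> 0 \<longrightarrow> t ^ N * g t = poly p t)" for g :: "complex \<Rightarrow> complex"
  have Q_const: "Q (\<lambda>t. c)" for c
    unfolding Q_def by (intro exI[of _ 0] exI[of _ "[:c:]"]) simp
  have Q_id: "Q (\<lambda>t. t)"
    unfolding Q_def by (rule exI[of _ 0], rule exI[of _ "[:0,1:]"]) simp
  have Q_inv: "Q (\<lambda>t. 1 / t)"
    unfolding Q_def by (rule exI[of _ 1], rule exI[of _ "1"]) simp
  have Q_add: "Q (\<lambda>t. f t + g t)" and Q_mult: "Q (\<lambda>t. f t * g t)" if "Q f" "Q g" for f g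
  proof -
    from that obtain N p M q where fg: "\<And>t. t \<noteq> 0 \<Longrightarrow> t ^ N * f t = poly p t" "\<And>t. t \<noteq> 0 \<Longrightarrow> t ^ M * g t = poly q t"
      unfolding Q_def by blast
    show "Q (\<lambda>t. f t + g t)"
      unfolding Q_def
      by (rule exI[of _ "N + M"], rule exI[of _ "monom 1 M * p + monom 1 N * q"])
         (simp add: poly_monom power_add algebra_simps flip: fg)
    show "Q (\<lambda>t. f t * g t)"
      unfolding Q_def
      by (rule exI[of _ "N + M"], rule exI[of _ "p * q"])
         (simp add: power_add algebra_simps flip: fg)
  qed
  have QR: "Q (\<lambda>t. R (diag t) $ i $ j)" for i j
  proof (rule polyfun2_closed[where Q = Q and T = diag, OF poly Q_const Q_add Q_mult])
    fix i j :: 2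
    show "Q (\<lambda>t. diag t $ i $ j)"
      using exhaust_2[of i] exhaust_2[of j] by (auto simp: diag_def Q_const Q_id Q_inv)
  qed
  have Q_sum: "Q (\<lambda>t. \<Sum>x\<in>S. f x t)" if "\<And>x. x \<in> S \<Longrightarrow> Q (f x)" for S :: "'n set" and f
    using that by (induction S rule: infinite_finite_induct) (auto intro: Q_const Q_add)
  have "Q (\<lambda>t. (R (diag t) *v v) $ i)" for i
    unfolding matrix_vector_mult_def by (simp, intro Q_sum Q_mult QR Q_const)
  then obtain N p where Np: "\<And>i t. t \<noteq> 0 \<Longrightarrow> t ^ N i * (R (diag t) *v v) $ i = poly (p i) t"
    unfolding Q_def by metis
  define M where "M = (\<Sum>i\<in>UNIV. N i)"
  define P where "P i = monom 1 (M - N i) * p i" for i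
  have P: "t ^ M * (R (diag t) *v v) $ i = poly (P i) t" if "t \<noteq> 0" for i t
  proof -
    have "N i \<le> M" unfolding M_def by (intro member_le_sum) auto
    then have "t ^ M = t ^ (M - N i) * t ^ N i" by (simp flip: power_add)
    then show ?thesis using Np[OF that] by (simp add: P_def poly_monom)
  qed
  define W where "W k = (\<chi> i. coeff (P i) k)" for k
  have Wd: "s ^ M *s (R (diag s) *v W k) = s ^ k *s W k" if "s \<noteq> 0" for s k
  proof -
    have "smult (s ^ M) (\<Sum>j\<in>UNIV. smult (R (diag s) $ i $ j) (P j)) = P i \<circ>\<^sub>p [:0, s:]" for i
    proof (rule poly_eq_nonzero)
      fix t :: complex assume "t \<noteq> 0"
      have "poly (smult (s ^ M) (\<Sum>j\<in>UNIV. smult (R (diag s) $ i $ j) (P j))) t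
        = (s * t) ^ M * (R (diag s) *v (R (diag t) *v v)) $ i"
        by (simp add: poly_sum matrix_vector_mult_def[of "R (diag s)"] power_mult_distrib sum_distrib_left mult_ac flip: P[OF \<open>t \<noteq> 0\<close>])
      also have "R (diag s) *v (R (diag t) *v v) = R (diag (s * t)) *v v"
        using that \<open>t \<noteq> 0\<close> by (simp add: diag_mult mult matrix_vector_mul_assoc)
      also have "(s * t) ^ M * (R (diag (s * t)) *v v) $ i = poly (P i) (s * t)"
        using that \<open>t \<noteq> 0\<close> by (intro P) simp
      finally show "poly (smult (s ^ M) (\<Sum>j\<in>UNIV. smult (R (diag s) $ i $ j) (P j))) t = poly (P i \<circ>\<^sub>p [:0, s:]) t"
        by (simp add: poly_pcompose mult.commute)
    qed
    then have "coeff (smult (s ^ M) (\<Sum>j\<in>UNIV. smult (R (diag s) $ i $ j) (P j))) k = coeff (P i \<circ>\<^sub>p [:0, s:]) k" for i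
      by simp
    then show ?thesis
      by (simp add: vec_eq_iff W_def matrix_vector_mult_def coeff_sum coeff_pcompose_linear)
  qed
  have Wu: "R (upper x) *v W k = W k" for x k
  proof -
    have "(\<Sum>j\<in>UNIV. smult (R (upper x) $ i $ j) (P j)) = P i" for i
    proof (rule poly_eq_nonzero)
      fix t :: complex assume t: "t \<noteq> 0"
      have "upper x ** diag t = diag t ** upper (x / t^2)"
        using t by (simp add: mat2_eq_iff mat2_mult upper_def diag_def power2_eq_square)
      then have "R (upper x ** diag t) *v v = R (diag t ** upper (x / t^2)) *v v" by simp
      then have e: "R (upper x) *v (R (diag t) *v v) = R (diag t) *v v"
        using t u[of "x / t^2"] by (simp add: mult flip: matrix_vector_mul_assoc)
      have "poly (\<Sum>j\<in>UNIV. smult (R (upper x) $ i $ j) (P j)) t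
        = t ^ M * (R (upper x) *v (R (diag t) *v v)) $ i"
        by (simp add: poly_sum matrix_vector_mult_def[of "R (upper x)"] sum_distrib_left mult_ac flip: P[OF t])
      then show "poly (\<Sum>j\<in>UNIV. smult (R (upper x) $ i $ j) (P j)) t = poly (P i) t"
        unfolding e using P[OF t] by simp
    qed
    then have "coeff (\<Sum>j\<in>UNIV. smult (R (upper x) $ i $ j) (P j)) k = coeff (P i) k" for i by simp
    then show ?thesis by (simp add: vec_eq_iff W_def matrix_vector_mult_def coeff_sum)
  qed
  have "W k = 0" if "k \<le> M" for k
    by (rule highest_weight_nonpositive[OF noinv Wu Wd that])
  then have "monom 1 (Suc M) dvd P i" for i
    unfolding monom_1_dvd_iff' by (auto simp: W_def vec_eq_iff less_Suc_eq_le)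
  then have "\<forall>i. \<exists>r. P i = monom 1 (Suc M) * r" by (auto elim!: dvdE)
  then obtain r where r: "\<And>i. P i = monom 1 (Suc M) * r i" by metis
  show ?thesis
  proof (rule that[of "\<lambda>i. [:0, 1:] * r i"])
    fix i and t :: complex assume "t \<noteq> 0"
    then show "(R (diag t) *v v) $ i = poly ([:0, 1:] * r i) t"
      using P[of t i] by (simp add: r poly_monom)
  qed simp
qed

text \<open>\<open>p\<close> is the length of the first column of \<open>h\<close>, and
  \<open>k\<close> is the element of \<open>SU(2)\<close> whose first column is that column
  normalized. Its four entries have modulus at most 1, which gives the bound 4.\<close>

lemma SL2_iwasawa:
  assumes "h \<in> SL2"
  obtains k and p :: real and x where "k \<in> SL2" "norm k \<le> 4" "p > 0" "h = k ** (diag (of_real p) ** upper x)"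
proof -
  let ?a = "h$1$1" and ?c = "h$2$1"
  define p where "p = sqrt ((norm ?a)\<^sup>2 + (norm ?c)\<^sup>2)"
  have "?a \<noteq> 0 \<or> ?c \<noteq> 0" using assms by (auto simp: mem_SL2_iff)
  then have pos: "(norm ?a)\<^sup>2 + (norm ?c)\<^sup>2 > 0"
    by (auto simp: sum_power2_gt_zero_iff)
  then have p: "p > 0" by (simp add: p_def)
  have "p\<^sup>2 = (norm ?a)\<^sup>2 + (norm ?c)\<^sup>2" using pos by (simp add: p_def)
  then have p2: "complex_of_real p * complex_of_real p = ?a * cnj ?a + ?c * cnj ?c"
    unfolding complex_norm_square[symmetric] power2_eq_square[symmetric]
    by (metis of_real_add of_real_power)
  have p0: "complex_of_real p \<noteq> 0" using p by simp
  define k where "k = mat2 (?a / p) (- cnj ?c / p) (?c / p) (cnj ?a / p)"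
  have k: "k \<in> SL2"
  proof -
    have "?a / p * (cnj ?a / p) - (- cnj ?c / p) * (?c / p) = (?a * cnj ?a + ?c * cnj ?c) / (of_real p * of_real p)"
      by (simp add: add_divide_distrib mult.commute)
    then show ?thesis using p0 by (simp add: k_def mem_SL2_iff flip: p2)
  qed
  have le: "norm ?a \<le> p" "norm ?c \<le> p"
    unfolding p_def by (simp_all add: real_le_rsqrt)
  have "norm k \<le> (\<Sum>i\<in>UNIV. \<Sum>j\<in>UNIV. norm (k$i$j))" by (rule norm_le_sum_entries)
  also have "\<dots> \<le> 4"
    using le p by (simp add: sum_2 k_def norm_divide) (simp add: divide_simps)
  finally have nk: "norm k \<le> 4" .
  define x where "x = (h$1$2 * cnj ?a + h$2$2 * cnj ?c) / (of_real p * of_real p)"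
  have "adj2 k ** h = diag (of_real p) ** upper x"
  proof -
    have d: "?a * h$2$2 = 1 + h$1$2 * ?c" using assms by (simp add: mem_SL2_iff algebra_simps)
    have "adj2 k ** h = mat2 ((?a * cnj ?a + ?c * cnj ?c) / p) ((h$1$2 * cnj ?a + h$2$2 * cnj ?c) / p)
        0 ((?a * h$2$2 - ?c * h$1$2) / p)"
      by (simp add: mat2_eq_iff mat2_mult adj2_def k_def add_divide_distrib diff_divide_distrib mult.commute)
    also have "\<dots> = mat2 p (p * x) 0 (1 / p)"
      using p0 d by (simp add: mat2_eq_iff x_def mult.commute flip: p2)
    finally show ?thesis by (simp add: mat2_eq_iff mat2_mult diag_def upper_def)
  qed
  then have "k ** (adj2 k ** h) = k ** (diag (of_real p) ** upper x)" by simp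
  then have "h = k ** (diag (of_real p) ** upper x)"
    using k by (simp add: matrix_mul_assoc adj2_mult)
  with k nk p show ?thesis by (rule that)
qed

text \<open>Every point of the orbit is \<open>R k *v f p\<close> with \<open>k\<close> in a bounded
  set and \<open>p > 0\<close>, where \<open>f\<close> extends the torus curve of \<open>v\<close>
  by \<open>f 0 = 0\<close>. Along a convergent sequence \<open>p\<close> stays bounded, and the
  limit lies in \<open>X\<close> or is 0 according to whether the limit of \<open>p\<close> is
  positive.\<close>

lemma highest_weight_orbit:
  assumes noinv: "\<And>w. (\<forall>h\<in>SL2. R h *v w = w) \<Longrightarrow> w = 0"
    and Ev: "dE *v v = 0" and M: "invertible M"
    and gX: "(\<lambda>x. M *v x + c) ` {R h *v v | h. h \<in> SL2} = {R h *v v | h. h \<in> SL2}"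
  shows "c = 0"
proof (cases "v = 0")
  case True
  have "{R h *v v | h. h \<in> SL2} = {0}" using True SL2_one by auto
  then show ?thesis using gX by simp
next
  case False
  define X where "X = {R h *v v | h. h \<in> SL2}"
  have u: "R (upper x) *v v = v" for x using Ev by (rule upper_fixed)
  obtain r where r: "\<And>i. poly (r i) 0 = 0" "\<And>i t. t \<noteq> 0 \<Longrightarrow> (R (diag t) *v v) $ i = poly (r i) t"
    using highest_weight_torus[OF noinv u] by blast
  define f where "f t = (\<chi> i. poly (r i) t)" for t
  have f0: "f 0 = 0" by (simp add: f_def r vec_eq_iff)
  have f: "f t = R (diag t) *v v" if "t \<noteq> 0" for t using r(2)[OF that] by (simp add: f_def vec_eq_iff)
  have f_lim: "((\<lambda>n. f (t n)) \<longlongrightarrow> f t0) F" if "(t \<longlongrightarrow> t0) F" for t t0 and F :: "nat filter"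
    unfolding f_def by (intro vec_tendstoI) (simp, intro tendsto_intros that)
  have "f 1 = v" using f[of 1] by (simp add: diag_def one flip: mat2_one)
  then obtain i0 where i0: "poly (r i0) 1 \<noteq> 0" using False by (auto simp: f_def vec_eq_iff)
  have inj0: "x = 0" if "R h *v x = 0" "h \<in> SL2" for h and x :: "complex^'n"
    using R_adj2(2)[OF that(2)] that(1) by (metis matrix_vector_mul_assoc matrix_vector_mul_lid matrix_vector_mult_0_right)
  have X0: "0 \<notin> X" using inj0[of _ v] False by (auto simp: X_def)
  have cl0: "0 \<in> closure X"
    unfolding closure_sequential
  proof (intro exI conjI allI)
    let ?t = "\<lambda>n. complex_of_real (inverse (real (Suc n)))"
    show "f (?t n) \<in> X" for n
    proof -
      have "?t n \<noteq> 0" by (simp only: of_real_eq_0_iff) simp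
      then show ?thesis using f[of "?t n"] diag_SL2[of "?t n"] unfolding X_def by blast
    qed
    have "?t \<longlonglongrightarrow> of_real 0" by (intro tendsto_of_real LIMSEQ_inverse_real_of_nat)
    then show "(\<lambda>n. f (?t n)) \<longlonglongrightarrow> 0" using f_lim[of ?t 0] f0 by simp
  qed
  have clX: "closure X \<subseteq> insert 0 X"
  proof
    fix y assume "y \<in> closure X"
    then obtain x where x: "\<And>n. x n \<in> X" "x \<longlonglongrightarrow> y" unfolding closure_sequential by blast
    have "\<forall>n. \<exists>k (p::real). k \<in> SL2 \<and> norm k \<le> 4 \<and> p > 0 \<and> x n = R k *v f (of_real p)"
    proof
      fix n
      obtain h where h: "h \<in> SL2" "x n = R h *v v" using x(1)[of n] by (auto simp: X_def)
      obtain k and p :: real and z where k: "k \<in> SL2" "norm k \<le> 4" "p > 0" "h = k ** (diag (of_real p) ** upper z)"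
        by (rule SL2_iwasawa[OF h(1)])
      have "x n = R k *v (R (diag (of_real p)) *v (R (upper z) *v v))"
        unfolding h k(4) using k by (simp add: mult SL2_mult matrix_vector_mul_assoc matrix_mul_assoc)
      then have "x n = R k *v f (of_real p)" using k(3) by (simp add: u f)
      then show "\<exists>k (p::real). k \<in> SL2 \<and> norm k \<le> 4 \<and> p > 0 \<and> x n = R k *v f (of_real p)" using k by blast
    qed
    then obtain k p where k: "\<And>n. k n \<in> SL2" "\<And>n. norm (k n) \<le> 4" and p: "\<And>n. p n > (0::real)"
      and xk: "\<And>n. x n = R (k n) *v f (of_real (p n))" by metis
    have "bounded (range k)" using k(2) by (auto simp: bounded_iff)
    then obtain k0 \<phi> where \<phi>: "strict_mono \<phi>" "(k \<circ> \<phi>) \<longlonglongrightarrow> k0"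
      using bounded_imp_convergent_subsequence by blast
    then have klim: "(\<lambda>n. k (\<phi> n)) \<longlonglongrightarrow> k0" by (simp add: o_def)
    have k0: "k0 \<in> SL2" using tendsto_det[OF klim] k(1) by (simp add: SL2_def LIMSEQ_const_iff)
    have adjlim: "(\<lambda>n. adj2 (k (\<phi> n))) \<longlonglongrightarrow> adj2 k0"
    proof (intro vec_tendstoI)
      fix i j :: 2
      show "(\<lambda>n. adj2 (k (\<phi> n)) $ i $ j) \<longlonglongrightarrow> adj2 k0 $ i $ j"
        using exhaust_2[of i] exhaust_2[of j] by (elim disjE; simp add: adj2_def) (intro tendsto_intros klim)+
    qed
    have "(\<lambda>n. x (\<phi> n)) \<longlonglongrightarrow> y" using LIMSEQ_subseq_LIMSEQ[OF x(2) \<phi>(1)] by (simp add: o_def)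
    then have "(\<lambda>n. R (adj2 (k (\<phi> n))) *v x (\<phi> n)) \<longlonglongrightarrow> R (adj2 k0) *v y"
      by (intro tendsto_mulv tendsto_R adjlim)
    moreover have "R (adj2 (k (\<phi> n))) *v x (\<phi> n) = f (of_real (p (\<phi> n)))" for n
      unfolding xk using k by (simp add: matrix_vector_mul_assoc R_adj2)
    ultimately have flim: "(\<lambda>n. f (of_real (p (\<phi> n)))) \<longlonglongrightarrow> R (adj2 k0) *v y" by simp
    then have "(\<lambda>n. f (of_real (p (\<phi> n))) $ i0) \<longlonglongrightarrow> (R (adj2 k0) *v y) $ i0" by (intro tendsto_vec_nth)
    then have "Bseq (\<lambda>n. f (of_real (p (\<phi> n))) $ i0)" by (intro convergent_imp_Bseq convergentI)
    then obtain B where B: "\<And>n. norm (f (of_real (p (\<phi> n))) $ i0) \<le> B" unfolding Bseq_def by blast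
    obtain a q where aq: "r i0 = pCons a q" by (rule pCons_cases)
    \<comment> \<open>The coordinate polynomial vanishes at 0 but not at 1, so it is nonconstant and
      unbounded; this bounds \<open>p\<close>.\<close>
    have "q \<noteq> 0" using i0 r(1)[of i0] by (auto simp: aq)
    from poly_infinity[OF this, of "B + 1" a]
    obtain \<rho> where \<rho>: "\<And>z. \<rho> \<le> norm z \<Longrightarrow> B + 1 \<le> norm (poly (r i0) z)" by (auto simp: aq)
    have "p (\<phi> n) \<le> \<rho>" for n
    proof (rule ccontr)
      assume "\<not> p (\<phi> n) \<le> \<rho>"
      then have "\<rho> \<le> norm (complex_of_real (p (\<phi> n)))" by simp
      from \<rho>[OF this] B[of n] show False by (simp add: f_def)
    qed
    then have "bounded (range (\<lambda>n. p (\<phi> n)))"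
      unfolding bounded_iff using p by (intro exI[of _ \<rho>]) (auto simp: less_imp_le)
    then obtain p0 \<psi> where \<psi>: "strict_mono \<psi>" "((\<lambda>n. p (\<phi> n)) \<circ> \<psi>) \<longlonglongrightarrow> p0"
      using bounded_imp_convergent_subsequence by blast
    then have "(\<lambda>n. complex_of_real (p (\<phi> (\<psi> n)))) \<longlonglongrightarrow> of_real p0" by (intro tendsto_of_real) (simp add: o_def)
    from f_lim[OF this] have "(\<lambda>n. f (of_real (p (\<phi> (\<psi> n))))) \<longlonglongrightarrow> f (of_real p0)" .
    moreover have "(\<lambda>n. f (of_real (p (\<phi> (\<psi> n))))) \<longlonglongrightarrow> R (adj2 k0) *v y"
      using LIMSEQ_subseq_LIMSEQ[OF flim \<psi>(1)] by (simp add: o_def)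
    ultimately have "f (of_real p0) = R (adj2 k0) *v y" by (rule LIMSEQ_unique)
    then have "R k0 *v f (of_real p0) = R k0 *v (R (adj2 k0) *v y)" by simp
    then have y: "y = R k0 *v f (of_real p0)" using k0 by (simp add: matrix_vector_mul_assoc R_adj2)
    show "y \<in> insert 0 X"
    proof (cases "p0 = 0")
      case True
      then show ?thesis by (simp add: y f0)
    next
      case False
      then have "y = R (k0 ** diag (of_real p0)) *v v"
        using k0 by (simp add: y f mult matrix_vector_mul_assoc)
      moreover have "k0 ** diag (of_real p0) \<in> SL2" using False k0 by (simp add: SL2_mult)
      ultimately show ?thesis by (auto simp: X_def)
    qed
  qed
  have gX': "(\<lambda>x. M *v x + c) ` X = X" using gX by (simp add: X_def)
  have "c \<in> closure X"
  proof -
    obtain x where x: "\<And>n. x n \<in> X" "x \<longlonglongrightarrow> 0" using cl0 unfolding closure_sequential by blast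
    have "(\<lambda>n. M *v x n + c) \<longlonglongrightarrow> M *v 0 + c"
      by (intro tendsto_add tendsto_mulv tendsto_const x)
    moreover have "M *v x n + c \<in> X" for n using x(1)[of n] gX' by blast
    ultimately show ?thesis unfolding closure_sequential by (auto intro!: exI[of _ "\<lambda>n. M *v x n + c"])
  qed
  then consider "c = 0" | "c \<in> X" using clX by blast
  then show ?thesis
  proof cases
    case 2
    \<comment> \<open>\<open>c\<close> is the image of 0, so a preimage of \<open>c\<close> in
      \<open>X\<close> would have to be 0, which is not in \<open>X\<close>.\<close>
    then obtain x where x: "x \<in> X" "M *v x + c = c" using gX' by (metis (mono_tags, lifting) imageE)
    then have "M *v x = 0" by simp
    then have "x = 0" using M unfolding invertible_def
      by (metis matrix_vector_mul_assoc matrix_vector_mul_lid matrix_vector_mult_0_right)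
    then show ?thesis using x X0 by simp
  qed
qed

end

section \<open>The orbit types\<close>

lemma polynomial_curve_mulv:
  assumes "\<And>j. polynomial_curve (\<lambda>t. x t $ j)"
  shows "polynomial_curve (\<lambda>t. (A *v x t) $ i)"
  by (simp add: matrix_vector_mult_def polynomial_curve_sum polynomial_curve_mult polynomial_curve_const assms)

lemma vec_polynomial_det:
  fixes L :: "complex^'n^'r" and E :: "'r \<Rightarrow> complex^'n^'n"
  shows "vec_polynomial (\<lambda>x. det (L ** (\<chi> i j. (E j *v x) $ i)))"
  unfolding vec_polynomial_def
proof (intro conjI allI impI)
  fix x :: "complex \<Rightarrow> complex^'n" assume "\<forall>i. polynomial_curve (\<lambda>t. x t $ i)"
  then have "polynomial_curve (\<lambda>t. (\<chi> i j. (E j *v x t) $ i) $ i $ j)" for i j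
    by (simp add: polynomial_curve_mulv)
  then show "polynomial_curve (\<lambda>t. det (L ** (\<chi> i j. (E j *v x t) $ i)))"
    by (intro polynomial_curve_det polynomial_curve_matmul polynomial_curve_const)
next
  fix x0 x' :: "complex^'n"
  let ?A = "\<lambda>x. L ** (\<chi> i j. (E j *v x) $ i)"
  show "\<exists>q. \<forall>x. x 0 = x0 \<longrightarrow> has_vderiv x x' 0 \<longrightarrow> ((\<lambda>t. det (?A (x t))) has_field_derivative q) (at 0)"
  proof (intro exI[of _ "det_deriv (?A x0) (?A x')"] allI impI)
    fix x assume x: "x 0 = x0" "has_vderiv x x' 0"
    have "has_vderiv (\<lambda>t. E j *v x t) (E j *v x') 0" for j
      by (rule has_vderiv_mult_left[OF x(2)])
    then have "has_mderiv (\<lambda>t. \<chi> i j. (E j *v x t) $ i) (\<chi> i j. (E j *v x') $ i) 0"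
      unfolding has_mderiv_def has_vderiv_def by simp
    then have "has_mderiv (\<lambda>t. ?A (x t)) (?A x') 0" by (rule has_mderiv_mult_left)
    from has_field_derivative_det[OF this]
    show "((\<lambda>t. det (?A (x t))) has_field_derivative det_deriv (?A x0) (?A x')) (at 0)"
      by (simp add: x)
  qed
qed

lemma vec_polynomial_mult:
  assumes "vec_polynomial f" "vec_polynomial g"
  shows "vec_polynomial (\<lambda>x. f x * g x)"
  unfolding vec_polynomial_def
proof (intro conjI allI impI)
  fix x :: "complex \<Rightarrow> complex^'a" assume "\<forall>i. polynomial_curve (\<lambda>t. x t $ i)"
  with assms show "polynomial_curve (\<lambda>t. f (x t) * g (x t))"
    unfolding vec_polynomial_def by (intro polynomial_curve_mult) blast+
next
  fix x0 x' :: "complex^'a"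
  obtain q where q: "\<And>x. x 0 = x0 \<Longrightarrow> has_vderiv x x' 0 \<Longrightarrow> ((\<lambda>t. f (x t)) has_field_derivative q) (at 0)"
    using assms(1) unfolding vec_polynomial_def by meson
  obtain r where r: "\<And>x. x 0 = x0 \<Longrightarrow> has_vderiv x x' 0 \<Longrightarrow> ((\<lambda>t. g (x t)) has_field_derivative r) (at 0)"
    using assms(2) unfolding vec_polynomial_def by meson
  show "\<exists>q. \<forall>x. x 0 = x0 \<longrightarrow> has_vderiv x x' 0 \<longrightarrow> ((\<lambda>t. f (x t) * g (x t)) has_field_derivative q) (at 0)"
  proof (intro exI[of _ "q * g x0 + r * f x0"] allI impI)
    fix x assume x: "x 0 = x0" "has_vderiv x x' 0"
    from DERIV_mult[OF q[OF x] r[OF x]]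
    show "((\<lambda>t. f (x t) * g (x t)) has_field_derivative q * g x0 + r * f x0) (at 0)" by (simp add: x)
  qed
qed

lemma vec_polynomial_diff:
  assumes "vec_polynomial f" "vec_polynomial g"
  shows "vec_polynomial (\<lambda>x. f x - g x)"
  unfolding vec_polynomial_def
proof (intro conjI allI impI)
  fix x :: "complex \<Rightarrow> complex^'a" assume "\<forall>i. polynomial_curve (\<lambda>t. x t $ i)"
  with assms show "polynomial_curve (\<lambda>t. f (x t) - g (x t))"
    unfolding vec_polynomial_def by (intro polynomial_curve_diff) blast+
next
  fix x0 x' :: "complex^'a"
  obtain q where q: "\<And>x. x 0 = x0 \<Longrightarrow> has_vderiv x x' 0 \<Longrightarrow> ((\<lambda>t. f (x t)) has_field_derivative q) (at 0)"
    using assms(1) unfolding vec_polynomial_def by meson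
  obtain r where r: "\<And>x. x 0 = x0 \<Longrightarrow> has_vderiv x x' 0 \<Longrightarrow> ((\<lambda>t. g (x t)) has_field_derivative r) (at 0)"
    using assms(2) unfolding vec_polynomial_def by meson
  show "\<exists>q. \<forall>x. x 0 = x0 \<longrightarrow> has_vderiv x x' 0 \<longrightarrow> ((\<lambda>t. f (x t) - g (x t)) has_field_derivative q) (at 0)"
    by (intro exI[of _ "q - r"] allI impI DERIV_diff q r)
qed

context sl2_rep
begin

lemma commutator: "D x y z ** D x' y' z' - D x' y' z' ** D x y z
    = D (2 * (z*x' - x*z')) (2 * (y*z' - z*y')) (x*y' - y*x')"
proof -
  have L: "(D x y z ** M) $ i $ j = x * (dE ** M)$i$j + y * (dF ** M)$i$j + z * (dH ** M)$i$j"
    and Rr: "(M ** D x y z) $ i $ j = x * (M ** dE)$i$j + y * (M ** dF)$i$j + z * (M ** dH)$i$j"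
    for M i j x y z
    by (simp_all add: D_def matrix_matrix_mult_def sum_distrib_left algebra_simps sum.distrib)
  have "dE ** dF = dF ** dE + dH" "dE ** dH = dH ** dE + D (-2) 0 0" "dF ** dH = dH ** dF + D 0 2 0"
    using comm_E[of 0 1 0] comm_E[of 0 0 1] comm_F[of 0 0 1] by (simp_all add: D_basis)
  then have "(dE ** dF)$i$j = (dF ** dE)$i$j + dH$i$j" "(dE ** dH)$i$j = (dH ** dE)$i$j - 2 * dE$i$j"
    "(dF ** dH)$i$j = (dH ** dF)$i$j + 2 * dF$i$j" for i j
    by (simp_all add: D_def)
  then show ?thesis
    by (simp add: vec_eq_iff L Rr) (simp add: D_def algebra_simps)
qed

lemma D_conj:
  assumes "h = mat2 a b c d" "h \<in> SL2"
  shows "D x y z ** R h = R h ** D (d^2*x - b^2*y + 2*b*d*z) (a^2*y - c^2*x - 2*a*c*z) ((a*d + b*c)*z - a*b*y + c*d*x)"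
proof -
  have "adj2 h = mat2 d (-b) (-c) a" by (simp add: assms adj2_def)
  from equivariance[OF this adj2_SL2[OF assms(2)], of x y z]
  have "R (adj2 h) ** D x y z = D (d^2*x - b^2*y + 2*b*d*z) (a^2*y - c^2*x - 2*a*c*z) ((a*d + b*c)*z - a*b*y + c*d*x) ** R (adj2 h)"
    by (simp add: mult_ac)
  then have "R h ** R (adj2 h) ** D x y z ** R h = R h ** D (d^2*x - b^2*y + 2*b*d*z) (a^2*y - c^2*x - 2*a*c*z) ((a*d + b*c)*z - a*b*y + c*d*x) ** (R (adj2 h) ** R h)"
    by (metis matrix_mul_assoc)
  then show ?thesis using assms(2) by (simp add: R_adj2)
qed

lemma D_conj_mulv:
  assumes "h = mat2 a b c d" "h \<in> SL2"
  shows "D x y z *v (R h *v v) = R h *v (D (d^2*x - b^2*y + 2*b*d*z) (a^2*y - c^2*x - 2*a*c*z) ((a*d + b*c)*z - a*b*y + c*d*x) *v v)"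
  using D_conj[OF assms, of x y z] by (simp add: matrix_vector_mul_assoc)

lemma linearization_sequence:
  assumes "\<And>n. A n \<in> SL2" "A \<longlonglongrightarrow> mat 1" "\<epsilon> > 0"
  shows "\<forall>\<^sub>F n in sequentially. norm (R (A n) *v v - v - D (A n$1$2) (A n$2$1) (A n$1$1 - 1) *v v)
      \<le> \<epsilon> * (norm (A n$1$2) + norm (A n$2$1) + norm (A n$1$1 - 1))"
proof -
  obtain \<delta> where d: "\<delta> > 0" "\<And>A. A \<in> SL2 \<Longrightarrow> norm (A - mat 1) < \<delta> \<Longrightarrow>
    norm (R A *v v - v - D (A$1$2) (A$2$1) (A$1$1 - 1) *v v)
      \<le> \<epsilon> * (norm (A$1$2) + norm (A$2$1) + norm (A$1$1 - 1))"
    using linearization[OF assms(3)] by blast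
  have "\<forall>\<^sub>F n in sequentially. dist (A n) (mat 1) < \<delta>"
    using assms(2) d(1) by (rule tendstoD)
  then show ?thesis
    by eventually_elim (use d(2) assms(1) in \<open>auto simp: dist_norm\<close>)
qed

text \<open>The frame is \<open>E\<close>, \<open>F\<close>, \<open>H\<close>, and the form is the
  minor \<open>L\<close> of \<open>Ex\<close>, \<open>Fx\<close>, \<open>Hx\<close>. It is invariant
  since the adjoint action has determinant 1; \<open>bracket\<close> holds since \<open>ad\<close>
  is traceless.\<close>

lemma orbit_finite_stabilizer:
  assumes noinv: "\<And>w. (\<forall>h\<in>SL2. R h *v w = w) \<Longrightarrow> w = 0"
    and ind: "\<And>x y z. D x y z *v v = 0 \<Longrightarrow> x = 0 \<and> y = 0 \<and> z = 0"
    and M: "invertible M"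
    and gX: "(\<lambda>x. M *v x + c) ` {R h *v v | h. h \<in> SL2} = {R h *v v | h. h \<in> SL2}"
  shows "c = 0"
proof -
  define ex ey ez where "ex j = (of_bool (j = 1) :: complex)" and "ey j = (of_bool (j = 2) :: complex)"
    and "ez j = (of_bool (j = 3) :: complex)" for j :: 3
  note e_defs = ex_def ey_def ez_def
  define P where "P = (\<chi> i j. (D (ex j) (ey j) (ez j) *v v) $ i)"
  have Pq: "P *v q = D (q$1) (q$2) (q$3) *v v" for q
    unfolding P_def e_defs
    by (simp add: D_mulv vec_eq_iff matrix_vector_mult_def[of "\<chi> i j. _ i j"] sum_3 D_def algebra_simps sum.distrib sum_distrib_left)
  have "\<forall>q. P *v q = 0 \<longrightarrow> q = 0"
  proof (intro allI impI)
    fix q assume "P *v q = 0"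
    then show "q = 0" using ind[of "q$1" "q$2" "q$3"] by (simp add: Pq) (simp add: vec_eq_iff forall_3)
  qed
  then obtain lam where lam: "lam ** P = mat 1"
    unfolding matrix_left_invertible_ker[symmetric] by blast
  have lamP: "lam *v (P *v q) = q" for q by (simp add: matrix_vector_mul_assoc lam)
  define q3 where "q3 x y z = (\<chi> j::3. if j = 1 then x else if j = 2 then y else z)" for x y z :: complex
  have q3: "q3 x y z $ 1 = x" "q3 x y z $ 2 = y" "q3 x y z $ 3 = z" for x y z
    by (simp_all add: q3_def)
  have Dq: "D x y z *v v = P *v q3 x y z" for x y z by (simp add: Pq q3)
  interpret framed_orbit R v ex ey ez P lam
  proof
    show "P = (\<chi> i j. (D (ex j) (ey j) (ez j) *v v) $ i)" by (rule P_def)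
    show "lam ** P = mat 1" by (rule lam)
    show "D x y z *v v = P *v (lam *v (D x y z *v v))" for x y z by (simp only: Dq lamP)
    show "(\<Sum>j\<in>UNIV. (lam *v ((D (ex j) (ey j) (ez j) ** D (ex k) (ey k) (ez k)
        - D (ex k) (ey k) (ez k) ** D (ex j) (ey j) (ez j)) *v v)) $ j) = 0" for k
      unfolding commutator Dq lamP
      using exhaust_3[of k] by (auto simp: sum_3 q3 e_defs)
    show "\<exists>p e. (\<forall>n. R (A n) *v v = v + P *v p n + e n) \<and>
          (\<forall>\<epsilon>>0. \<forall>\<^sub>F n in sequentially. norm (e n) \<le> \<epsilon> * norm (p n :: complex^3))"
      if A: "\<And>n. A n \<in> SL2" "A \<longlonglongrightarrow> mat 1" for A
    proof (intro exI conjI allI impI)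
      define p where "p n = q3 (A n$1$2) (A n$2$1) (A n$1$1 - 1)" for n
      define e where "e n = R (A n) *v v - v - P *v p n" for n
      show "R (A n) *v v = v + P *v p n + e n" for n by (simp add: e_def)
      fix \<epsilon> :: real assume "\<epsilon> > 0"
      then have "\<forall>\<^sub>F n in sequentially. norm (R (A n) *v v - v - D (A n$1$2) (A n$2$1) (A n$1$1 - 1) *v v)
          \<le> \<epsilon>/3 * (norm (A n$1$2) + norm (A n$2$1) + norm (A n$1$1 - 1))"
        by (intro linearization_sequence A) simp
      then show "\<forall>\<^sub>F n in sequentially. norm (e n) \<le> \<epsilon> * norm (p n)"
      proof eventually_elim
        case (elim n)
        have "norm (p n $ 1) + norm (p n $ 2) + norm (p n $ 3) \<le> 3 * norm (p n)"
          using Finite_Cartesian_Product.norm_nth_le[of "p n" 1] Finite_Cartesian_Product.norm_nth_le[of "p n" 2]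
            Finite_Cartesian_Product.norm_nth_le[of "p n" 3] by linarith
        then have "\<epsilon>/3 * (norm (p n $ 1) + norm (p n $ 2) + norm (p n $ 3)) \<le> \<epsilon>/3 * (3 * norm (p n))"
          using \<open>\<epsilon> > 0\<close> by (intro mult_left_mono) auto
        with elim show ?case by (simp add: e_def Dq p_def q3)
      qed
    qed
    show "\<exists>Q. vec_polynomial Q \<and> (\<forall>h\<in>SL2. Q (R h *v v) = (det (L ** R h ** P))\<^sup>2)" for L
    proof (intro exI conjI ballI)
      let ?Q = "\<lambda>x. det (L ** (\<chi> i j. (D (ex j) (ey j) (ez j) *v x) $ i))"
      show "vec_polynomial (\<lambda>x. ?Q x * ?Q x)"
        by (intro vec_polynomial_mult vec_polynomial_det)
      fix h assume h: "h \<in> SL2"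
      obtain a b c d where abcd: "h = mat2 a b c d" by (metis mat2_eq_iff mat2_nth)
      have det: "a*d - b*c = 1" using h by (simp add: abcd mem_SL2_iff)
      \<comment> \<open>The columns of the adjoint action of \<open>h^-1\<close> in the basis
        \<open>E\<close>, \<open>F\<close>, \<open>H\<close>.\<close>
      define q where "q j = (if j = 1 then q3 (d^2) (-(c^2)) (c*d) else if j = 2 then q3 (-(b^2)) (a^2) (-(a*b))
          else q3 (2*b*d) (-(2*a*c)) (a*d + b*c))" for j :: 3
      have "D (ex j) (ey j) (ez j) *v (R h *v v) = (R h ** P) *v q j" for j
        using exhaust_3[of j] unfolding D_conj_mulv[OF abcd h] Dq matrix_vector_mul_assoc[symmetric]
        by (auto simp: q_def e_defs)
      then have "(\<chi> i j. (D (ex j) (ey j) (ez j) *v (R h *v v)) $ i) = R h ** P ** (\<chi> i j. q j $ i)"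
        unfolding matmul_columns by simp
      then have "?Q (R h *v v) = det (L ** R h ** P) * det (\<chi> i j. q j $ i)"
        by (simp add: det_mul[symmetric] matrix_mul_assoc)
      moreover have "det (\<chi> i j. q j $ i) = (a*d - b*c)^3"
        by (simp add: det_3 q_def q3) (simp add: power3_eq_cube power2_eq_square algebra_simps)
      ultimately show "?Q (R h *v v) * ?Q (R h *v v) = (det (L ** R h ** P))\<^sup>2"
        by (simp add: det power2_eq_square)
    qed
  qed
  from affine_stabilizer_linear[OF noinv M] gX show ?thesis by (simp add: X_def)
qed

text \<open>The frame is \<open>E\<close>, \<open>F\<close>; their bracket \<open>H\<close> kills
  \<open>v\<close>. The minor of \<open>Ex\<close> and \<open>Fx\<close> alone is not an invariant
  form, since conjugation mixes in \<open>H\<close>.\<close>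

lemma orbit_torus_stabilizer:
  assumes noinv: "\<And>w. (\<forall>h\<in>SL2. R h *v w = w) \<Longrightarrow> w = 0"
    and Hv: "dH *v v = 0" and ind: "\<And>x y. D x y 0 *v v = 0 \<Longrightarrow> x = 0 \<and> y = 0"
    and M: "invertible M"
    and gX: "(\<lambda>x. M *v x + c) ` {R h *v v | h. h \<in> SL2} = {R h *v v | h. h \<in> SL2}"
  shows "c = 0"
proof -
  define ex ey ez where "ex j = (of_bool (j = 1) :: complex)" and "ey j = (of_bool (j = 2) :: complex)"
    and "ez j = (0 :: complex)" for j :: 2
  note e_defs = ex_def ey_def ez_def
  define P where "P = (\<chi> i j. (D (ex j) (ey j) (ez j) *v v) $ i)"
  have Pq: "P *v q = D (q$1) (q$2) 0 *v v" for q
    unfolding P_def e_defs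
    by (simp add: D_mulv vec_eq_iff matrix_vector_mult_def[of "\<chi> i j. _ i j"] sum_2 D_def algebra_simps sum.distrib sum_distrib_left)
  have "\<forall>q. P *v q = 0 \<longrightarrow> q = 0"
  proof (intro allI impI)
    fix q assume "P *v q = 0"
    then show "q = 0" using ind[of "q$1" "q$2"] by (simp add: Pq) (simp add: vec_eq_iff forall_2)
  qed
  then obtain lam where lam: "lam ** P = mat 1"
    unfolding matrix_left_invertible_ker[symmetric] by blast
  have lamP: "lam *v (P *v q) = q" for q by (simp add: matrix_vector_mul_assoc lam)
  define q2 where "q2 x y = (\<chi> j::2. if j = 1 then x else y)" for x y :: complex
  have q2: "q2 x y $ 1 = x" "q2 x y $ 2 = y" for x y
    by (simp_all add: q2_def)
  have Dq: "D x y z *v v = P *v q2 x y" for x y z by (simp add: Pq q2 D_mulv Hv)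
  interpret framed_orbit R v ex ey ez P lam
  proof
    show "P = (\<chi> i j. (D (ex j) (ey j) (ez j) *v v) $ i)" by (rule P_def)
    show "lam ** P = mat 1" by (rule lam)
    show "D x y z *v v = P *v (lam *v (D x y z *v v))" for x y z by (simp only: Dq lamP)
    show "(\<Sum>j\<in>UNIV. (lam *v ((D (ex j) (ey j) (ez j) ** D (ex k) (ey k) (ez k)
        - D (ex k) (ey k) (ez k) ** D (ex j) (ey j) (ez j)) *v v)) $ j) = 0" for k
      unfolding commutator Dq lamP
      by (auto simp: sum_2 q2 e_defs)
    show "\<exists>p e. (\<forall>n. R (A n) *v v = v + P *v p n + e n) \<and>
          (\<forall>\<epsilon>>0. \<forall>\<^sub>F n in sequentially. norm (e n) \<le> \<epsilon> * norm (p n :: complex^2))"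
      if A: "\<And>n. A n \<in> SL2" "A \<longlonglongrightarrow> mat 1" for A
    proof (intro exI conjI allI impI)
      \<comment> \<open>The torus fixes \<open>v\<close>, so \<open>A n\<close> may be multiplied on
        the right by a diagonal matrix that makes its upper left entry 1; the third coordinate of
        the linearization then vanishes. The default 1 covers the indices where the entry is 0,
        which eventually do not occur.\<close>
      define a where "a n = (if A n$1$1 = 0 then 1 else A n$1$1)" for n
      define A' where "A' n = A n ** diag (1 / a n)" for n
      have a0: "a n \<noteq> 0" for n by (simp add: a_def)
      have A': "A' n \<in> SL2" for n using A a0 by (simp add: A'_def SL2_mult)
      have RA': "R (A' n) *v v = R (A n) *v v" for n
        using A a0 diag_fixed[OF Hv, of "1 / a n"] by (simp add: A'_def mult flip: matrix_vector_mul_assoc)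
      have A11: "(\<lambda>n. A n$1$1) \<longlonglongrightarrow> 1" using tendsto_vec_nth[OF tendsto_vec_nth[OF A(2)], of 1 1] by (simp add: mat2_one)
      have ev: "\<forall>\<^sub>F n in sequentially. A n$1$1 \<noteq> 0"
        using A11 by (rule tendsto_imp_eventually_ne) simp
      have alim: "a \<longlonglongrightarrow> 1"
        by (rule Lim_transform_eventually[OF A11]) (use ev in \<open>eventually_elim, simp add: a_def\<close>)
      have "(\<lambda>n. diag (1 / a n)) \<longlonglongrightarrow> diag (1 / 1)"
      proof (intro vec_tendstoI)
        fix i j :: 2
        show "(\<lambda>n. diag (1 / a n) $ i $ j) \<longlonglongrightarrow> diag (1/1) $ i $ j"
          using exhaust_2[of i] exhaust_2[of j]
          by (elim disjE; simp add: diag_def alim) (use tendsto_inverse[OF alim] in \<open>simp add: inverse_eq_divide\<close>)+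
      qed
      then have A'lim: "A' \<longlonglongrightarrow> mat 1"
        unfolding A'_def using tendsto_matmul[OF A(2)] by (fastforce simp: diag_def mat2_one[symmetric])
      define p where "p n = q2 (A' n$1$2) (A' n$2$1)" for n
      define e where "e n = R (A n) *v v - v - P *v p n" for n
      show "R (A n) *v v = v + P *v p n + e n" for n by (simp add: e_def)
      fix \<epsilon> :: real assume "\<epsilon> > 0"
      then have "\<forall>\<^sub>F n in sequentially. norm (R (A' n) *v v - v - D (A' n$1$2) (A' n$2$1) (A' n$1$1 - 1) *v v)
          \<le> \<epsilon>/2 * (norm (A' n$1$2) + norm (A' n$2$1) + norm (A' n$1$1 - 1))"
        by (intro linearization_sequence A' A'lim) simp
      then show "\<forall>\<^sub>F n in sequentially. norm (e n) \<le> \<epsilon> * norm (p n)"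
        using ev
      proof eventually_elim
        case (elim n)
        have one: "A' n $ 1 $ 1 = 1" using elim(2) by (simp add: A'_def mat2_mult diag_def a_def)
        have "norm (p n $ 1) + norm (p n $ 2) \<le> 2 * norm (p n)"
          using Finite_Cartesian_Product.norm_nth_le[of "p n" 1] Finite_Cartesian_Product.norm_nth_le[of "p n" 2] by linarith
        then have "\<epsilon>/2 * (norm (p n $ 1) + norm (p n $ 2)) \<le> \<epsilon>/2 * (2 * norm (p n))"
          using \<open>\<epsilon> > 0\<close> by (intro mult_left_mono) auto
        with elim(1) show ?case by (simp add: e_def Dq p_def q2 RA' one)
      qed
    qed
    show "\<exists>Q. vec_polynomial Q \<and> (\<forall>h\<in>SL2. Q (R h *v v) = (det (L ** R h ** P))\<^sup>2)" for L
    proof (intro exI conjI ballI)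
      let ?W = "\<lambda>\<xi> \<zeta> x. det (L ** (\<chi> i (j::2). ((if j = 1 then \<xi> else \<zeta>) *v x) $ i))"
      \<comment> \<open>Up to a scalar, the invariant quadratic form of the Lie algebra, carried to
        its exterior square by the bracket, which sends the pairs \<open>(E,F)\<close>,
        \<open>(H,E)\<close>, \<open>(H,F)\<close> to \<open>H\<close>, \<open>2E\<close>,
        \<open>-2F\<close>. At \<open>v\<close> only the first square remains because
        \<open>Hv = 0\<close>.\<close>
      let ?Q = "\<lambda>x. ?W (D 1 0 0) (D 0 1 0) x * ?W (D 1 0 0) (D 0 1 0) x - ?W (D 0 0 1) (D 1 0 0) x * ?W (D 0 0 1) (D 0 1 0) x"
      show "vec_polynomial ?Q"
        by (intro vec_polynomial_diff vec_polynomial_mult vec_polynomial_det)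
      fix h assume h: "h \<in> SL2"
      obtain a b c d where abcd: "h = mat2 a b c d" by (metis mat2_eq_iff mat2_nth)
      have det: "a*d - b*c = 1" using h by (simp add: abcd mem_SL2_iff)
      let ?\<delta> = "det (L ** R h ** P)"
      have W: "?W \<xi> \<zeta> (R h *v v) = ?\<delta> * (x*y' - x'*y)"
        if "\<xi> *v (R h *v v) = R h *v (P *v q2 x y)" "\<zeta> *v (R h *v v) = R h *v (P *v q2 x' y')" for \<xi> \<zeta> x y x' y'
      proof -
        define q where "q j = (if j = 1 then q2 x y else q2 x' y')" for j :: 2
        have "(if j = 1 then \<xi> else \<zeta>) *v (R h *v v) = (R h ** P) *v q j" for j
          using that by (simp add: q_def matrix_vector_mul_assoc matrix_mul_assoc)
        then have "(\<chi> i j. ((if j = 1 then \<xi> else \<zeta>) *v (R h *v v)) $ i) = R h ** P ** (\<chi> i j. q j $ i)"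
          unfolding matmul_columns by simp
        then have "?W \<xi> \<zeta> (R h *v v) = ?\<delta> * det (\<chi> i j. q j $ i)"
          by (simp add: det_mul[symmetric] matrix_mul_assoc)
        also have "det (\<chi> i j. q j $ i) = x*y' - x'*y" by (simp add: det_2 q_def q2)
        finally show ?thesis .
      qed
      have E: "D 1 0 0 *v (R h *v v) = R h *v (P *v q2 (d^2) (-(c^2)))"
        and F: "D 0 1 0 *v (R h *v v) = R h *v (P *v q2 (-(b^2)) (a^2))"
        and H: "D 0 0 1 *v (R h *v v) = R h *v (P *v q2 (2*b*d) (-(2*a*c)))"
        unfolding D_conj_mulv[OF abcd h] Dq by simp_all
      have "?Q (R h *v v) = ?\<delta>\<^sup>2 * ((d^2*a^2 - b^2*c^2)^2 - (2*a*c*d^2 - 2*b*d*c^2) * (2*b*d*a^2 - 2*a*c*b^2))"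
        unfolding W[OF E F] W[OF H E] W[OF H F] by (simp add: power2_eq_square algebra_simps)
      also have "(d^2*a^2 - b^2*c^2)^2 - (2*a*c*d^2 - 2*b*d*c^2) * (2*b*d*a^2 - 2*a*c*b^2) = (a*d - b*c)^4"
        by (simp add: power2_eq_square power4_eq_xxxx algebra_simps)
      finally show "?Q (R h *v v) = ?\<delta>\<^sup>2" by (simp add: det)
    qed
  qed
  from affine_stabilizer_linear[OF noinv M] gX show ?thesis by (simp add: X_def)
qed

lemma orbit_translate:
  assumes "g \<in> SL2"
  shows "{R h *v (R g *v v) | h. h \<in> SL2} = {R h *v v | h. h \<in> SL2}"
proof -
  have "R h *v (R g *v v) = R (h ** g) *v v" "R h *v v = R (h ** adj2 g) *v (R g *v v)" if "h \<in> SL2" for h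
    using assms that by (simp_all add: mult SL2_mult adj2_SL2 matrix_vector_mul_assoc) (simp add: R_adj2 assms flip: matrix_mul_assoc)
  then show ?thesis using assms SL2_mult adj2_SL2 by (smt (verit) Collect_cong)
qed

text \<open>The lower row \<open>(c, d)\<close> of the conjugating matrix is a zero of a binary quadratic form,
  which makes the conjugated element upper triangular.\<close>

lemma orbit_representative:
  assumes "D x y z *v v = 0" "\<not> (x = 0 \<and> y = 0 \<and> z = 0)"
  shows "\<exists>g\<in>SL2. dE *v (R g *v v) = 0 \<or> dH *v (R g *v v) = 0"
proof -
  obtain a b c d where det: "a*d - b*c = 1" and q: "d^2*y + 2*c*d*z - c^2*x = 0"
  proof (cases "y = 0")
    case True
    then show ?thesis using that[of 1 1 0 0] by simp
  next
    case False
    define d where "d = (- z + csqrt (z^2 + x*y)) / y"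
    have "y * (d^2*y + 2*d*z - x) = (y*d + z)^2 - (z^2 + x*y)"
      by (simp add: power2_eq_square algebra_simps)
    also have "y*d + z = csqrt (z^2 + x*y)" using False by (simp add: d_def)
    finally have "d^2*y + 2*d*z - x = 0" using False by simp
    then show ?thesis using that[of 0 d "-1" 1] by simp
  qed
  define g where "g = mat2 a b c d"
  have g: "g \<in> SL2" using det by (simp add: g_def mem_SL2_iff)
  define x' z' where "x' = a^2*x - b^2*y - 2*a*b*z" and "z' = (a*d + b*c)*z + b*d*y - a*c*x"
  have "D x' 0 z' ** R g = R g ** D x y z"
  proof -
    have "d^2*y - c^2*x + 2*c*d*z = 0" using q by algebra
    then show ?thesis using equivariance[OF g_def g, of x y z] by (simp only: x'_def z'_def)
  qed
  then have D0: "D x' 0 z' *v (R g *v v) = 0"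
    using assms(1) by (simp add: matrix_vector_mul_assoc) (simp flip: matrix_vector_mul_assoc)
  show ?thesis
  proof (cases "z' = 0")
    case True
    \<comment> \<open>Otherwise the conjugated element is 0, and conjugating back, as the identities
      below do, makes the original element 0.\<close>
    have "x' \<noteq> 0"
    proof
      assume "x' = 0"
      have "d^2*x' - b^2*(d^2*y + 2*c*d*z - c^2*x) + 2*b*d*z' = (a*d - b*c)^2 * x"
        "a^2*(d^2*y + 2*c*d*z - c^2*x) - c^2*x' - 2*a*c*z' = (a*d - b*c)^2 * y"
        "(a*d + b*c)*z' - a*b*(d^2*y + 2*c*d*z - c^2*x) + c*d*x' = (a*d - b*c)^2 * z"
        by (simp_all add: x'_def z'_def power2_eq_square algebra_simps)
      then have "x = 0 \<and> y = 0 \<and> z = 0"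
        unfolding q \<open>x' = 0\<close> True det by simp
      then show False using assms(2) by blast
    qed
    then have "dE *v (R g *v v) = 0" using D0 True by (simp add: D_mulv vec_eq_iff)
    then show ?thesis using g by blast
  next
    case False
    \<comment> \<open>Conjugation by \<open>upper s\<close> with this value removes the nilpotent
      part, leaving a multiple of \<open>H\<close>.\<close>
    define s where "s = x' / (2*z')"
    have "R (upper s) ** D x' 0 z' = D (x' - 2 * s * z') 0 z' ** R (upper s)"
      using equivariance[OF upper_def upper_SL2, of s x' 0 z'] by simp
    moreover have "x' - 2 * s * z' = 0" using False by (simp add: s_def)
    ultimately have "D 0 0 z' ** R (upper s) = R (upper s) ** D x' 0 z'" by metis
    then have "D 0 0 z' *v (R (upper s) *v (R g *v v)) = R (upper s) *v (D x' 0 z' *v (R g *v v))"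
      by (metis matrix_vector_mul_assoc)
    then have "D 0 0 z' *v (R (upper s) *v (R g *v v)) = 0"
      by (simp only: D0 matrix_vector_mult_0_right)
    moreover have "R (upper s ** g) *v v = R (upper s) *v (R g *v v)"
      using g by (simp add: mult matrix_vector_mul_assoc)
    ultimately have "z' *s (dH *v (R (upper s ** g) *v v)) = 0"
      by (simp add: D_mulv)
    then have "dH *v (R (upper s ** g) *v v) = 0" using False by (simp add: vec_eq_iff)
    then show ?thesis using g SL2_mult upper_SL2 by blast
  qed
qed

text \<open>The cases follow the Lie algebra of the stabilizer: zero, or containing \<open>E\<close>
  or \<open>H\<close> after a translation of the base point. If it contains \<open>H\<close> and
  \<open>F\<close>, \<open>weyl\<close> exchanges \<open>F\<close> with \<open>E\<close> up to sign;
  if it contains \<open>H\<close> but neither \<open>E\<close> nor \<open>F\<close>, the torus case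
  applies.\<close>

theorem orbit_affine_stabilizer_linear:
  assumes noinv: "\<And>w. (\<forall>h\<in>SL2. R h *v w = w) \<Longrightarrow> w = 0"
    and M: "invertible M"
    and gX: "(\<lambda>x. M *v x + c) ` {R h *v v | h. h \<in> SL2} = {R h *v v | h. h \<in> SL2}"
  shows "c = 0"
proof (cases "\<exists>x y z. D x y z *v v = 0 \<and> \<not> (x = 0 \<and> y = 0 \<and> z = 0)")
  case False
  then show ?thesis using orbit_finite_stabilizer[OF noinv _ M gX] by blast
next
  case True
  then obtain g where g: "g \<in> SL2" "dE *v (R g *v v) = 0 \<or> dH *v (R g *v v) = 0"
    using orbit_representative by blast
  define w where "w = R g *v v"
  have gw: "(\<lambda>x. M *v x + c) ` {R h *v w | h. h \<in> SL2} = {R h *v w | h. h \<in> SL2}"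
    using gX orbit_translate[OF g(1)] by (simp add: w_def)
  show ?thesis
  proof (cases "dE *v w = 0")
    case True
    from highest_weight_orbit[OF noinv this M gw] show ?thesis .
  next
    case E: False
    then have H: "dH *v w = 0" using g by (simp add: w_def)
    show ?thesis
    proof (cases "dF *v w = 0")
      case True
      have "D 1 0 0 *v (R weyl *v w) = R weyl *v (D 0 (-1) 0 *v w)"
        using D_conj_mulv[OF weyl_def weyl_SL2, of 1 0 0 w] by simp
      then have "dE *v (R weyl *v w) = 0" using True by (simp add: D_basis D_mulv)
      moreover have "(\<lambda>x. M *v x + c) ` {R h *v (R weyl *v w) | h. h \<in> SL2} = {R h *v (R weyl *v w) | h. h \<in> SL2}"
        using gw orbit_translate[OF weyl_SL2] by simp
      ultimately show ?thesis using highest_weight_orbit[OF noinv _ M] by blast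
    next
      case F: False
      have "x = 0 \<and> y = 0" if "D x y 0 *v w = 0" for x y
      proof -
        \<comment> \<open>\<open>Ew\<close> and \<open>Fw\<close> are nonzero eigenvectors of
          \<open>H\<close> for the eigenvalues 2 and -2, hence independent.\<close>
        have "D 0 0 1 ** D x y 0 - D x y 0 ** D 0 0 1 = D (2*x) (-(2*y)) 0"
          by (simp add: commutator)
        then have "(D 0 0 1 ** D x y 0 - D x y 0 ** D 0 0 1) *v w = D (2*x) (-(2*y)) 0 *v w" by simp
        then have "D (2*x) (-(2*y)) 0 *v w = 0"
          using that H by (simp add: D_basis matrix_vector_mult_diff_rdistrib flip: matrix_vector_mul_assoc)
        then have 1: "(2*x) * (dE *v w)$i - (2*y) * (dF *v w)$i = 0" and 2: "x * (dE *v w)$i + y * (dF *v w)$i = 0" for i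
          using that by (auto simp: D_mulv vec_eq_iff)
        have "x * (dE *v w)$i = 0 \<and> y * (dF *v w)$i = 0" for i
        proof -
          have "p = 0 \<and> q = 0" if "2 * p - 2 * q = 0" "p + q = 0" for p q :: complex using that by auto
          from this[of "x * (dE *v w)$i" "y * (dF *v w)$i"] show ?thesis
            using 1[of i] 2[of i] by (simp only: mult.assoc)
        qed
        then have "x *s (dE *v w) = 0" "y *s (dF *v w) = 0" by (simp_all only: vec_eq_iff vector_smult_component zero_index) simp_all
        then show ?thesis using E F by (auto simp: vec_eq_iff)
      qed
      then show ?thesis using orbit_torus_stabilizer[OF noinv H _ M gw] by blast
    qed
  qed
qed

end

theorem theorem3p14:
  fixes \<rho> :: "complex^2^2 \<Rightarrow> complex^'n^'n" and v :: "complex^'n"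
  assumes "SL2_module \<rho>"
    and "\<forall>w. (\<forall>h\<in>SL2. \<rho> h *v w = w) \<longrightarrow> w = 0"
  shows "\<forall>(M, c)\<in>affine_stabilizer (SL2_orbit \<rho> v). c = 0"
proof -
  have "\<exists>g. polyfun2 g \<and> (\<forall>A\<in>SL2. g A = \<rho> A $ i $ j)" for i j
    using assms(1) unfolding SL2_module_def by (intro regular_on_SL2_polyfun2) blast
  then obtain g where g: "\<And>i j. polyfun2 (g i j)" "\<And>i j A. A \<in> SL2 \<Longrightarrow> g i j A = \<rho> A $ i $ j"
    by metis
  \<comment> \<open>A polynomial extension of \<open>\<rho>\<close> to all matrices; the orbit and
    the invariants involve only values on \<open>SL2\<close>.\<close>
  define R where "R A = (\<chi> i j. g i j A)" for A
  have R: "R A = \<rho> A" if "A \<in> SL2" for A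
    using g(2)[OF that] by (simp add: R_def vec_eq_iff)
  interpret sl2_rep R
  proof
    show "polyfun2 (\<lambda>A. R A $ i $ j)" for i j by (simp add: R_def g)
    show "R (A ** B) = R A ** R B" if "A \<in> SL2" "B \<in> SL2" for A B
      using assms(1) that by (simp add: R SL2_mult SL2_module_def)
    show "R (mat 1) = mat 1" using assms(1) by (simp add: R SL2_one SL2_module_def)
  qed
  have orbit: "SL2_orbit \<rho> v = {R h *v v | h. h \<in> SL2}"
    unfolding SL2_orbit_def using R by force
  have noinv: "w = 0" if "\<forall>h\<in>SL2. R h *v w = w" for w
    using assms(2) that R by simp
  show ?thesis
    unfolding affine_stabilizer_def orbit
    using orbit_affine_stabilizer_linear[OF noinv] by auto
qed

end
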